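(* Let $k\geq 2$ be an integer. There exist a multiplicative function $f:\mathbb{N}\to\{-1,0,1\}$ supported on the $k$-free integers, with $f(p)\in\{-1,1\}$ for every prime $p$, and a constant $c>0$ such that $$\sum_{n\leq x}f(n)\ll\frac{x^{1/k}}{\exp\left(c(\log x)^{1/4}\right)}.$$
   Context: $\mathbb{N}$ is the set of positive integers. For an integer $k\ge 2$, an integer $n$ is $k$-free if it is not divisible by $p^k$ for any prime $p$. A function $f:\mathbb{N}\to\mathbb{C}$ is multiplicative if $f(nm)=f(n)f(m)$ whenever $\gcd(n,m)=1$. $f$ is supported on the $k$-free integers if $f(n)=0$ whenever $n$ is not $k$-free. The notation $F(x)\ll G(x)$ means that there is a constant $C>0$ such that $|F(x)|\leq C|G(x)|$ for all sufficiently large real $x>0$. *)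

theory Defs
  imports
    Complex_Main
    "HOL-Computational_Algebra.Primes"
    "HOL-Library.Landau_Symbols"
begin

text \<open>
  Arithmetic functions on the positive integers are represented by functions on
  \<^typ>\<open>nat\<close>; all conditions are restricted to positive arguments, so the value at
  \<^term>\<open>0 :: nat\<close> is irrelevant.
\<close>

definition k_free :: "nat \<Rightarrow> nat \<Rightarrow> bool" where
  "k_free k n \<longleftrightarrow> (\<forall>p. prime p \<longrightarrow> \<not> p ^ k dvd n)"

text \<open>
  The value \<open>f 1 = 1\<close> is not part of the definition: it follows as soon as \<open>f\<close> is nonzero
  at some positive integer, e.g. at a prime.
\<close>
definition multiplicative :: "(nat \<Rightarrow> complex) \<Rightarrow> bool" where
  "multiplicative f \<longleftrightarrow> (\<forall>n>0. \<forall>m>0. coprime n m \<longrightarrow> f (n * m) = f n * f m)"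

definition supported_on_k_free :: "nat \<Rightarrow> (nat \<Rightarrow> complex) \<Rightarrow> bool" where
  "supported_on_k_free k f \<longleftrightarrow> (\<forall>n>0. \<not> k_free k n \<longrightarrow> f n = 0)"

end

theory Submission
  imports
    Defs
    "HOL-Computational_Algebra.Squarefree"
    "HOL-Complex_Analysis.Complex_Analysis"
    "HOL-Probability.Probability"
    "HOL-Real_Asymp.Real_Asymp"
begin

text \<open>
  Let \<open>g\<close> be the completely multiplicative function that agrees with the nonprincipal character
  modulo 3 away from 3 and has \<open>g(3) = 1\<close>. Its partial sum up to \<open>N\<close> counts the digits 1 in the
  ternary expansion of \<open>N\<close> and is therefore \<open>O(log N)\<close>. Take \<open>f = g\<close> on the \<open>k\<close>-free integers and
  \<open>f = 0\<close> elsewhere. As \<open>f(n)\<close> is the sum of \<open>\<mu>(d) g(d)\<^sup>k g(n / d\<^sup>k)\<close> over all \<open>d\<close> with \<open>d\<^sup>k dvd n\<close>,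
  the hyperbola method reduces the theorem to the bound \<open>M(u) = O(u exp(-(log u)\<^bsup>1/3\<^esup>))\<close> for the
  partial sums \<open>M\<close> of \<open>\<mu> g\<^sup>k\<close>, where \<open>g\<^sup>k\<close> is \<open>1\<close> or \<open>g\<close>.

  Let \<open>D\<close> be the Dirichlet series of \<open>g\<^sup>k\<close>. A comparison of \<open>D\<close> with its mirror image in a vertical
  line, combined with the 3-4-1 inequality, gives \<open>1 / D(s) = O(log T)\<close> for \<open>\<bar>Im s\<bar> \<le> T\<close> and
  \<open>Re s \<ge> 1 - c / log T\<close>. In place of Perron's formula, \<open>v \<mapsto> M(e\<^sup>v)\<close> is convolved with a narrow
  Gaussian: the result is an absolutely convergent integral of \<open>1 / (s D(s))\<close> along a vertical line,
  which can be moved to the left, and the error of the convolution is small because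
  \<open>\<bar>M(u) - M(w)\<bar> \<le> \<bar>u - w\<bar> + 1\<close>.
\<close>

section \<open>Moebius function\<close>

text \<open>The character modulo 3 itself would give \<open>f(3) = 0\<close>; the choice
  \<open>g(3) = 1\<close> keeps \<open>f\<close> nonzero at every prime and costs only a logarithm.
  The Dirichlet series of \<open>f\<close> is \<open>G(s) / D(k s)\<close> with \<open>G\<close> the
  series of \<open>g\<close>. As \<open>G\<close> has no pole at 1, only zeros of
  \<open>D(k s)\<close> can obstruct near the line Re s = 1/k; hence the exponent 1/k and the need
  for a zero-free region. That region is reached without counting zeros and without logarithmic
  derivatives: besides the 3-4-1 inequality and the value at 1, only polynomial growth of
  \<open>D\<close> to the left of 1 and lower bounds to the right of 1 enter. The exponents 2/5 >
  1/3 > 1/4 are slack. The bound for \<open>M\<close> comes out with 2/5 and a constant factor in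
  the exponent; the step to 1/3 absorbs constants and polynomial factors there, the step to 1/4 does
  the same for the hyperbola method, so that \<open>c = 1\<close> is possible in the end.\<close>

definition moebius_mu :: "nat \<Rightarrow> real" where
  "moebius_mu n = (if squarefree n then (-1) ^ card (prime_factors n) else 0)"

lemma abs_mu_le: "\<bar>moebius_mu n\<bar> \<le> 1"
  by (simp add: moebius_mu_def)

text \<open>Products and \<open>prime_factors\<close> are thereby inverse bijections between finite
  sets of primes and squarefree numbers, which turns sums over \<open>moebius_mu\<close> into
  alternating sums over subsets. The third claim lets divisibility by a k-th power be tested prime
  by prime.\<close>

lemma squarefree_prod_primes:
  fixes Q :: "nat set"
  assumes "finite Q" "\<And>p. p \<in> Q \<Longrightarrow> prime p"
  shows "squarefree (\<Prod>Q)" "prime_factors (\<Prod>Q) = Q" "\<And>k n. (\<forall>p\<in>Q. p ^ k dvd n) \<Longrightarrow> (\<Prod>Q) ^ k dvd n"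
proof -
  have cop: "coprime p q" if "p \<in> Q" "q \<in> Q" "p \<noteq> q" for p q
    using assms that by (simp add: primes_coprime)
  show "squarefree (\<Prod>Q)"
    by (rule squarefree_prod_coprime) (use assms cop squarefree_prime in auto)
  show "prime_factors (\<Prod>Q) = Q"
    using assms by (subst prime_factors_prod)
        (auto simp: prime_prime_factors prime_gt_0_nat dest: prime_gt_0_nat)
  show "(\<Prod>Q) ^ k dvd n" if "\<forall>p\<in>Q. p ^ k dvd n" for k n
    using assms(1) that cop
  proof (induction Q rule: finite_induct)
    case (insert p Q)
    have "coprime (p ^ k) (\<Prod>Q ^ k)"
      using insert by
          (intro coprime_power_left_iff[THEN iffD2] disjI1 coprime_power_right_iff[THEN iffD2]
          prod_coprime_right) auto
    then show ?case
      using insert by (auto simp: power_mult_distrib intro!: divides_mult)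
  qed auto
qed

lemma squarefree_eq_prod_prime_factors:
  fixes d :: nat
  assumes "squarefree d"
  shows "\<Prod>(prime_factors d) = d"
proof -
  have d: "d \<noteq> 0" using assms by (metis not_squarefree_0)
  have "multiplicity p d = 1" if "p \<in> prime_factors d" for p
  proof -
    have "multiplicity p d \<le> 1"
      using assms d squarefree_factorial_semiring''[of d] that by auto
    then show ?thesis using that
        by (metis One_nat_def le_antisym less_eq_Suc_le prime_factors_multiplicity mem_Collect_eq)
  qed
  then have "(\<Prod>p\<in>prime_factors d. p ^ multiplicity p d) = \<Prod>(prime_factors d)"
    by (intro prod.cong) auto
  then show ?thesis using prod_prime_factors[OF d] by simp
qed

lemma finite_power_dvd:
  assumes "n > 0" "k > 0"
  shows "finite {d::nat. d ^ k dvd n}"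
proof (rule finite_subset[of _ "{..n}"])
  show "{d. d ^ k dvd n} \<subseteq> {..n}"
  proof
    fix d assume "d \<in> {d. d ^ k dvd n}"
    then have "d dvd n" using assms by (meson dvd_power dvd_trans mem_Collect_eq)
    then show "d \<in> {..n}" using assms dvd_imp_le by auto
  qed
qed auto

text \<open>Only squarefree d contribute, and those with \<open>d ^ k dvd n\<close> are the products
  of subsets of \<open>P\<close>, the primes whose k-th power divides n. The sum is the expansion of
  the product of 1 - 1 over \<open>P\<close>, so it is nonzero exactly when \<open>P\<close> is
  empty.\<close>

lemma sum_mu_power_dvd:
  assumes "n > 0" "k > 0"
  shows "(\<Sum>d | d ^ k dvd n. moebius_mu d) = (if k_free k n then 1 else 0)"
proof -
  define P where "P = {p. prime p \<and> p ^ k dvd n}"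
  note fin = finite_power_dvd[OF assms]
  have finP: "finite P" using fin unfolding P_def by (rule finite_subset[rotated]) auto
  have PQ: "finite Q" "\<And>p. p \<in> Q \<Longrightarrow> prime p" if "Q \<in> Pow P" for Q
    using that finP by (auto simp: P_def intro: finite_subset)
  have "(\<Sum>d | d ^ k dvd n. moebius_mu d) = (\<Sum>d | d ^ k dvd n \<and> squarefree d. moebius_mu d)"
    by (rule sum.mono_neutral_right) (auto simp: fin moebius_mu_def)
  also have "\<dots> = (\<Sum>Q\<in>Pow P. (-1) ^ card Q)"
  proof (rule sum.reindex_bij_witness[of _ "\<lambda>Q. \<Prod>Q" prime_factors])
    fix d assume d: "d \<in> {d. d ^ k dvd n \<and> squarefree d}"
    then show "\<Prod>(prime_factors d) = d" by (simp add: squarefree_eq_prod_prime_factors)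
    show "prime_factors d \<in> Pow P"
      using d by (auto simp: P_def in_prime_factors_iff intro: dvd_trans[OF dvd_power_same])
    show "(- 1) ^ card (prime_factors d) = moebius_mu d" using d by (simp add: moebius_mu_def)
  next
    fix Q assume Q: "Q \<in> Pow P"
    note * = squarefree_prod_primes[OF PQ[OF Q]]
    show "prime_factors (\<Prod>Q) = Q" by (rule *(2))
    show "\<Prod>Q \<in> {d. d ^ k dvd n \<and> squarefree d}"
      using * Q by (auto simp: P_def)
  qed
  also have "\<dots> = (\<Sum>Q\<in>Pow P. (\<Prod>p\<in>Q. - 1) * (\<Prod>p\<in>P - Q. 1))" by simp
  also have "\<dots> = (\<Prod>p\<in>P. - 1 + (1::real))" by (rule prod_add[OF finP, symmetric])
  also have "\<dots> = (if P = {} then 1 else 0)" using finP by auto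
  also have "P = {} \<longleftrightarrow> k_free k n" by (auto simp: P_def k_free_def)
  finally show ?thesis by simp
qed

lemma sum_mu_dvd:
  assumes "n > 0"
  shows "(\<Sum>d | d dvd n. moebius_mu d) = (if n = 1 then 1 else 0)"
proof -
  have "k_free 1 n \<longleftrightarrow> n = 1"
    using prime_factor_nat[of n] by (auto simp: k_free_def)
  then show ?thesis using sum_mu_power_dvd[OF assms, of 1] by simp
qed

section \<open>Dirichlet series of real completely multiplicative functions\<close>

text \<open>The term n^(-s) for positive n, written through \<open>exp\<close> and \<open>ln\<close>
  so that it is visibly entire in s.\<close>

definition npow :: "nat \<Rightarrow> complex \<Rightarrow> complex" where
  "npow n s = exp (- s * of_real (ln (real n)))"

text \<open>Since an infinite sum that does not exist has the default value 0, this is meaningful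
  only where the series converges absolutely. Statements about it assume Re s > 1; further left
  \<open>dirichlet_cont\<close> takes over.\<close>

definition dirichlet_series :: "(nat \<Rightarrow> real) \<Rightarrow> complex \<Rightarrow> complex" where
  "dirichlet_series a s = (\<Sum>\<^sub>\<infinity>n\<in>{0<..}. of_real (a n) * npow n s)"

lemma npow_1 [simp]: "npow (Suc 0) s = 1"
  by (simp add: npow_def)

lemma npow_nonzero [simp]: "npow n s \<noteq> 0"
  by (simp add: npow_def)

lemma npow_mult: "m > 0 \<Longrightarrow> n > 0 \<Longrightarrow> npow (m * n) s = npow m s * npow n s"
  by (simp add: npow_def ln_mult exp_add[symmetric] algebra_simps)

lemma npow_add: "npow n (s + t) = npow n s * npow n t"
  by (simp add: npow_def exp_add[symmetric] algebra_simps)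

lemma norm_npow: "n > 0 \<Longrightarrow> norm (npow n s) = real n powr (- Re s)"
  by (simp add: npow_def powr_def)

lemma npow_of_real: "n > 0 \<Longrightarrow> npow n (of_real x) = of_real (real n powr (- x))"
  by (simp add: npow_def powr_def exp_of_real flip: of_real_mult of_real_minus)

section \<open>Sums of negative powers compared with integrals\<close>

lemma powr_diff_bounds:
  fixes \<sigma> :: real
  assumes "\<sigma> > 1" "n > (0::nat)"
  shows "(\<sigma> - 1) * real (Suc n) powr (-\<sigma>) \<le> real n powr (1-\<sigma>) - real (Suc n) powr (1-\<sigma>)"
    and "real n powr (1-\<sigma>) - real (Suc n) powr (1-\<sigma>) \<le> (\<sigma> - 1) * real n powr (-\<sigma>)"
proof -
  have "\<exists>z>real n. z < real (Suc n) \<and> real (Suc n) powr (1-\<sigma>) - real n powr (1-\<sigma>)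
      = (real (Suc n) - real n) * ((1-\<sigma>) * z powr (-\<sigma>))"
    by (rule MVT2) (use assms in \<open>auto intro!: derivative_eq_intros simp: \<close>)
  then obtain z where z: "z > real n" "z < real (Suc n)"
      "real n powr (1-\<sigma>) - real (Suc n) powr (1-\<sigma>) = (\<sigma> - 1) * z powr (-\<sigma>)"
    by (auto simp: algebra_simps)
  have "real (Suc n) powr (-\<sigma>) \<le> z powr (-\<sigma>)" "z powr (-\<sigma>) \<le> real n powr (-\<sigma>)"
    using z assms by (auto intro!: powr_mono2')
  with assms z(3) show "(\<sigma> - 1) * real (Suc n) powr (-\<sigma>) \<le> real n powr (1-\<sigma>) - real (Suc n) powr (1-\<sigma>)"
    and "real n powr (1-\<sigma>) - real (Suc n) powr (1-\<sigma>) \<le> (\<sigma> - 1) * real n powr (-\<sigma>)"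
    by auto
qed

text \<open>Telescopes \<open>powr_diff_bounds\<close>. An arbitrary finite \<open>F\<close> in
  place of an interval is what the criterion for unconditional summability asks for.\<close>

lemma sum_powr_le:
  fixes \<sigma> :: real
  assumes "\<sigma> > 1" "N > (0::nat)" "finite F" "F \<subseteq> {N<..}"
  shows "(\<Sum>n\<in>F. real n powr (-\<sigma>)) \<le> real N powr (1-\<sigma>) / (\<sigma> - 1)"
proof -
  obtain M where M: "F \<subseteq> {..M}" using assms(3) finite_nat_iff_bounded_le by auto
  have "(\<Sum>n\<in>F. real n powr (-\<sigma>)) \<le> (\<Sum>n\<in>{N<..N+M}. real n powr (-\<sigma>))"
    using assms M by (intro sum_mono2) (auto simp: subset_iff trans_le_add2)
  also have "(\<sigma> - 1) * \<dots> \<le> real N powr (1-\<sigma>) - real (N+M) powr (1-\<sigma>)"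
  proof (induction M)
    case (Suc M)
    have "{N<..N + Suc M} = insert (Suc (N+M)) {N<..N+M}" by auto
    then have "(\<sigma> - 1) * (\<Sum>n\<in>{N<..N+Suc M}. real n powr (-\<sigma>)) = (\<sigma> - 1) * (\<Sum>n\<in>{N<..N+M}. real n powr (-\<sigma>))
       + (\<sigma> - 1) * real (Suc (N+M)) powr (-\<sigma>)" by (simp add: algebra_simps)
    then show ?case using Suc powr_diff_bounds(1)[OF assms(1), of "N+M"] assms(2) by simp
  qed auto
  then have "(\<Sum>n\<in>{N<..N+M}. real n powr (-\<sigma>)) \<le> real N powr (1-\<sigma>) / (\<sigma> - 1)"
    using assms(1) by (smt (verit) divide_right_mono nonzero_mult_div_cancel_left powr_ge_zero)
  finally show ?thesis .
qed

lemma summable_powr_tail: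
  fixes \<sigma> :: real
  assumes "\<sigma> > 1" "N > (0::nat)"
  shows "(\<lambda>n. real n powr (-\<sigma>)) summable_on {N<..}"
    and "(\<Sum>\<^sub>\<infinity>n\<in>{N<..}. real n powr (-\<sigma>)) \<le> real N powr (1-\<sigma>) / (\<sigma> - 1)"
proof -
  show *: "(\<lambda>n. real n powr (-\<sigma>)) summable_on {N<..}"
    by (rule nonneg_bdd_above_summable_on)
       (use sum_powr_le[OF assms] in \<open>auto intro!: bdd_aboveI2\<close>)
  show "(\<Sum>\<^sub>\<infinity>n\<in>{N<..}. real n powr (-\<sigma>)) \<le> real N powr (1-\<sigma>) / (\<sigma> - 1)"
    by (rule infsum_le_finite_sums[OF *]) (use sum_powr_le[OF assms] in auto)
qed

lemma greaterThan_0_eq: "{0<..} = insert (Suc 0) {Suc 0<..}"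
  by auto

text \<open>The lower bound records the pole of zeta at 1; the 3-4-1 argument uses it at the right
  one of its two abscissas and the upper bound at the left one.\<close>

lemma summable_powr:
  fixes \<sigma> :: real
  assumes "\<sigma> > 1"
  shows "(\<lambda>n. real n powr (-\<sigma>)) summable_on {0<..}"
    and "(\<Sum>\<^sub>\<infinity>n\<in>{0<..}. real n powr (-\<sigma>)) \<le> \<sigma> / (\<sigma> - 1)"
    and "1 / (\<sigma> - 1) \<le> (\<Sum>\<^sub>\<infinity>n\<in>{0<..}. real n powr (-\<sigma>))"
proof -
  note * = summable_powr_tail[OF assms, of 1, simplified]
  show 1: "(\<lambda>n. real n powr (-\<sigma>)) summable_on {0<..}"
    using * by (simp add: greaterThan_0_eq summable_on_insert_iff)
  have "(\<Sum>\<^sub>\<infinity>n\<in>{0<..}. real n powr (-\<sigma>)) = 1 + (\<Sum>\<^sub>\<infinity>n\<in>{Suc 0<..}. real n powr (-\<sigma>))"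
    using * unfolding greaterThan_0_eq by (subst infsum_insert) auto
  also have "\<dots> \<le> 1 + 1 / (\<sigma> - 1)" using * by simp
  also have "\<dots> = \<sigma> / (\<sigma> - 1)" using assms by (simp add: field_simps)
  finally show "(\<Sum>\<^sub>\<infinity>n\<in>{0<..}. real n powr (-\<sigma>)) \<le> \<sigma> / (\<sigma> - 1)" .
  have part: "(1 - real (Suc N) powr (1-\<sigma>)) \<le> (\<sigma> - 1) * (\<Sum>n\<in>{0<..N}. real n powr (-\<sigma>))" for N
  proof (induction N)
    case (Suc N)
    have "{0<..Suc N} = insert (Suc N) {0<..N}" by auto
    then have "(\<sigma> - 1) * (\<Sum>n\<in>{0<..Suc N}. real n powr (-\<sigma>)) = (\<sigma> - 1) * (\<Sum>n\<in>{0<..N}. real n powr (-\<sigma>))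
       + (\<sigma> - 1) * real (Suc N) powr (-\<sigma>)" by (simp add: algebra_simps)
    then show ?case using Suc powr_diff_bounds(2)[OF assms(1), of "Suc N"] by simp
  qed auto
  have part': "1 - real (Suc N) powr (1-\<sigma>) \<le> (\<sigma> - 1) * (\<Sum>\<^sub>\<infinity>n\<in>{0<..}. real n powr (-\<sigma>))" for N
  proof -
    have "(\<Sum>n\<in>{0<..N}. real n powr (-\<sigma>)) \<le> (\<Sum>\<^sub>\<infinity>n\<in>{0<..}. real n powr (-\<sigma>))"
      by (rule finite_sum_le_infsum) (use 1 in auto)
    then show ?thesis using part[of N] assms by (smt (verit) mult_left_mono)
  qed
  have "(\<lambda>N. 1 - real (Suc N) powr (1-\<sigma>)) \<longlonglongrightarrow> 1 - 0"
    using assms by (intro tendsto_intros tendsto_neg_powr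
        filterlim_compose[OF filterlim_real_sequentially filterlim_Suc]) auto
  then have "1 \<le> (\<sigma> - 1) * (\<Sum>\<^sub>\<infinity>n\<in>{0<..}. real n powr (-\<sigma>))"
    by (intro LIMSEQ_le_const2[of _ "1 :: real"]) (use part' in auto)
  then show "1 / (\<sigma> - 1) \<le> (\<Sum>\<^sub>\<infinity>n\<in>{0<..}. real n powr (-\<sigma>))"
    using assms by (simp add: field_simps)
qed

lemma summable_Suc_powr:
  fixes \<sigma> :: real
  assumes "\<sigma> > 1"
  shows "summable (\<lambda>n. real (Suc n) powr (- \<sigma>))" "(\<Sum>n. real (Suc n) powr (- \<sigma>)) \<le> \<sigma> / (\<sigma> - 1)"
proof -
  have "((\<lambda>n. real n powr (- \<sigma>)) has_sum infsum (\<lambda>n. real n powr (- \<sigma>)) {0<..}) {0<..}"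
    using summable_powr(1)[OF assms] by simp
  moreover have "bij_betw Suc UNIV {0<..}"
    by (auto simp: bij_betw_def image_iff gr0_conv_Suc)
  ultimately have "((\<lambda>n. real (Suc n) powr (- \<sigma>)) has_sum infsum (\<lambda>n. real n powr (- \<sigma>)) {0<..}) UNIV"
    by (subst has_sum_reindex_bij_betw)
  then have "(\<lambda>n. real (Suc n) powr (- \<sigma>)) sums infsum (\<lambda>n. real n powr (- \<sigma>)) {0<..}"
    by (rule has_sum_imp_sums)
  then show "summable (\<lambda>n. real (Suc n) powr (- \<sigma>))" "(\<Sum>n. real (Suc n) powr (- \<sigma>)) \<le> \<sigma> / (\<sigma> - 1)"
    using summable_powr(2)[OF assms] by (auto simp: sums_iff simp del: of_nat_Suc)
qed

lemma dirichlet_series_abs_summable: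
  assumes "Re s > 1" "\<And>n. n > 0 \<Longrightarrow> \<bar>a n\<bar> \<le> 1"
  shows "(\<lambda>n. norm (complex_of_real (a n) * npow n s)) summable_on {0<..}"
  by (rule summable_on_comparison_test[OF summable_powr(1)[OF assms(1)]])
     (use assms(2) in \<open>auto simp: norm_mult norm_npow mult_left_le_one_le\<close>)

lemma dirichlet_series_summable:
  assumes "Re s > 1" "\<And>n. n > 0 \<Longrightarrow> \<bar>a n\<bar> \<le> 1" "A \<subseteq> {0<..}"
  shows "(\<lambda>n. complex_of_real (a n) * npow n s) summable_on A"
  by (rule summable_on_subset[OF _ assms(3)], rule abs_summable_summable, rule dirichlet_series_abs_summable)
     (use assms in auto)

lemma dirichlet_series_sums:
  assumes "Re s > 1" "\<And>n. n > 0 \<Longrightarrow> \<bar>a n\<bar> \<le> 1"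
  shows "(\<lambda>n. complex_of_real (a (Suc n)) * npow (Suc n) s) sums dirichlet_series a s"
proof -
  have "((\<lambda>n. complex_of_real (a n) * npow n s) has_sum dirichlet_series a s) {0<..}"
    unfolding dirichlet_series_def using dirichlet_series_summable[of s a "{0<..}"] assms by auto
  moreover have "bij_betw Suc UNIV {0<..}"
    by (auto simp: bij_betw_def image_iff gr0_conv_Suc)
  ultimately have "((\<lambda>n. complex_of_real (a (Suc n)) * npow (Suc n) s) has_sum dirichlet_series a s) UNIV"
    by (subst has_sum_reindex_bij_betw)
  then show ?thesis by (rule has_sum_imp_sums)
qed

lemma norm_dirichlet_series_sub_le:
  assumes "Re s > 1" "\<And>n. n > 0 \<Longrightarrow> \<bar>a n\<bar> \<le> 1" "A \<subseteq> B" "B \<subseteq> {0<..}"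
  shows "norm (\<Sum>\<^sub>\<infinity>n\<in>A. complex_of_real (a n) * npow n s) \<le> (\<Sum>\<^sub>\<infinity>n\<in>B. real n powr (- Re s))"
proof -
  have sA: "(\<lambda>n. norm (complex_of_real (a n) * npow n s)) summable_on A"
    by (rule summable_on_subset[of _ "{0<..}"], rule dirichlet_series_abs_summable) (use assms in auto)
  have sB: "(\<lambda>n. real n powr (- Re s)) summable_on B"
    by (rule summable_on_subset[OF summable_powr(1)[OF assms(1)] assms(4)])
  have "norm (\<Sum>\<^sub>\<infinity>n\<in>A. complex_of_real (a n) * npow n s) \<le> (\<Sum>\<^sub>\<infinity>n\<in>A. norm (complex_of_real (a n) * npow n s))"
    by (rule norm_infsum_bound[OF sA])
  also have "\<dots> \<le> (\<Sum>\<^sub>\<infinity>n\<in>B. real n powr (- Re s))"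
    by (rule infsum_mono_neutral[OF sA sB])
       (use assms in \<open>auto simp: norm_mult norm_npow subset_iff intro!: mult_left_le_one_le\<close>)
  finally show ?thesis .
qed

lemma norm_dirichlet_series_le:
  assumes "Re s > 1" "\<And>n. n > 0 \<Longrightarrow> \<bar>a n\<bar> \<le> 1"
  shows "norm (dirichlet_series a s) \<le> Re s / (Re s - 1)"
  using norm_dirichlet_series_sub_le[where a = a and A = "{0<..}" and B = "{0<..}", OF assms(1)]
      assms(2) summable_powr(2)[OF assms(1)]
  by (simp add: dirichlet_series_def)

lemma norm_dirichlet_series_1_ge:
  assumes "\<sigma> > 1"
  shows "norm (dirichlet_series (\<lambda>_. 1) (of_real \<sigma>)) \<ge> 1 / (\<sigma> - 1)"
proof -
  have "dirichlet_series (\<lambda>_. 1) (of_real \<sigma>) = (\<Sum>\<^sub>\<infinity>n\<in>{0<..}. complex_of_real (real n powr (- \<sigma>)))"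
    unfolding dirichlet_series_def by (intro infsum_cong) (auto simp: npow_of_real)
  also have "\<dots> = of_real (\<Sum>\<^sub>\<infinity>n\<in>{0<..}. real n powr (- \<sigma>))"
    by (intro infsumI has_sum_of_real has_sum_infsum summable_powr assms)
  finally show ?thesis using summable_powr(3)[OF assms] by (simp del: divide_le_eq)
qed

text \<open>One Euler factor of the 3-4-1 inequality, with u in the role of p^(-\<sigma>). The
  logarithm of the product is a power series in u whose n-th coefficient is -1/n times
  \<open>2 * (1 + Re (z^n))^2\<close>, so it decreases in u. Monotonicity, rather than a comparison
  with 1, is what later relates two abscissas.\<close>

lemma three_four_one_local:
  fixes z :: complex
  assumes z: "norm z = 1" and u: "0 \<le> u" "u \<le> v" "v < 1"
  shows "(1 - v)^3 * norm (1 - of_real v * z)^4 * norm (1 - of_real v * z^2)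
       \<le> (1 - u)^3 * norm (1 - of_real u * z)^4 * norm (1 - of_real u * z^2)"
proof -
  define q where "q = (\<lambda>u. (1 - u)^3 * norm (1 - of_real u * z)^4 * norm (1 - of_real u * z^2))"
  \<comment> \<open>Real part of the logarithm series. Its term at n = 0 is a division by zero and
    therefore 0.\<close>
  have lnorm: "(\<lambda>n. - (u ^ n * Re (w ^ n) / real n)) sums ln (norm (1 - of_real u * w))"
    if "0 \<le> u" "u < 1" "norm w = 1" for u and w :: complex
  proof -
    have n: "norm (- (of_real u * w)) < 1" using that by (simp add: norm_mult)
    have ne: "1 - of_real u * w \<noteq> 0" using that
      by (metis eq_iff_diff_eq_0 mult.right_neutral norm_mult norm_of_real norm_one abs_of_nonneg less_irrefl)
    have "(\<lambda>n. (-1)^Suc n / of_nat n * (- (of_real u * w))^n) sums ln (1 + - (of_real u * w))"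
      by (rule Ln_series[OF n])
    then have "(\<lambda>n. Re ((-1)^Suc n / of_nat n * (- (of_real u * w))^n)) sums Re (ln (1 + - (of_real u * w)))"
      by (rule sums_Re)
    moreover have "Re ((-1)^Suc n / of_nat n * (- (of_real u * w))^n) = - (u ^ n * Re (w ^ n) / real n)" for n
    proof -
      have "(- (of_real u * w))^n = (-1)^n * (of_real (u^n) * w^n)"
        by (subst power_minus) (simp add: power_mult_distrib)
      moreover have "(-1)^n * (-1)^n = (1::complex)" by (simp flip: power_add)
      ultimately have "(-1)^Suc n / of_nat n * (- (of_real u * w))^n = - of_real (u^n / real n) * w ^ n"
        by (simp add: field_simps)
      then have "Re ((-1)^Suc n / of_nat n * (- (of_real u * w))^n) = Re (- of_real (u^n / real n) * w ^ n)"
        by (rule arg_cong)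
      also have "\<dots> = - (u ^ n * Re (w ^ n) / real n)"
          by (subst minus_mult_left[symmetric]) (simp del: of_real_divide of_real_power)
      finally show ?thesis .
    qed
    ultimately show ?thesis using ne by (simp del: power_Suc of_real_mult)
  qed
  have lnq: "(\<lambda>n. - (u ^ n / real n) * (3 + 4 * Re (z^n) + Re ((z^2)^n))) sums ln (q u)" and qpos: "q u > 0"
    if "0 \<le> u" "u < 1" for u
  proof -
    have ne: "norm (1 - of_real u * w) > 0" if "norm w = 1" for w :: complex
    proof -
      have "of_real u * w \<noteq> 1"
        using that \<open>u < 1\<close> \<open>0 \<le> u\<close>
            by (metis mult.right_neutral norm_mult norm_of_real norm_one abs_of_nonneg less_irrefl)
      then show ?thesis by auto
    qed
    have z2: "norm (z^2) = 1" using z by (simp add: norm_power)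
    show "q u > 0" unfolding q_def using ne[OF z] ne[OF z2] that by (intro mult_pos_pos zero_less_power) auto
    have "ln (q u) = 3 * ln (1 - u) + 4 * ln (norm (1 - of_real u * z)) + ln (norm (1 - of_real u * z^2))"
      unfolding q_def using ne[OF z] ne[OF z2] that by (simp add: ln_mult ln_realpow)
    moreover have "ln (norm (1 - complex_of_real u * 1)) = ln (1 - u)"
      using that by (metis abs_of_pos diff_gt_0_iff_gt mult.right_neutral norm_of_real of_real_1 of_real_diff)
    ultimately show "(\<lambda>n. - (u ^ n / real n) * (3 + 4 * Re (z^n) + Re ((z^2)^n))) sums ln (q u)"
      using sums_add[OF
          sums_add[OF sums_mult[OF lnorm[OF that, of 1], of 3] sums_mult[OF lnorm[OF that z], of 4]]
          lnorm[OF that z2]]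
      by (simp add: algebra_simps)
  qed
  have "3 + 4 * Re (z^n) + Re ((z^2)^n) \<ge> 0" for n
  proof -
    have "norm (z^n) = 1" using z by (simp add: norm_power)
    then have "(Re (z^n))\<^sup>2 + (Im (z^n))\<^sup>2 = 1" by (metis cmod_power2 one_power2)
    moreover have "(z^2)^n = (z^n)^2" by (simp add: mult.commute flip: power_mult)
    moreover have "Re (w^2) = (Re w)^2 - (Im w)^2" for w by (simp add: power2_eq_square)
    ultimately have "3 + 4 * Re (z^n) + Re ((z^2)^n) = 2 * (1 + Re (z^n))^2"
      by (simp add: power2_eq_square algebra_simps)
    then show ?thesis by simp
  qed
  then have "- (v ^ n / real n) * (3 + 4 * Re (z^n) + Re ((z^2)^n))
      \<le> - (u ^ n / real n) * (3 + 4 * Re (z^n) + Re ((z^2)^n))" for n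
    using u by (intro mult_right_mono le_imp_neg_le divide_right_mono power_mono) auto
  then have "ln (q v) \<le> ln (q u)"
    using sums_le[OF _ lnq[of v] lnq[of u]] u by auto
  then show ?thesis using qpos[of u] qpos[of v] u unfolding q_def by simp
qed

text \<open>Values 1 and -1 only, so that squares of values are 1: the factor of doubled frequency
  in the 3-4-1 product then belongs to zeta itself.\<close>

locale sign_character =
  fixes \<psi> :: "nat \<Rightarrow> real"
  assumes \<psi>_mult: "m > 0 \<Longrightarrow> n > 0 \<Longrightarrow> \<psi> (m * n) = \<psi> m * \<psi> n"
    and \<psi>_cases: "n > 0 \<Longrightarrow> \<psi> n = 1 \<or> \<psi> n = -1"
begin

lemma \<psi>_1: "\<psi> (Suc 0) = 1"
  using \<psi>_mult[of 1 1] \<psi>_cases[of 1] by auto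

lemma abs_\<psi>: "n > 0 \<Longrightarrow> \<bar>\<psi> n\<bar> = 1"
  using \<psi>_cases[of n] by auto

lemma abs_\<psi>_le: "n > 0 \<Longrightarrow> \<bar>\<psi> n\<bar> \<le> 1"
  using abs_\<psi> by auto

lemma abs_mu_\<psi>_le: "n > 0 \<Longrightarrow> \<bar>moebius_mu n * \<psi> n\<bar> \<le> 1"
  using abs_mu_le[of n] by (simp add: abs_mult abs_\<psi>)

text \<open>Multiply the two absolutely convergent series and group the pairs (m, d) by k = m d.
  Complete multiplicativity pulls \<open>\<psi> k\<close> and k^(-s) out of the inner sum, which
  becomes the divisor sum of \<open>moebius_mu\<close>.\<close>

lemma dirichlet_series_mu_inverse:
  assumes s: "Re s > 1"
  shows "dirichlet_series \<psi> s * dirichlet_series (\<lambda>n. moebius_mu n * \<psi> n) s = 1"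
proof -
  let ?f = "\<lambda>n. complex_of_real (\<psi> n) * npow n s" and ?g =
      "\<lambda>n. complex_of_real (moebius_mu n * \<psi> n) * npow n s"
  let ?N = "{0::nat<..}"
  have sf: "?f summable_on ?N" and sg: "?g summable_on ?N"
    using dirichlet_series_summable[where a = \<psi>, OF s abs_\<psi>_le]
        dirichlet_series_summable[where a = "\<lambda>n. moebius_mu n * \<psi> n", OF s abs_mu_\<psi>_le] by auto
  have nf: "(\<lambda>m. norm (?f m)) summable_on ?N" and ng: "(\<lambda>n. norm (?g n)) summable_on ?N"
    using dirichlet_series_abs_summable[where a = \<psi>, OF s abs_\<psi>_le]
        dirichlet_series_abs_summable[where a = "\<lambda>n. moebius_mu n * \<psi> n", OF s abs_mu_\<psi>_le] by auto
  have "(\<lambda>x. norm ((\<lambda>(m, n). ?f m * ?g n) x)) summable_on ?N \<times> ?N"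
  proof (subst Infinite_Sum.abs_summable_on_Sigma_iff, intro conjI ballI)
    fix m assume "m \<in> ?N"
    show "(\<lambda>n. norm ((\<lambda>(m, n). ?f m * ?g n) (m, n))) summable_on ?N"
      using summable_on_cmult_right[OF ng, of "norm (?f m)"] by (simp add: norm_mult)
  next
    show "(\<lambda>m. norm (\<Sum>\<^sub>\<infinity>n\<in>?N. norm ((\<lambda>(m, n). ?f m * ?g n) (m, n)))) summable_on ?N"
      using summable_on_cmult_left[OF nf, of "\<Sum>\<^sub>\<infinity>n\<in>?N. norm (?g n)"]
      by (simp add: norm_mult infsum_cmult_right' infsum_nonneg)
  qed
  then have sm: "(\<lambda>(m, n). ?f m * ?g n) summable_on ?N \<times> ?N"
    by (rule abs_summable_summable)
  have "dirichlet_series \<psi> s * dirichlet_series (\<lambda>n. moebius_mu n * \<psi> n) s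
      = (\<Sum>\<^sub>\<infinity>m\<in>?N. ?f m * (\<Sum>\<^sub>\<infinity>n\<in>?N. ?g n))"
    unfolding dirichlet_series_def by (rule infsum_cmult_left'[symmetric])
  also have "\<dots> = (\<Sum>\<^sub>\<infinity>m\<in>?N. \<Sum>\<^sub>\<infinity>n\<in>?N. ?f m * ?g n)"
    by (intro infsum_cong infsum_cmult_right'[symmetric])
  also have "\<dots> = (\<Sum>\<^sub>\<infinity>(m,n)\<in>?N \<times> ?N. ?f m * ?g n)"
    using infsum_Sigma'_banach[of "\<lambda>m n. ?f m * ?g n", OF sm] by simp
  also have "\<dots> = (\<Sum>\<^sub>\<infinity>(k,d)\<in>(SIGMA k:?N. {d. d dvd k}). ?f k * of_real (moebius_mu d))"
    by (rule infsum_reindex_bij_witness[of _ "\<lambda>(k,d). (k div d, d)" "\<lambda>(m,d). (m * d, d)"])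
       (auto simp: npow_mult \<psi>_mult dvd_div_eq_0_iff intro!: Nat.gr0I)
  also have "\<dots> = (\<Sum>\<^sub>\<infinity>k\<in>?N. \<Sum>\<^sub>\<infinity>d\<in>{d. d dvd k}. ?f k * of_real (moebius_mu d))"
  proof (rule infsum_Sigma'_banach[symmetric])
    show "(\<lambda>(k,d). ?f k * of_real (moebius_mu d)) summable_on (SIGMA k:?N. {d. d dvd k})"
      using sm by (subst
          summable_on_reindex_bij_witness[of _ "\<lambda>(m,d). (m * d, d)" "\<lambda>(k,d). (k div d, d)"  "?N \<times> ?N"
          "\<lambda>(m, n). ?f m * ?g n"])
       (auto simp: npow_mult \<psi>_mult dvd_div_eq_0_iff intro!: Nat.gr0I)
  qed
  also have "\<dots> = (\<Sum>\<^sub>\<infinity>k\<in>?N. if k = 1 then 1 else 0)"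
  proof (rule infsum_cong)
    fix k :: nat assume k: "k \<in> ?N"
    have "(\<Sum>\<^sub>\<infinity>d\<in>{d. d dvd k}. ?f k * of_real (moebius_mu d)) = ?f k * of_real (\<Sum>d | d dvd k. moebius_mu d)"
      using k by (simp add: infsum_finite sum_distrib_left)
    then show "(\<Sum>\<^sub>\<infinity>d\<in>{d. d dvd k}. ?f k * of_real (moebius_mu d)) = (if k = 1 then 1 else 0)"
      using k by (simp only: sum_mu_dvd greaterThan_iff) (simp add: \<psi>_1)
  qed
  also have "\<dots> = (\<Sum>\<^sub>\<infinity>k\<in>{1::nat}. 1)"
    by (rule infsum_cong_neutral) auto
  finally show ?thesis by simp
qed

text \<open>The inverse series obeys the same trivial upper bound as the series, and this is a lower
  bound for the series.\<close>

lemma norm_dirichlet_series_ge: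
  assumes s: "Re s > 1"
  shows "norm (dirichlet_series \<psi> s) \<ge> (Re s - 1) / Re s" "dirichlet_series \<psi> s \<noteq> 0"
proof -
  have 1: "norm (dirichlet_series \<psi> s) * norm (dirichlet_series (\<lambda>n. moebius_mu n * \<psi> n) s) = 1"
    using dirichlet_series_mu_inverse[OF s] by (metis norm_mult norm_one)
  then show "dirichlet_series \<psi> s \<noteq> 0" by auto
  have "1 \<le> norm (dirichlet_series \<psi> s) * (Re s / (Re s - 1))"
    using norm_dirichlet_series_le[where a = "\<lambda>n. moebius_mu n * \<psi> n", OF s abs_mu_\<psi>_le]
        mult_left_mono[of _ "Re s / (Re s - 1)" "norm (dirichlet_series \<psi> s)"] 1 by fastforce
  then show "norm (dirichlet_series \<psi> s) \<ge> (Re s - 1) / Re s" using s by (simp add: field_simps)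
qed

text \<open>Sieve out the primes up to N: by \<open>eq\<close> the finite product times the series
  is the sum over \<open>S N\<close>, whose members other than 1 exceed N. That sum tends to
  1.\<close>

lemma euler_product:
  assumes s: "Re s > 1"
  shows "(\<lambda>N. \<Prod>p | prime p \<and> p \<le> N. 1 - of_real (\<psi> p) * npow p s) \<longlonglongrightarrow> inverse (dirichlet_series \<psi> s)"
proof -
  define S where "S N = {n. n > 0 \<and> (\<forall>p\<le>N. prime p \<longrightarrow> \<not> p dvd n)}" for N :: nat
  let ?f = "\<lambda>n. complex_of_real (\<psi> n) * npow n s"
  have sub: "S N \<subseteq> {0<..}" for N by (auto simp: S_def)
  have eq: "(\<Sum>\<^sub>\<infinity>n\<in>S N. ?f n) = dirichlet_series \<psi> s * (\<Prod>p | prime p \<and> p \<le> N. 1 - ?f p)" for N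
  proof (induction N)
    case 0
    have "S 0 = {0<..}" by (auto simp: S_def)
    moreover have "{p::nat. prime p \<and> p \<le> 0} = {}" by auto
    ultimately show ?case unfolding dirichlet_series_def by (simp only: prod.empty mult_1_right)
  next
    case (Suc N)
    show ?case
    proof (cases "prime (Suc N)")
      case False
      then have "{p. prime p \<and> p \<le> Suc N} = {p. prime p \<and> p \<le> N}" "S (Suc N) = S N"
        by (auto simp: S_def le_Suc_eq)
      then show ?thesis using Suc by simp
    next
      case True
      define p where "p = Suc N"
      have p: "prime p" using True by (simp add: p_def)
      \<comment> \<open>Members not divisible by p, and p times arbitrary members. The second part
        contributes \<open>?f p\<close> times the whole sum, whence the factor
        \<open>1 - ?f p\<close>.\<close>
      have un: "S N = S p \<union> (\<lambda>n. p * n) ` S N"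
      proof (intro equalityI subsetI)
        fix n assume n: "n \<in> S N"
        show "n \<in> S p \<union> (\<lambda>n. p * n) ` S N"
        proof (cases "p dvd n")
          case True
          then obtain m where m: "n = p * m" by auto
          then have "m \<in> S N" using n by (auto simp: S_def)
          then show ?thesis using m by auto
        next
          case False
          then show ?thesis using n by (auto simp: S_def p_def le_Suc_eq)
        qed
      next
        fix n assume n: "n \<in> S p \<union> (\<lambda>n. p * n) ` S N"
        show "n \<in> S N"
        proof (cases "n \<in> S p")
          case True then show ?thesis by (auto simp: S_def p_def)
        next
          case False
          then obtain m where m: "m \<in> S N" "n = p * m" using n by auto
          have "\<not> q dvd n" if "q \<le> N" "prime q" for q
          proof
            assume "q dvd n"
            then have "q dvd p \<or> q dvd m" using m that by (simp add: prime_dvd_mult_iff)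
            moreover have "\<not> q dvd p" using that p
                by (auto simp: p_def primes_dvd_imp_eq dest: primes_dvd_imp_eq)
            ultimately show False using m that by (auto simp: S_def)
          qed
          then show ?thesis using m p by (auto simp: S_def prime_gt_0_nat)
        qed
      qed
      have dis: "S p \<inter> (\<lambda>n. p * n) ` S N = {}" using p by (auto simp: S_def)
      have sm: "?f summable_on A" if "A \<subseteq> {0<..}" for A
        by (rule dirichlet_series_summable[where a = \<psi>, OF s abs_\<psi>_le that])
      have "(\<Sum>\<^sub>\<infinity>n\<in>(\<lambda>n. p * n) ` S N. ?f n) = (\<Sum>\<^sub>\<infinity>n\<in>S N. ?f (p * n))"
        using p by (subst infsum_reindex) (auto simp: inj_on_def o_def prime_gt_0_nat)
      also have "\<dots> = (\<Sum>\<^sub>\<infinity>n\<in>S N. ?f p * ?f n)"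
        using p by (intro infsum_cong) (auto simp: S_def npow_mult \<psi>_mult prime_gt_0_nat)
      also have "\<dots> = ?f p * (\<Sum>\<^sub>\<infinity>n\<in>S N. ?f n)" by (rule infsum_cmult_right')
      finally have im: "(\<Sum>\<^sub>\<infinity>n\<in>(\<lambda>n. p * n) ` S N. ?f n) = ?f p * (\<Sum>\<^sub>\<infinity>n\<in>S N. ?f n)" .
      have "(\<Sum>\<^sub>\<infinity>n\<in>S N. ?f n) = (\<Sum>\<^sub>\<infinity>n\<in>S p. ?f n) + ?f p * (\<Sum>\<^sub>\<infinity>n\<in>S N. ?f n)"
        using infsum_Un_disjoint[OF sm sm dis] sub un im by (metis Un_subset_iff)
      then have "(\<Sum>\<^sub>\<infinity>n\<in>S p. ?f n) = (1 - ?f p) * (\<Sum>\<^sub>\<infinity>n\<in>S N. ?f n)" by (simp add: algebra_simps)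
      moreover have "{q. prime q \<and> q \<le> Suc N} = insert p {q. prime q \<and> q \<le> N}"
        using p by (auto simp: p_def)
      ultimately show ?thesis using Suc by (simp add: p_def mult_ac)
    qed
  qed
  have "(\<lambda>N. \<Sum>\<^sub>\<infinity>n\<in>S N. ?f n) \<longlonglongrightarrow> 1"
  proof (rule LIM_zero_cancel, rule Lim_null_comparison[OF eventually_sequentiallyI[of 1]])
    fix N :: nat assume N: "1 \<le> N"
    have "S N = insert (Suc 0) (S N - {Suc 0})" by (auto simp: S_def)
    then have "(\<Sum>\<^sub>\<infinity>n\<in>S N. ?f n) = ?f (Suc 0) + (\<Sum>\<^sub>\<infinity>n\<in>S N - {Suc 0}. ?f n)"
      using infsum_insert[where f = ?f and A = "S N - {Suc 0}" and a = "Suc 0"]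
          dirichlet_series_summable[where a = \<psi> and A = "S N - {Suc 0}", OF s abs_\<psi>_le] sub[of N] \<psi>_1 by auto
    then have "(\<Sum>\<^sub>\<infinity>n\<in>S N. ?f n) - 1 = (\<Sum>\<^sub>\<infinity>n\<in>S N - {Suc 0}. ?f n)" by (simp add: \<psi>_1)
    moreover have "S N - {Suc 0} \<subseteq> {N<..}"
    proof
      fix n assume n: "n \<in> S N - {Suc 0}"
      then obtain p where "prime p" "p dvd n" using prime_factor_nat[of n] by auto
      then show "n \<in> {N<..}" using n by (auto simp: S_def) (metis dvd_imp_le le_trans not_le)
    qed
    ultimately show "norm ((\<Sum>\<^sub>\<infinity>n\<in>S N. ?f n) - 1) \<le> real N powr (1 - Re s) / (Re s - 1)"
      using norm_dirichlet_series_sub_le[where a = \<psi> and A = "S N - {Suc 0}" and B = "{N<..}", OF s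
          abs_\<psi>_le] summable_powr_tail(2)[OF s, of N] N by force
  next
    have "(\<lambda>N. real N powr (1 - Re s) / (Re s - 1)) \<longlonglongrightarrow> 0 / (Re s - 1)"
      using s by (intro tendsto_intros tendsto_neg_powr filterlim_real_sequentially) auto
    then show "(\<lambda>N. real N powr (1 - Re s) / (Re s - 1)) \<longlonglongrightarrow> 0" by simp
  qed
  then have "(\<lambda>N. inverse (dirichlet_series \<psi> s)
      * (dirichlet_series \<psi> s * (\<Prod>p | prime p \<and> p \<le> N. 1 - ?f p))) \<longlonglongrightarrow> inverse (dirichlet_series \<psi> s) * 1"
    unfolding eq by (intro tendsto_intros)
  then show ?thesis using norm_dirichlet_series_ge(2)[OF s] by (simp flip: mult.assoc)
qed

end

section \<open>The 3-4-1 inequality for Dirichlet series\<close>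

interpretation one: sign_character "\<lambda>_. 1"
  by standard auto

context sign_character begin

text \<open>Factor by factor the finite Euler products \<open>Q\<close> grow with the abscissa. They
  tend to the inverse of the quantity displayed, which therefore decreases.\<close>

lemma three_four_one_mono:
  assumes "1 < \<sigma>" "\<sigma> \<le> \<sigma>'"
  defines "Z \<equiv> dirichlet_series (\<lambda>_. 1)"
  shows "norm (Z (of_real \<sigma>'))^3 * norm (dirichlet_series \<psi> (Complex \<sigma>' t))^4 * norm (Z (Complex \<sigma>' (2*t)))
       \<le> norm (Z (of_real \<sigma>))^3 * norm (dirichlet_series \<psi> (Complex \<sigma> t))^4 * norm (Z (Complex \<sigma> (2*t)))"
proof -
  define P where "P a N s = (\<Prod>p | prime p \<and> p \<le> N. 1 - complex_of_real (a p) * npow p s)"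
    for a :: "nat \<Rightarrow> real" and N s
  define Q where "Q N x = norm (P (\<lambda>_. 1) N (of_real x))^3 * norm (P \<psi> N (Complex x t))^4
      * norm (P (\<lambda>_. 1) N (Complex x (2*t)))" for N x
  define R where "R x = norm (Z (of_real x))^3 * norm (dirichlet_series \<psi> (Complex x t))^4
      * norm (Z (Complex x (2*t)))" for x
  have lim: "(\<lambda>N. Q N x) \<longlonglongrightarrow> inverse (R x)" if "x > 1" for x
  proof -
    have 1: "(\<lambda>N. P (\<lambda>_. 1) N s) \<longlonglongrightarrow> inverse (Z s)" if "Re s > 1" for s
      using one.euler_product[OF that] unfolding P_def Z_def .
    have 2: "(\<lambda>N. P \<psi> N s) \<longlonglongrightarrow> inverse (dirichlet_series \<psi> s)" if "Re s > 1" for s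
      using euler_product[OF that] unfolding P_def .
    have a: "(\<lambda>N. norm (P (\<lambda>_. 1) N (of_real x)) ^ 3) \<longlonglongrightarrow> norm (inverse (Z (of_real x))) ^ 3"
      by (rule tendsto_power, rule tendsto_norm, rule 1) (simp add: that)
    have b: "(\<lambda>N. norm (P \<psi> N (Complex x t)) ^ 4) \<longlonglongrightarrow> norm (inverse (dirichlet_series \<psi> (Complex x t))) ^ 4"
      by (rule tendsto_power, rule tendsto_norm, rule 2) (simp add: that)
    have c: "(\<lambda>N. norm (P (\<lambda>_. 1) N (Complex x (2*t)))) \<longlonglongrightarrow> norm (inverse (Z (Complex x (2*t))))"
      by (rule tendsto_norm, rule 1) (simp add: that)
    have "(\<lambda>N. Q N x) \<longlonglongrightarrow> norm (inverse (Z (of_real x)))^3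
        * norm (inverse (dirichlet_series \<psi> (Complex x t)))^4 * norm (inverse (Z (Complex x (2*t))))"
      using tendsto_mult[OF tendsto_mult[OF a b] c] unfolding Q_def .
    then show ?thesis by (simp add: R_def norm_inverse power_inverse)
  qed
  have Q_eq: "Q N x = (\<Prod>p | prime p \<and> p \<le> N. norm (1 - npow p (of_real x))^3 *
       norm (1 - of_real (\<psi> p) * npow p (Complex x t))^4 * norm (1 - npow p (Complex x (2*t))))" for N x
    unfolding Q_def P_def by (simp add: prod.distrib prod_power_distrib flip: prod_norm)
  have local: "norm (1 - npow p (of_real \<sigma>))^3 * norm (1 - of_real (\<psi> p) * npow p (Complex \<sigma> t))^4
      * norm (1 - npow p (Complex \<sigma> (2*t)))
     \<le> norm (1 - npow p (of_real \<sigma>'))^3 * norm (1 - of_real (\<psi> p) * npow p (Complex \<sigma>' t))^4 * norm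
         (1 - npow p (Complex \<sigma>' (2*t)))"
    if p: "prime p" for p
  proof -
    have p0: "p > 0" and p1: "real p > 1" using p prime_gt_0_nat prime_gt_1_nat by auto
    \<comment> \<open>The sign is put into z and disappears in its square, so the third factor is
      that of zeta at 2 t.\<close>
    define z where "z = of_real (\<psi> p) * npow p (Complex 0 t)"
    have z: "norm z = 1" by (simp add: z_def norm_mult norm_npow p0 abs_\<psi>)
    have z2: "z^2 = npow p (Complex 0 (2*t))"
    proof -
      have "z^2 = of_real ((\<psi> p)^2) * npow p (Complex 0 t + Complex 0 t)"
        by (simp only: npow_add) (simp add: z_def power2_eq_square)
      also have "(\<psi> p)^2 = 1" using \<psi>_cases[OF p0] by auto
      also have "Complex 0 t + Complex 0 t = Complex 0 (2*t)" by (simp add: complex_eq_iff)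
      finally show ?thesis by simp
    qed
    have spl: "npow p (Complex x y) = of_real (real p powr (-x)) * npow p (Complex 0 y)" for x y
    proof -
      have "Complex x y = of_real x + Complex 0 y" by (simp add: complex_eq_iff)
      then show ?thesis by (simp add: npow_add npow_of_real p0)
    qed
    have u1: "real p powr (-x) < 1" if "x > 1" for x
      using that p1 by (simp add: powr_minus inverse_less_1_iff)
    have n1: "norm (1 - npow p (of_real x)) = 1 - real p powr (-x)" if "x > 1" for x
    proof -
      have "1 - npow p (of_real x) = of_real (1 - real p powr (-x))" by (simp add: npow_of_real p0)
      then show ?thesis using u1[OF that] by (metis abs_of_pos diff_gt_0_iff_gt norm_of_real)
    qed
    have e1: "of_real (\<psi> p) * npow p (Complex x t) = of_real (real p powr (-x)) * z" for x
      by (simp add: spl[of x t] z_def)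
    have e2: "npow p (Complex x (2*t)) = of_real (real p powr (-x)) * z^2" for x
      by (simp add: spl[of x "2*t"] z2)
    have "real p powr (-\<sigma>') \<le> real p powr (-\<sigma>)" using assms p1 by (intro powr_mono) auto
    then show ?thesis
      using three_four_one_local[OF z, of "real p powr (-\<sigma>')" "real p powr (-\<sigma>)"] assms u1[of \<sigma>] p0
      by (simp add: n1 e1 e2)
  qed
  have "Q N \<sigma> \<le> Q N \<sigma>'" for N
    unfolding Q_eq by (rule prod_mono) (use local in auto)
  then have le: "inverse (R \<sigma>) \<le> inverse (R \<sigma>')"
    using LIMSEQ_le[OF lim[of \<sigma>] lim[of \<sigma>']] assms by auto
  have pos: "R x > 0" if "x > 1" for x
    using norm_dirichlet_series_ge(2)[of "Complex x t"] one.norm_dirichlet_series_ge(2)[of "of_real x"]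
        one.norm_dirichlet_series_ge(2)[of "Complex x (2*t)"] that
    by (simp add: R_def Z_def)
  show ?thesis using le pos[of \<sigma>] pos[of \<sigma>'] assms unfolding R_def[symmetric] by simp
qed

end

section \<open>Reflection in a vertical line\<close>

text \<open>A two-constant estimate: the factor \<open>exp (- M * W)\<close> compensates the large
  bound on the arc, so the exponent of the resulting bound falls linearly to 0 as x approaches the
  flat side.\<close>

lemma half_disc_maximum_modulus:
  fixes q :: "complex \<Rightarrow> complex"
  assumes r: "r > 0" and M: "M \<ge> 0" and U: "open U" "{z. norm z \<le> r \<and> Re z \<ge> 0} \<subseteq> U"
    and hol: "q holomorphic_on U"
    and flat: "\<And>z. norm z \<le> r \<Longrightarrow> Re z = 0 \<Longrightarrow> norm (q z) \<le> 1"
    and arc: "\<And>z. norm z = r \<Longrightarrow> Re z \<ge> 0 \<Longrightarrow> norm (q z) \<le> exp M"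
    and x: "0 \<le> x" "x \<le> r"
  shows "norm (q (of_real x)) \<le> exp (2 * M * x / r)"
proof -
  \<comment> \<open>\<open>Re W\<close> is at least 1 on the arc and nonnegative on the diameter, and \<open>W z = O(z)\<close> at 0.\<close>
  define W where "W z = 2 * z / of_real r - z^2 / of_real (r^2)" for z :: complex
  define H where "H = {z. norm z \<le> r \<and> Re z \<ge> 0}"
  define F where "F z = q z * exp (- of_real M * W z)" for z
  have normF: "norm (F z) = norm (q z) * exp (- M * Re (W z))" for z
    by (simp add: F_def norm_mult)
  have ReW: "Re (W z) = 2 * Re z / r - ((Re z)^2 - (Im z)^2) / r^2" for z
  proof -
    have "Re (z^2 / of_real (r^2)) = Re (z^2) / r^2" by (rule Re_divide_of_real)
    moreover have "Re (2 * z / of_real r) = 2 * Re z / r" by (simp add: Re_divide_of_real)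
    moreover have "Re (z^2) = (Re z)^2 - (Im z)^2" by (simp add: power2_eq_square)
    ultimately show ?thesis by (simp add: W_def)
  qed
  have sub: "H \<subseteq> cball 0 r" by (auto simp: H_def)
  have clH: "closed H" unfolding H_def
    by (intro closed_Collect_conj closed_Collect_le continuous_intros)
  have bd: "bounded H" using sub bounded_cball bounded_subset by blast
  have holF: "F holomorphic_on U"
    unfolding F_def W_def using r by (intro holomorphic_intros hol) auto
  have HU: "H \<subseteq> U" using U H_def by auto
  have int: "{z. norm z < r \<and> Re z > 0} \<subseteq> interior H"
  proof (rule interior_maximal)
    show "open {z::complex. norm z < r \<and> Re z > 0}"
      by (intro open_Collect_conj open_Collect_less continuous_intros)
  qed (auto simp: H_def)
  have "norm (F (of_real x)) \<le> 1"
  proof (rule maximum_modulus_frontier[of F H])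
    show "F holomorphic_on interior H"
      using holF HU interior_subset holomorphic_on_subset by blast
    show "continuous_on (closure H) F"
      using clH HU holF by (simp add: holomorphic_on_imp_continuous_on holomorphic_on_subset)
    show "bounded H" by (rule bd)
    show "of_real x \<in> H" using x r by (auto simp: H_def)
    fix z assume z: "z \<in> frontier H"
    then have zH: "z \<in> H" and "z \<notin> interior H"
      using clH by (auto simp: frontier_def)
    then consider "norm z = r" "Re z \<ge> 0" | "Re z = 0" "norm z \<le> r"
      using int unfolding H_def by force
    then show "norm (F z) \<le> 1"
    proof cases
      case 1
      have "(Re z)^2 + (Im z)^2 = r^2" using 1 by (metis cmod_power2)
      then have eq: "(Re z)^2 - (Im z)^2 = 2 * (Re z)^2 - r^2" by simp
      \<comment> \<open>Both factors Re z / r and 1 - Re z / r lie in [0, 1] on the arc.\<close>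
      have "Re (W z) = 1 + 2 * (Re z / r) * (1 - Re z / r)"
        using r unfolding ReW eq by (simp add: divide_simps) (simp add: power2_eq_square algebra_simps)
      moreover have "Re z / r \<le> 1" "0 \<le> Re z / r" using 1 r complex_Re_le_cmod[of z] by auto
      ultimately have W1: "Re (W z) \<ge> 1" using mult_nonneg_nonneg[of "Re z / r" "1 - Re z / r"] by simp
      have "norm (F z) \<le> exp M * exp (- M * Re (W z))"
        unfolding normF using arc[of z] 1 by (intro mult_right_mono) auto
      also have "\<dots> = exp (M * (1 - Re (W z)))" by (simp add: exp_add[symmetric] algebra_simps)
      also have "\<dots> \<le> 1" using M W1 by (simp add: mult_nonneg_nonpos)
      finally show ?thesis .
    next
      case 2
      have "Re (W z) \<ge> 0" unfolding ReW using 2 by simp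
      then have "exp (- M * Re (W z)) \<le> 1" using M by simp
      then show ?thesis using flat[of z] 2 unfolding normF by (intro mult_le_one) auto
    qed
  qed
  moreover have "Re (W (of_real x)) \<le> 2 * x / r" unfolding ReW by simp
  ultimately have "norm (q (of_real x)) * exp (- M * Re (W (of_real x))) \<le> 1" by (simp add: normF)
  then have "norm (q (of_real x)) \<le> exp (M * Re (W (of_real x)))" by (simp add: exp_minus field_simps)
  also have "\<dots> \<le> exp (M * (2 * x / r))"
    using mult_left_mono[OF \<open>Re (W (of_real x)) \<le> 2 * x / r\<close> M] by simp
  finally show ?thesis by (simp add: mult_ac)
qed

text \<open>
  The quotient of a function by its reflection in the line \<open>Re z = Re s\<^sub>0\<close> has modulus 1 on that
  line, so zeros to the left of the line are never divided by and need not be located.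
\<close>

lemma reflection_inequality:
  fixes f :: "complex \<Rightarrow> complex"
  assumes r: "0 < r" "r < R" and M: "M \<ge> 0"
    and hol: "f holomorphic_on ball s\<^sub>0 R"
    and nz: "\<And>w. w \<in> ball s\<^sub>0 R \<Longrightarrow> Re w \<ge> Re s\<^sub>0 \<Longrightarrow> f w \<noteq> 0"
    and le: "\<And>z w. dist s\<^sub>0 z = r \<Longrightarrow> Re z \<le> Re s\<^sub>0 \<Longrightarrow> dist s\<^sub>0 w = r \<Longrightarrow> Re w \<ge> Re s\<^sub>0 \<Longrightarrow>
               norm (f z) \<le> exp M * norm (f w)"
    and x: "0 \<le> x" "x \<le> r"
  shows "norm (f (s\<^sub>0 - of_real x)) \<le> exp (2 * M * x / r) * norm (f (s\<^sub>0 + of_real x))"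
proof -
  define U where "U = {z. z \<in> ball 0 R \<and> f (s\<^sub>0 + z) \<noteq> 0}"
  \<comment> \<open>\<open>- cnj z\<close> is the mirror image of z in the imaginary axis. The outer
    conjugation restores holomorphy and leaves the modulus alone.\<close>
  define q where "q z = cnj (f (s\<^sub>0 - cnj z)) / f (s\<^sub>0 + z)" for z
  have hol1: "(\<lambda>z. f (s\<^sub>0 + z)) holomorphic_on ball 0 R"
    by (rule holomorphic_on_compose_gen[OF _ hol, unfolded o_def])
       (auto intro!: holomorphic_intros simp: dist_norm)
  have hol2: "(\<lambda>z. f (s\<^sub>0 - z)) holomorphic_on ball 0 R"
    by (rule holomorphic_on_compose_gen[OF _ hol, unfolded o_def])
       (auto intro!: holomorphic_intros simp: dist_norm)
  have hol3: "(\<lambda>z. cnj (f (s\<^sub>0 - cnj z))) holomorphic_on ball 0 R"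
    using holomorphic_on_compose_cnj_cnj[of "\<lambda>z. f (s\<^sub>0 - z)" "ball 0 R"]
        holomorphic_on_subset[OF hol2, of "cnj ` ball 0 R"]
    by (auto simp: o_def image_subset_iff)
  have opU: "open U"
    unfolding U_def using continuous_open_preimage[OF holomorphic_on_imp_continuous_on[OF hol1], of "- {0}"]
    by (simp add: vimage_def Int_def open_Compl)
  have UR: "U \<subseteq> ball 0 R" by (auto simp: U_def)
  have "norm (q (of_real x)) \<le> exp (2 * M * x / r)"
  proof (rule half_disc_maximum_modulus[of r M U])
    show "{z. norm z \<le> r \<and> 0 \<le> Re z} \<subseteq> U"
      using nz r by (auto simp: U_def dist_norm)
    show "q holomorphic_on U" unfolding q_def
      by (intro holomorphic_intros holomorphic_on_subset[OF hol1 UR] holomorphic_on_subset[OF hol3 UR])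
          (auto simp: U_def)
    show "norm (q z) \<le> 1" if "norm z \<le> r" "Re z = 0" for z
    proof -
      have "- cnj z = z" using that by (simp add: complex_eq_iff)
      then have "s\<^sub>0 - cnj z = s\<^sub>0 + z" by (metis add.commute diff_conv_add_uminus)
      then show ?thesis unfolding q_def norm_divide complex_mod_cnj by (simp only:) (simp add: divide_le_eq_1)
    qed
    show "norm (q z) \<le> exp M" if "norm z = r" "Re z \<ge> 0" for z
      using le[of "s\<^sub>0 - cnj z" "s\<^sub>0 + z"] nz[of "s\<^sub>0 + z"] that r
      by (auto simp: q_def norm_divide dist_norm divide_simps)
  qed (use r M opU x in auto)
  then show ?thesis
    using nz[of "s\<^sub>0 + of_real x"] x r by (auto simp: q_def norm_divide dist_norm divide_simps)
qed

text \<open>The form in which the inequality is applied: one lower bound m to the right of the line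
  and one upper bound U on the left half of the circle give M = ln (U / m).\<close>

lemma reflection_bound:
  fixes f :: "complex \<Rightarrow> complex"
  assumes r: "0 < r" "r < R" and m: "0 < m" "m \<le> U"
    and hol: "f holomorphic_on ball s\<^sub>0 R"
    and right: "\<And>w. w \<in> ball s\<^sub>0 R \<Longrightarrow> Re w \<ge> Re s\<^sub>0 \<Longrightarrow> m \<le> norm (f w)"
    and left: "\<And>z. dist s\<^sub>0 z = r \<Longrightarrow> Re z \<le> Re s\<^sub>0 \<Longrightarrow> norm (f z) \<le> U"
    and x: "0 \<le> x" "x \<le> r"
  shows "norm (f (s\<^sub>0 - of_real x)) \<le> exp (2 * ln (U / m) * x / r) * norm (f (s\<^sub>0 + of_real x))"
proof (rule reflection_inequality[OF r _ hol _ _ x])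
  show "ln (U / m) \<ge> 0" using m by simp
  show "f w \<noteq> 0" if "w \<in> ball s\<^sub>0 R" "Re w \<ge> Re s\<^sub>0" for w
    using right[OF that] m by auto
  show "norm (f z) \<le> exp (ln (U / m)) * norm (f w)"
    if "dist s\<^sub>0 z = r" "Re z \<le> Re s\<^sub>0" "dist s\<^sub>0 w = r" "Re w \<ge> Re s\<^sub>0" for z w
  proof -
    have "norm (f z) \<le> U / m * m" using left[OF that(1,2)] m by simp
    also have "\<dots> \<le> U / m * norm (f w)" using right[of w] that r m by (intro mult_left_mono) auto
    finally show ?thesis using m by simp
  qed
qed

section \<open>Analytic continuation\<close>

definition char_sum :: "(nat \<Rightarrow> real) \<Rightarrow> nat \<Rightarrow> real" where
  "char_sum \<psi> N = (\<Sum>n\<in>{0<..N}. \<psi> n)"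

lemma char_sum_Suc: "char_sum a (Suc N) = char_sum a N + a (Suc N)"
proof -
  have "{0<..Suc N} = insert (Suc N) {0<..N}" by auto
  then show ?thesis by (simp add: char_sum_def)
qed

definition cont_term :: "(nat \<Rightarrow> real) \<Rightarrow> nat \<Rightarrow> nat \<Rightarrow> complex \<Rightarrow> complex" where
  "cont_term \<psi> \<kappa> n s = (s - 1) ^ \<kappa> * of_real (char_sum \<psi> n) * (npow n s - npow (Suc n) s)
      - of_nat \<kappa> * s * (npow n (s - 1) - npow (Suc n) (s - 1))"

text \<open>
  Abel summation for \<open>(s - 1)\<^sup>\<kappa> D(s)\<close>. The pole of order \<open>\<kappa> \<le> 1\<close> at 1 is removed by subtracting
  \<open>\<kappa> s = \<Sum>n. \<kappa> s (n\<^bsup>1-s\<^esup> - (n+1)\<^bsup>1-s\<^esup>)\<close> term by term, so that the series converges for \<open>Re s > 1 / 2\<close>.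
\<close>

definition dirichlet_cont :: "(nat \<Rightarrow> real) \<Rightarrow> nat \<Rightarrow> complex \<Rightarrow> complex" where
  "dirichlet_cont \<psi> \<kappa> s = of_nat \<kappa> * s + (\<Sum>n. cont_term \<psi> \<kappa> (Suc n) s)"

text \<open>\<open>\<kappa>\<close> is the mean value of \<open>\<psi>\<close> and the order of the
  pole at 1: 1 for zeta, 0 for \<open>g3\<close>. The square root in the error is generous for both
  and still leaves a strip to the left of 1, where the reflection takes place.\<close>

locale bounded_character = sign_character +
  fixes \<kappa> :: nat and C :: real
  assumes \<kappa>: "\<kappa> \<le> 1" and C: "C \<ge> 0"
    and char_sum_bound: "N > 0 \<Longrightarrow> \<bar>char_sum \<psi> N - real \<kappa> * real N\<bar> \<le> C * sqrt (real N)"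
begin

lemma norm_pow_\<kappa>_le: "norm ((s - 1) ^ \<kappa>) \<le> 1 + norm (s::complex)"
proof -
  have "\<kappa> = 0 \<or> \<kappa> = 1" using \<kappa> by auto
  then show ?thesis using norm_triangle_ineq4[of s 1] by auto
qed

text \<open>The term is the increment over [n, n + 1] of a function \<open>f\<close> of a real
  variable u. In its derivative the two parts combine to a multiple of
  \<open>char_sum \<psi> n - real \<kappa> * u\<close>, which is only of order sqrt n; this gives
  convergence up to the line Re s = 1/2.\<close>

lemma norm_cont_term_le:
  assumes n: "n > 0" and s: "Re s \<ge> 0"
  shows "norm (cont_term \<psi> \<kappa> n s) \<le> (1 + norm s)\<^sup>2 * (C + 1) * real n powr (- (Re s + 1 / 2))"
proof -
  define f where "f u = - ((s - 1) ^ \<kappa> * of_real (char_sum \<psi> n) * exp (- s * of_real (ln u)))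
      + of_nat \<kappa> * s * exp (- (s - 1) * of_real (ln u))" for u :: real
  define f' where
      "f' u = s * (s - 1) ^ \<kappa> * exp (- (s + 1) * of_real (ln u)) * of_real (char_sum \<psi> n - real \<kappa> * u)"
      for u :: real
  define B where "B = (1 + norm s)\<^sup>2 * (C + 1) * real n powr (- (Re s + 1 / 2))"
  have der: "(f has_vector_derivative f' u) (at u)" if "u > 0" for u
  proof -
    have ln: "((\<lambda>u. complex_of_real (ln u)) has_vector_derivative of_real (1 / u)) (at u)"
      using that by (intro has_vector_derivative_of_real)
          (auto intro!: derivative_eq_intros simp: has_real_derivative_iff_has_vector_derivative[symmetric])
    have ex: "((\<lambda>u. exp (c * complex_of_real (ln u))) has_vector_derivative of_real (1 / u)
        * (c * exp (c * of_real (ln u)))) (at u)" for c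
    proof -
      have "((\<lambda>z. exp (c * z)) has_field_derivative c * exp (c * of_real (ln u))) (at (of_real (ln u)))"
        by (auto intro!: derivative_eq_intros)
      from field_vector_diff_chain_at[OF ln this] show ?thesis by (simp add: o_def)
    qed
    have u: "of_real (1 / u) * exp (- s * of_real (ln u)) = exp (- (s + 1) * of_real (ln u))"
            "exp (- (s - 1) * of_real (ln u)) = of_real (u^2) * exp (- (s + 1) * of_real (ln u))"
    proof -
      have *: "exp (of_real (ln u)) = complex_of_real u" using that by (simp add: exp_of_real)
      show "of_real (1 / u) * exp (- s * of_real (ln u)) = exp (- (s + 1) * of_real (ln u))"
        using that by (simp add: distrib_right exp_diff exp_minus * field_simps)
      have "exp (- (s - 1) * of_real (ln u))
          = exp (of_real (ln u) + of_real (ln u) + - (s + 1) * of_real (ln u))"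
        by (rule arg_cong[where f = exp]) (simp add: algebra_simps)
      then show "exp (- (s - 1) * of_real (ln u)) = of_real (u^2) * exp (- (s + 1) * of_real (ln u))"
        by (simp only: exp_add *) (simp add: power2_eq_square)
    qed
    have d: "(f has_vector_derivative -
        ((s - 1) ^ \<kappa> * of_real (char_sum \<psi> n) * (of_real (1 / u) * (- s * exp (- s * of_real (ln u)))))
      + of_nat \<kappa> * s * (of_real (1 / u) * (- (s - 1) * exp (- (s - 1) * of_real (ln u))))) (at u)"
      unfolding f_def
          by (intro has_vector_derivative_add has_vector_derivative_minus has_vector_derivative_mult_right ex)
    have "- ((s - 1) ^ \<kappa> * of_real (char_sum \<psi> n) * (of_real (1 / u) * (- s * exp (- s * of_real (ln u)))))
      = s * (s - 1) ^ \<kappa> * exp (- (s + 1) * of_real (ln u)) * of_real (char_sum \<psi> n)"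
      unfolding u(1)[symmetric] by simp
    \<comment> \<open>Here \<open>\<kappa> \<le> 1\<close> matters: it gives \<kappa> (s - 1) =
      \<kappa> (s - 1)^\<kappa>, so that both parts share a factor.\<close>
    moreover have "of_nat \<kappa> * s * (of_real (1 / u) * (- (s - 1) * exp (- (s - 1) * of_real (ln u))))
      = - (s * (s - 1) ^ \<kappa> * exp (- (s + 1) * of_real (ln u)) * of_real (real \<kappa> * u))"
    proof -
      have "\<kappa> = 0 \<or> \<kappa> = 1" using \<kappa> by auto
      then show ?thesis unfolding u(2) using that by (auto simp: field_simps power2_eq_square)
    qed
    ultimately have
        "(f has_vector_derivative s * (s - 1) ^ \<kappa> * exp (- (s + 1) * of_real (ln u)) * of_real (char_sum \<psi> n)
        + - (s * (s - 1) ^ \<kappa> * exp (- (s + 1) * of_real (ln u)) * of_real (real \<kappa> * u))) (at u)"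
      using d by (simp only:)
    then show ?thesis unfolding f'_def of_real_diff by (simp only: right_diff_distrib add_uminus_conv_diff)
  qed
  have bound: "norm (f' u) \<le> B" if "u \<in> {real n<..<real (Suc n)}" for u
  proof -
    have u: "real n < u" "u < real n + 1" "u > 0" "real n \<ge> 1" using that n by auto
    have "\<bar>char_sum \<psi> n - real \<kappa> * u\<bar> \<le> \<bar>char_sum \<psi> n - real \<kappa> * real n\<bar> + \<bar>real \<kappa> * (u - real n)\<bar>"
      by (simp add: right_diff_distrib)
    also have "\<bar>real \<kappa> * (u - real n)\<bar> \<le> 1 * 1" unfolding abs_mult using u \<kappa> by (intro mult_mono) auto
    also have "1 * 1 \<le> sqrt (real n)" using u by simp
    finally have 1: "\<bar>char_sum \<psi> n - real \<kappa> * u\<bar> \<le> (C + 1) * sqrt (real n)"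
      using char_sum_bound[OF n] by (simp add: algebra_simps)
    have "norm (exp (- (s + 1) * of_real (ln u))) = u powr (- (Re s + 1))"
      using u by (simp add: powr_def)
    also have "\<dots> \<le> real n powr (- (Re s + 1))" using u s by (intro powr_mono2') auto
    finally have 2: "norm (exp (- (s + 1) * of_real (ln u))) \<le> real n powr (- (Re s + 1))" .
    have "norm (s * (s - 1) ^ \<kappa>) \<le> (1 + norm s) * (1 + norm s)"
      unfolding norm_mult using norm_pow_\<kappa>_le[of s] by (intro mult_mono) auto
    then have "norm (f' u) \<le> ((1 + norm s) * (1 + norm s)) * real n powr (- (Re s + 1))
        * ((C + 1) * sqrt (real n))"
      unfolding f'_def norm_mult[of _ "of_real _"] norm_mult[of _ "exp _"] norm_of_real
      using 1 2 by (intro mult_mono) auto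
    also have "\<dots> = (1 + norm s)\<^sup>2 * (C + 1) * (real n powr (- (Re s + 1)) * real n powr (1 / 2))"
      by (simp add: powr_half_sqrt power2_eq_square)
    also have "real n powr (- (Re s + 1)) * real n powr (1 / 2) = real n powr (- (Re s + 1 / 2))"
    proof -
      have "- (Re s + 1) + 1 / 2 = - (Re s + 1 / 2)" by simp
      then show ?thesis by (simp only: powr_add[symmetric])
    qed
    finally show ?thesis by (simp only: B_def)
  qed
  have "norm (f (real (Suc n)) - f (real n)) \<le> B * real (Suc n) - B * real n"
  proof (rule differentiable_bound_general)
    show "continuous_on {real n..real (Suc n)} f"
      by (rule continuous_on_vector_derivative[where f' = f'], rule has_vector_derivative_at_within,
          rule der) (use n in auto)
    show "continuous_on {real n..real (Suc n)} (\<lambda>u. B * u)" by (intro continuous_intros)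
    show "(f has_vector_derivative f' x) (at x)" if "real n < x" "x < real (Suc n)" for x
      using der that n by auto
    show "((\<lambda>u. B * u) has_vector_derivative B) (at x)" if "real n < x" "x < real (Suc n)" for x
      by (auto intro!: derivative_eq_intros simp: has_real_derivative_iff_has_vector_derivative[symmetric])
    show "norm (f' x) \<le> B" if "real n < x" "x < real (Suc n)" for x
      using bound that by auto
  qed simp
  moreover have "f (real (Suc n)) - f (real n) = cont_term \<psi> \<kappa> n s"
    by (simp add: f_def cont_term_def npow_def algebra_simps)
  moreover have "B * real (Suc n) - B * real n = B" by (simp add: algebra_simps)
  ultimately show ?thesis by (simp add: B_def)
qed

lemma holomorphic_cont: "dirichlet_cont \<psi> \<kappa> holomorphic_on {s. Re s > 1 / 2}"
proof -
  have "(\<lambda>s. \<Sum>n. cont_term \<psi> \<kappa> (Suc n) s) holomorphic_on {s. Re s > 1 / 2}"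
  proof (rule holomorphic_uniform_sequence[where f = "\<lambda>N s. \<Sum>n<N. cont_term \<psi> \<kappa> (Suc n) s"])
    show "open {s. Re s > 1 / 2}" by (rule open_halfspace_Re_gt)
    show "(\<lambda>s. \<Sum>n<N. cont_term \<psi> \<kappa> (Suc n) s) holomorphic_on {s. Re s > 1 / 2}" for N
      unfolding cont_term_def npow_def by (intro holomorphic_intros)
    fix x assume "x \<in> {s. Re s > 1 / 2}"
    then have x: "Re x > 1 / 2" by simp
    \<comment> \<open>Half the distance to the boundary line, so that the exponent Re s + 1/2 is at
      least 1 + d on the whole disc.\<close>
    define d where "d = (Re x - 1 / 2) / 2"
    have d: "d > 0" using x by (simp add: d_def)
    have Re: "Re s \<ge> 1 / 2 + d" if "s \<in> cball x d" for s
    proof -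
      have "Re x - Re s \<le> d" using complex_Re_le_cmod[of "x - s"] that by (simp add: dist_norm)
      then show ?thesis by (simp add: d_def field_simps)
    qed
    have nrm: "norm s \<le> norm x + d" if "s \<in> cball x d" for s
      using that norm_triangle_ineq2[of s x] by (auto simp: dist_norm norm_minus_commute)
    have "uniform_limit (cball x d) (\<lambda>N s. \<Sum>n<N. cont_term \<psi> \<kappa> (Suc n) s)
        (\<lambda>s. \<Sum>n. cont_term \<psi> \<kappa> (Suc n) s) sequentially"
    proof (rule Weierstrass_m_test)
      show "norm (cont_term \<psi> \<kappa> (Suc n) s) \<le> (1 + (norm x + d))\<^sup>2 * (C + 1) * real (Suc n) powr (- (1 + d))"
        if s: "s \<in> cball x d" for n s
      proof -
        have "norm (cont_term \<psi> \<kappa> (Suc n) s)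
            \<le> (1 + norm s)\<^sup>2 * (C + 1) * real (Suc n) powr (- (Re s + 1 / 2))"
          by (rule norm_cont_term_le) (use Re[OF s] d in auto)
        also have "\<dots> \<le> (1 + (norm x + d))\<^sup>2 * (C + 1) * real (Suc n) powr (- (1 + d))"
          using Re[OF s] nrm[OF s] C by (intro mult_mono power_mono powr_mono) auto
        finally show ?thesis .
      qed
      show "summable (\<lambda>n. (1 + (norm x + d))\<^sup>2 * (C + 1) * real (Suc n) powr (- (1 + d)))"
        using summable_Suc_powr(1)[of "1 + d"] d by (intro summable_mult) auto
    qed
    moreover have "cball x d \<subseteq> {s. Re s > 1 / 2}" using Re d by force
    ultimately show "\<exists>d>0. cball x d \<subseteq> {s. Re s > 1 / 2} \<and>
        uniform_limit (cball x d) (\<lambda>N s. \<Sum>n<N. cont_term \<psi> \<kappa> (Suc n) s)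
            (\<lambda>s. \<Sum>n. cont_term \<psi> \<kappa> (Suc n) s) sequentially"
      using d by blast
  qed
  then show ?thesis unfolding dirichlet_cont_def by (intro holomorphic_intros)
qed

text \<open>The exponent Re s + 1/2 is at least 5/4, and the sum of n^(-5/4) is at most 5. Any
  polynomial growth in s would do, since the bound enters the reflection inequality through a
  logarithm.\<close>

lemma norm_cont_le:
  assumes s: "Re s \<ge> 3 / 4"
  shows "norm (dirichlet_cont \<psi> \<kappa> s) \<le> (5 * C + 6) * (1 + norm s)\<^sup>2"
proof -
  have sm: "summable (\<lambda>n. (1 + norm s)\<^sup>2 * (C + 1) * real (Suc n) powr (- (5/4)))"
    using summable_Suc_powr(1)[of "5/4"] by (intro summable_mult) auto
  have le: "norm (cont_term \<psi> \<kappa> (Suc n) s) \<le> (1 + norm s)\<^sup>2 * (C + 1) * real (Suc n) powr (- (5/4))" for n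
  proof -
    have "norm (cont_term \<psi> \<kappa> (Suc n) s) \<le> (1 + norm s)\<^sup>2 * (C + 1) * real (Suc n) powr (- (Re s + 1 / 2))"
      by (rule norm_cont_term_le) (use s in auto)
    also have "\<dots> \<le> (1 + norm s)\<^sup>2 * (C + 1) * real (Suc n) powr (- (5/4))"
      using s C by (intro mult_left_mono powr_mono) auto
    finally show ?thesis .
  qed
  have "norm (\<Sum>n. cont_term \<psi> \<kappa> (Suc n) s) \<le> (\<Sum>n. (1 + norm s)\<^sup>2 * (C + 1) * real (Suc n) powr (- (5/4)))"
    by (rule norm_suminf_le[OF le sm])
  also have "\<dots> = (1 + norm s)\<^sup>2 * (C + 1) * (\<Sum>n. real (Suc n) powr (- (5/4)))"
    by (rule suminf_mult) (use summable_Suc_powr(1)[of "5/4"] in auto)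
  also have "\<dots> \<le> (1 + norm s)\<^sup>2 * (C + 1) * 5"
    using summable_Suc_powr(2)[of "5/4"] C by (intro mult_left_mono) auto
  finally have 1: "norm (\<Sum>n. cont_term \<psi> \<kappa> (Suc n) s) \<le> (1 + norm s)\<^sup>2 * (C + 1) * 5" .
  have "norm (of_nat \<kappa> * s) \<le> 1 * (1 + norm s)"
    unfolding norm_mult norm_of_nat using \<kappa> by (intro mult_mono) auto
  also have "\<dots> \<le> (1 + norm s) * (1 + norm s)" by (intro mult_right_mono) auto
  also have "\<dots> = (1 + norm s)\<^sup>2" by (simp add: power2_eq_square)
  finally have "norm (dirichlet_cont \<psi> \<kappa> s) \<le> (1 + norm s)\<^sup>2 + (1 + norm s)\<^sup>2 * (C + 1) * 5"
    unfolding dirichlet_cont_def using 1 norm_triangle_mono by blast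
  then show ?thesis by (simp add: algebra_simps)
qed

text \<open>Summation by parts turns the first half of \<open>cont_term\<close> into the Dirichlet
  series; the second half telescopes to \<open>of_nat \<kappa> * s\<close> and cancels the summand
  in front.\<close>

lemma cont_eq_dirichlet_series:
  assumes s: "Re s > 1"
  shows "dirichlet_cont \<psi> \<kappa> s = (s - 1) ^ \<kappa> * dirichlet_series \<psi> s"
proof -
  have lim: "(\<lambda>N. npow (Suc N) (s - 1)) \<longlonglongrightarrow> 0"
  proof (rule Lim_null_comparison)
    show "\<forall>\<^sub>F N in sequentially. norm (npow (Suc N) (s - 1)) \<le> real (Suc N) powr (- (Re s - 1))"
      by (simp add: norm_npow)
    show "(\<lambda>N. real (Suc N) powr (- (Re s - 1))) \<longlonglongrightarrow> 0"
      using s by (intro tendsto_neg_powr filterlim_compose[OF filterlim_real_sequentially filterlim_Suc]) auto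
  qed
  have tele: "(\<lambda>n. npow (Suc n) (s - 1) - npow (Suc (Suc n)) (s - 1)) sums (npow (Suc 0) (s - 1) - 0)"
    by (rule telescope_sums'[OF lim])
  have part: "(\<Sum>n<N. of_real (char_sum \<psi> (Suc n)) * (npow (Suc n) s - npow (Suc (Suc n)) s))
     = (\<Sum>n<N. of_real (\<psi> (Suc n)) * npow (Suc n) s) - of_real (char_sum \<psi> N) * npow (Suc N) s" for N
  proof (induction N)
    case (Suc N)
    then show ?case by (simp add: char_sum_Suc algebra_simps)
  qed (simp add: char_sum_def)
  have bnd: "\<bar>char_sum \<psi> N\<bar> \<le> real N" for N
  proof -
    have "\<bar>char_sum \<psi> N\<bar> \<le> (\<Sum>n\<in>{0<..N}. 1)" unfolding char_sum_def
      by (rule order_trans[OF sum_abs sum_mono]) (use abs_\<psi>_le in auto)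
    then show ?thesis by simp
  qed
  have "(\<lambda>N. of_real (char_sum \<psi> N) * npow (Suc N) s) \<longlonglongrightarrow> 0"
  proof (rule Lim_null_comparison)
    show "\<forall>\<^sub>F N in sequentially. norm (of_real (char_sum \<psi> N) * npow (Suc N) s) \<le> norm (npow (Suc N) (s - 1))"
    proof (rule always_eventually, rule allI)
      fix N
      have "npow (Suc N) s = npow (Suc N) 1 * npow (Suc N) (s - 1)" by (simp flip: npow_add)
      moreover have "norm (npow (Suc N) 1) = 1 / real (Suc N)"
          by (subst norm_npow) (auto simp: powr_minus_divide)
      moreover have "\<bar>char_sum \<psi> N\<bar> * (1 / real (Suc N)) \<le> 1" using bnd[of N] by (simp add: field_simps)
      ultimately show "norm (of_real (char_sum \<psi> N) * npow (Suc N) s) \<le> norm (npow (Suc N) (s - 1))"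
        using mult_right_mono[of "\<bar>char_sum \<psi> N\<bar> * (1 / real (Suc N))" 1 "norm (npow (Suc N) (s - 1))"]
        by (simp add: norm_mult del: of_nat_Suc)
    qed
    show "(\<lambda>N. norm (npow (Suc N) (s - 1))) \<longlonglongrightarrow> 0" using tendsto_norm_zero[OF lim] .
  qed
  then have "(\<lambda>n. of_real (char_sum \<psi> (Suc n)) * (npow (Suc n) s - npow (Suc (Suc n)) s)) sums
      (dirichlet_series \<psi> s - 0)"
    using dirichlet_series_sums[OF s, of \<psi>] abs_\<psi>_le unfolding sums_def part by (intro tendsto_diff) auto
  from sums_diff[OF sums_mult[OF this, of "(s - 1) ^ \<kappa>"] sums_mult[OF tele, of "of_nat \<kappa> * s"]]
  have "(\<lambda>n. cont_term \<psi> \<kappa> (Suc n) s) sums ((s - 1) ^ \<kappa> * dirichlet_series \<psi> s - of_nat \<kappa> * s)"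
    by (simp add: cont_term_def mult.assoc)
  then show ?thesis by (simp add: dirichlet_cont_def sums_iff)
qed

end

section \<open>Zero-free region\<close>

context bounded_character begin

text \<open>The continuation of the Dirichlet series itself. For \<kappa> = 1 its value at the pole
  is the default of division by zero, so the point 1 is left out of the domain of
  holomorphy.\<close>

definition lfun :: "complex \<Rightarrow> complex" where
  "lfun s = dirichlet_cont \<psi> \<kappa> s / (s - 1) ^ \<kappa>"

lemma lfun_eq_dirichlet_series: "Re s > 1 \<Longrightarrow> lfun s = dirichlet_series \<psi> s"
  by (cases "s = 1") (auto simp: lfun_def cont_eq_dirichlet_series)

lemma holomorphic_lfun: "lfun holomorphic_on {s. Re s > 1 / 2} - {1}"
  unfolding lfun_def by (intro holomorphic_intros holomorphic_on_subset[OF holomorphic_cont]) auto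

lemma norm_lfun_ge:
  assumes "\<delta> > 0" "\<delta> \<le> 1" "Re s \<ge> 1 + \<delta>" "Re s \<le> 2"
  shows "norm (lfun s) \<ge> \<delta> / 2"
proof -
  have "\<delta> / 2 \<le> (Re s - 1) / 2" using assms by simp
  also have "\<dots> \<le> (Re s - 1) / Re s" using assms by (intro divide_left_mono) auto
  finally have "\<delta> / 2 \<le> (Re s - 1) / Re s" .
  also have "\<dots> \<le> norm (dirichlet_series \<psi> s)" using assms by (intro norm_dirichlet_series_ge) auto
  finally show ?thesis using assms by (simp add: lfun_eq_dirichlet_series)
qed

text \<open>The distance \<open>t\<^sub>0 / 2\<close> from the real axis controls the division by
  \<open>(s - 1) ^ \<kappa>\<close>. The factor 32 is 16 from (4 T)^2 times 2 from that
  distance.\<close>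

lemma norm_lfun_le:
  assumes t\<^sub>0: "0 < t\<^sub>0" "t\<^sub>0 \<le> 1" and "Re s \<ge> 3 / 4" "Re s \<le> 2" "t\<^sub>0 / 2 \<le> \<bar>Im s\<bar>" "\<bar>Im s\<bar> \<le> T + 1" "T \<ge> 3"
  shows "norm (lfun s) \<le> 32 * (5 * C + 6) * T\<^sup>2 / t\<^sub>0"
proof -
  have ns: "norm s \<le> T + 3" using cmod_le[of s] assms by linarith
  have "norm (dirichlet_cont \<psi> \<kappa> s) \<le> (5 * C + 6) * (1 + norm s)\<^sup>2" by (rule norm_cont_le) (use assms in auto)
  also have "\<dots> \<le> (5 * C + 6) * (4 * T)\<^sup>2" using C ns assms by (intro mult_left_mono power_mono) auto
  finally have 1: "norm (dirichlet_cont \<psi> \<kappa> s) \<le> (5 * C + 6) * (4 * T)\<^sup>2" .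
  have "norm (s - 1) \<ge> t\<^sub>0 / 2" using abs_Im_le_cmod[of "s - 1"] assms by simp
  moreover have "\<kappa> = 0 \<or> \<kappa> = 1" using \<kappa> by auto
  ultimately have "norm ((s - 1) ^ \<kappa>) \<ge> t\<^sub>0 / 2" using t\<^sub>0 by auto
  then have "norm (lfun s) \<le> (5 * C + 6) * (4 * T)\<^sup>2 / (t\<^sub>0 / 2)"
    unfolding lfun_def norm_divide using 1 t\<^sub>0 C by (intro frac_le) auto
  then show ?thesis by (simp add: power2_eq_square mult_ac)
qed

text \<open>Reflection in the line midway between the abscissas 1 + \<eta> and 1 + \<eta>' exchanges
  the two points; the circle of radius \<open>t\<^sub>0 / 4\<close> reaches to the left of 1 but
  avoids the pole because |t| is at least \<open>t\<^sub>0\<close>. The second claim is the same for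
  the difference quotient at \<beta> + i t, which stays bounded away from 0 on the right as long as
  the value at that point is small.\<close>

lemma lfun_ratio:
  assumes t\<^sub>0: "0 < t\<^sub>0" "t\<^sub>0 \<le> 1" and t: "t\<^sub>0 \<le> \<bar>t\<bar>" "\<bar>t\<bar> \<le> T" and T: "T \<ge> 3"
    and \<eta>: "0 < \<eta>" "\<eta> < \<eta>'" "\<eta>' \<le> t\<^sub>0 / 16"
  defines "A \<equiv> 8192 * (5 * C + 6) / t\<^sub>0\<^sup>2"
  shows "norm (lfun (Complex (1 + \<eta>) t))
      \<le> exp (4 * \<eta>' * ln (A * T\<^sup>2 / \<eta>) / t\<^sub>0) * norm (lfun (Complex (1 + \<eta>') t))"
    and "\<beta> \<ge> 1 - \<eta> \<Longrightarrow> \<beta> < 1 + \<eta> \<Longrightarrow> norm (lfun (Complex \<beta> t)) \<le> \<eta> / 4 \<Longrightarrow>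
         norm (lfun (Complex (1 + \<eta>) t) - lfun (Complex \<beta> t)) / (1 + \<eta> - \<beta>) \<le> exp
             (4 * \<eta>' * ln (A * T\<^sup>2 / \<eta>) / t\<^sub>0) *
           (norm (lfun (Complex (1 + \<eta>') t) - lfun (Complex \<beta> t)) / (1 + \<eta>' - \<beta>))"
proof -
  define s\<^sub>0 where "s\<^sub>0 = Complex (1 + (\<eta> + \<eta>') / 2) t"
  define x where "x = (\<eta>' - \<eta>) / 2"
  define U where "U = 32 * (5 * C + 6) * T\<^sup>2 / t\<^sub>0"
  have T2: "T\<^sup>2 \<ge> 1" using T by (simp add: one_le_power)
  have "1 * 1 \<le> 32 * (5 * C + 6) * T\<^sup>2" using C T2 by (intro mult_mono) auto
  then have U1: "U \<ge> 1" using t\<^sub>0 by (simp add: U_def)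
  have x: "0 \<le> x" "x \<le> t\<^sub>0 / 4" "x \<le> \<eta>' / 2" using \<eta> by (auto simp: x_def)
  have pts: "s\<^sub>0 - of_real x = Complex (1 + \<eta>) t" "s\<^sub>0 + of_real x = Complex (1 + \<eta>') t"
    by (auto simp: s\<^sub>0_def x_def complex_eq_iff field_simps)
  have near: "Re z \<le> 2" "t\<^sub>0 / 2 \<le> \<bar>Im z\<bar>" "\<bar>Im z\<bar> \<le> T + 1" "z \<noteq> 1" "Re z > 1/2"
    if "z \<in> ball s\<^sub>0 (t\<^sub>0 / 2)" for z
  proof -
    have "\<bar>Re z - Re s\<^sub>0\<bar> < t\<^sub>0 / 2" "\<bar>Im z - Im s\<^sub>0\<bar> < t\<^sub>0 / 2"
      using that abs_Re_le_cmod[of "z - s\<^sub>0"] abs_Im_le_cmod[of "z - s\<^sub>0"]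
          by (auto simp: dist_norm norm_minus_commute)
    then have re: "\<bar>Re z - (1 + (\<eta> + \<eta>') / 2)\<bar> < t\<^sub>0 / 2" and im: "\<bar>Im z - t\<bar> < t\<^sub>0 / 2"
      by (auto simp: s\<^sub>0_def)
    show "Re z \<le> 2" using re \<eta> t\<^sub>0 by argo
    show "Re z > 1/2" using re \<eta> t\<^sub>0 by argo
    show im': "t\<^sub>0 / 2 \<le> \<bar>Im z\<bar>" using im t t\<^sub>0 by argo
    show "\<bar>Im z\<bar> \<le> T + 1" using im t t\<^sub>0 by argo
    show "z \<noteq> 1" using im' t\<^sub>0 by auto
  qed
  have hol: "lfun holomorphic_on ball s\<^sub>0 (t\<^sub>0 / 2)"
  proof (rule holomorphic_on_subset[OF holomorphic_lfun], rule subsetI)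
    show "z \<in> {s. Re s > 1 / 2} - {1}" if "z \<in> ball s\<^sub>0 (t\<^sub>0 / 2)" for z
      using near[OF that] by simp
  qed
  have up: "norm (lfun z) \<le> U" if z: "dist s\<^sub>0 z = t\<^sub>0 / 4" for z
  proof -
    have zb: "z \<in> ball s\<^sub>0 (t\<^sub>0 / 2)" using z t\<^sub>0 by simp
    have "\<bar>Re z - Re s\<^sub>0\<bar> \<le> t\<^sub>0 / 4"
      using z abs_Re_le_cmod[of "z - s\<^sub>0"] by (auto simp: dist_norm norm_minus_commute)
    then have "Re z \<ge> 3 / 4" using \<eta> t\<^sub>0 unfolding s\<^sub>0_def complex.sel by argo
    then show ?thesis unfolding U_def using near[OF zb] t\<^sub>0 T by (intro norm_lfun_le) auto
  qed
  have low: "norm (lfun w) \<ge> \<eta> / 2" if "w \<in> ball s\<^sub>0 (t\<^sub>0 / 2)" "Re w \<ge> Re s\<^sub>0" for w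
  proof (rule norm_lfun_ge)
    show "1 + \<eta> \<le> Re w" using that(2) \<eta> unfolding s\<^sub>0_def complex.sel by argo
  qed (use near[OF that(1)] \<eta> t\<^sub>0 in auto)
  have expo: "exp (2 * ln (V / m) * x / (t\<^sub>0 / 4)) \<le> exp (4 * \<eta>' * ln (A * T\<^sup>2 / \<eta>) / t\<^sub>0)"
    if "0 < m" "m \<le> V" "V / m \<le> A * T\<^sup>2 / \<eta>" for V m
  proof -
    have "V / m \<ge> 1" using that by simp
    then have "0 \<le> ln (V / m)" "ln (V / m) \<le> ln (A * T\<^sup>2 / \<eta>)"
      using that by (auto intro!: ln_mono)
    then have "ln (V / m) * x \<le> ln (A * T\<^sup>2 / \<eta>) * (\<eta>' / 2)" using x by (intro mult_mono) auto
    then have le: "8 * (ln (V / m) * x) / t\<^sub>0 \<le> 8 * (ln (A * T\<^sup>2 / \<eta>) * (\<eta>' / 2)) / t\<^sub>0"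
      using t\<^sub>0 by (intro divide_right_mono mult_left_mono) auto
    have "2 * ln (V / m) * x / (t\<^sub>0 / 4) = 8 * (ln (V / m) * x) / t\<^sub>0"
      "4 * \<eta>' * ln (A * T\<^sup>2 / \<eta>) / t\<^sub>0 = 8 * (ln (A * T\<^sup>2 / \<eta>) * (\<eta>' / 2)) / t\<^sub>0"
      by (simp_all add: mult_ac)
    with le have "2 * ln (V / m) * x / (t\<^sub>0 / 4) \<le> 4 * \<eta>' * ln (A * T\<^sup>2 / \<eta>) / t\<^sub>0"
      by (simp only:)
    then show ?thesis by (simp only: exp_le_cancel_iff)
  qed
  have t02: "1 \<le> 1 / t\<^sub>0" using t\<^sub>0 by simp
  \<comment> \<open>Large enough for both quotients of bounds below, which are
    \<open>2 * U / \<eta>\<close> and \<open>64 * U / (t\<^sub>0 * \<eta>)\<close>.\<close>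
  have A_eq: "A * T\<^sup>2 / \<eta> = 256 * U / (t\<^sub>0 * \<eta>)"
    by (simp add: A_def U_def power2_eq_square algebra_simps)
  have "norm (lfun (s\<^sub>0 - of_real x))
      \<le> exp (2 * ln (U / (\<eta> / 2)) * x / (t\<^sub>0 / 4)) * norm (lfun (s\<^sub>0 + of_real x))"
    by (rule reflection_bound[OF _ _ _ _ hol low up x(1,2)]) (use t\<^sub>0 \<eta> U1 in auto)
  also have "\<dots> \<le> exp (4 * \<eta>' * ln (A * T\<^sup>2 / \<eta>) / t\<^sub>0) * norm (lfun (s\<^sub>0 + of_real x))"
  proof (intro mult_right_mono expo)
    have "2 * U / \<eta> * 1 \<le> 256 * U / \<eta> * (1 / t\<^sub>0)" using t02 U1 \<eta> by (intro mult_mono divide_right_mono) auto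
    then show "U / (\<eta> / 2) \<le> A * T\<^sup>2 / \<eta>" unfolding A_eq by (simp add: mult_ac)
  qed (use \<eta> t\<^sub>0 U1 in auto)
  finally show "norm (lfun (Complex (1 + \<eta>) t))
      \<le> exp (4 * \<eta>' * ln (A * T\<^sup>2 / \<eta>) / t\<^sub>0) * norm (lfun (Complex (1 + \<eta>') t))"
    by (simp only: pts)
  assume \<beta>: "\<beta> \<ge> 1 - \<eta>" "\<beta> < 1 + \<eta>" and small: "norm (lfun (Complex \<beta> t)) \<le> \<eta> / 4"
  define \<rho> where "\<rho> = Complex \<beta> t"
  \<comment> \<open>The difference quotient with its removable singularity filled. To the right of
    the line its modulus is at least \<eta> / 4: \<open>lfun w\<close> has size at least \<eta> / 2,
    \<open>lfun \<rho>\<close> at most \<eta> / 4, and w is within distance 1 of \<rho>.\<close>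
  define f where "f z = (if z = \<rho> then deriv lfun \<rho> else (lfun z - lfun \<rho>) / (z - \<rho>))" for z
  have d\<rho>: "norm (s\<^sub>0 - \<rho>) \<le> 2 * \<eta>'"
  proof -
    have "norm (s\<^sub>0 - \<rho>) \<le> \<bar>1 + (\<eta> + \<eta>') / 2 - \<beta>\<bar>"
      using cmod_le[of "s\<^sub>0 - \<rho>"] by (simp add: s\<^sub>0_def \<rho>_def)
    then show ?thesis using \<beta> \<eta> by argo
  qed
  have \<rho>b: "\<rho> \<in> ball s\<^sub>0 (t\<^sub>0 / 2)" using d\<rho> \<eta> t\<^sub>0 by (simp add: dist_norm)
  have "f holomorphic_on ball s\<^sub>0 (t\<^sub>0 / 2)"
    unfolding f_def by (rule pole_lemma[OF hol]) (use \<rho>b in auto)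
  moreover have "\<eta> / 4 \<le> norm (f w)" if w: "w \<in> ball s\<^sub>0 (t\<^sub>0 / 2)" "Re w \<ge> Re s\<^sub>0" for w
  proof -
    have ne: "w \<noteq> \<rho>"
    proof
      assume "w = \<rho>"
      then have "1 + (\<eta> + \<eta>') / 2 \<le> \<beta>" using w(2) by (simp add: s\<^sub>0_def \<rho>_def)
      then show False using \<beta> \<eta> by argo
    qed
    have "norm (w - \<rho>) \<le> norm (w - s\<^sub>0) + norm (s\<^sub>0 - \<rho>)"
        using norm_triangle_ineq[of "w - s\<^sub>0" "s\<^sub>0 - \<rho>"] by simp
    also have "\<dots> \<le> t\<^sub>0 / 2 + 2 * \<eta>'" using d\<rho> w by (auto simp: dist_norm norm_minus_commute)
    also have "\<dots> \<le> 1" using \<eta> t\<^sub>0 by argo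
    finally have "norm (w - \<rho>) \<le> 1" .
    moreover have "\<eta> / 4 \<le> norm (lfun w - lfun \<rho>)"
      using low[OF w] small norm_triangle_ineq2[of "lfun w" "lfun \<rho>"] by (simp add: \<rho>_def)
    ultimately have "\<eta> / 4 / 1 \<le> norm (lfun w - lfun \<rho>) / norm (w - \<rho>)"
      using ne \<eta> by (intro frac_le) auto
    then show ?thesis using ne by (simp add: f_def norm_divide)
  qed
  moreover have "norm (f z) \<le> 16 * U / t\<^sub>0" if z: "dist s\<^sub>0 z = t\<^sub>0 / 4" for z
  proof -
    have "t\<^sub>0 / 8 \<le> norm (z - \<rho>)"
    proof -
      have "norm (s\<^sub>0 - z) \<le> norm (s\<^sub>0 - \<rho>) + norm (z - \<rho>)"
        using norm_triangle_ineq4[of "s\<^sub>0 - \<rho>" "z - \<rho>"] by simp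
      then show ?thesis using z d\<rho> \<eta> unfolding dist_norm by argo
    qed
    moreover have "norm (lfun z - lfun \<rho>) \<le> 2 * U"
      using up[OF z] small norm_triangle_ineq4[of "lfun z" "lfun \<rho>"] \<eta> t\<^sub>0 U1 unfolding \<rho>_def by argo
    ultimately have "norm (lfun z - lfun \<rho>) / norm (z - \<rho>) \<le> 2 * U / (t\<^sub>0 / 8)"
      using t\<^sub>0 U1 by (intro frac_le) auto
    moreover have "z \<noteq> \<rho>" using \<open>t\<^sub>0 / 8 \<le> norm (z - \<rho>)\<close> t\<^sub>0 by auto
    ultimately show ?thesis by (simp add: f_def norm_divide)
  qed
  moreover have *: "\<eta> / 4 \<le> 16 * U / t\<^sub>0"
  proof -
    have "\<eta> / 4 \<le> 1 * 1" using \<eta> t\<^sub>0 by simp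
    also have "\<dots> \<le> (16 * U) * (1 / t\<^sub>0)" using U1 t02 by (intro mult_mono) auto
    finally show ?thesis by simp
  qed
  ultimately have
      "norm (f (s\<^sub>0 - of_real x)) \<le> exp (2 * ln (16 * U / t\<^sub>0 / (\<eta> / 4)) * x / (t\<^sub>0 / 4))
      * norm (f (s\<^sub>0 + of_real x))"
    by (intro reflection_bound[of "t\<^sub>0 / 4" "t\<^sub>0 / 2"]) (use t\<^sub>0 \<eta> x in auto)
  also have "\<dots> \<le> exp (4 * \<eta>' * ln (A * T\<^sup>2 / \<eta>) / t\<^sub>0) * norm (f (s\<^sub>0 + of_real x))"
  proof (intro mult_right_mono expo *)
    have "64 * U / (t\<^sub>0 * \<eta>) \<le> 256 * U / (t\<^sub>0 * \<eta>)" using t\<^sub>0 \<eta> U1 by (intro divide_right_mono) auto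
    then show "16 * U / t\<^sub>0 / (\<eta> / 4) \<le> A * T\<^sup>2 / \<eta>" unfolding A_eq by simp
  qed (use \<eta> in auto)
  finally have main:
      "norm (f (Complex (1 + \<eta>) t)) \<le> exp (4 * \<eta>' * ln (A * T\<^sup>2 / \<eta>) / t\<^sub>0) * norm (f (Complex (1 + \<eta>') t))"
    by (simp only: pts)
  have nf: "norm (f (Complex u t)) = norm (lfun (Complex u t) - lfun \<rho>) / (u - \<beta>)" if "u > \<beta>" for u
  proof -
    have "Complex u t - \<rho> = of_real (u - \<beta>)" by (simp add: \<rho>_def complex_eq_iff)
    then have "norm (Complex u t - \<rho>) = u - \<beta>" using that by (metis abs_of_pos diff_gt_0_iff_gt norm_of_real)
    moreover have "Complex u t \<noteq> \<rho>" using that by (simp add: \<rho>_def)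
    ultimately show ?thesis by (simp add: f_def norm_divide)
  qed
  show "norm (lfun (Complex (1 + \<eta>) t) - lfun (Complex \<beta> t)) / (1 + \<eta> - \<beta>)
      \<le> exp (4 * \<eta>' * ln (A * T\<^sup>2 / \<eta>) / t\<^sub>0) *
           (norm (lfun (Complex (1 + \<eta>') t) - lfun (Complex \<beta> t)) / (1 + \<eta>' - \<beta>))"
    using main nf[of "1 + \<eta>"] nf[of "1 + \<eta>'"] \<beta> \<eta> by (simp add: \<rho>_def)
qed

end

interpretation zeta: bounded_character "\<lambda>_. 1" 1 0
  by unfold_locales (auto simp: char_sum_def)

text \<open>Supplies the constant c of the zero-free region: once the logarithms of T have
  cancelled, the exponent of the reflection inequality has the shape c (K + ln (1/c)).\<close>

lemma small_times_ln:
  fixes K \<epsilon> :: real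
  assumes "\<epsilon> > 0"
  obtains c where "0 < c" "c \<le> \<epsilon>" "c \<le> 1" "c * (K + ln (1 / c)) \<le> \<epsilon>"
proof -
  have "((\<lambda>c. c * (K + ln (1 / c))) \<longlongrightarrow> 0) (at_right 0)" by real_asymp
  then have "\<forall>\<^sub>F c in at_right 0. c * (K + ln (1 / c)) < \<epsilon>"
    using assms by (rule order_tendstoD)
  moreover have "\<forall>\<^sub>F c in at_right 0. 0 < c \<and> c < min \<epsilon> 1"
    using eventually_at_right_real[of 0 "min \<epsilon> 1"] assms by (simp add: greaterThanLessThan_def)
  ultimately have "\<forall>\<^sub>F c in at_right (0::real). 0 < c \<and> c \<le> \<epsilon> \<and> c \<le> 1 \<and> c * (K + ln (1 / c)) \<le> \<epsilon>"
    by eventually_elim auto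
  then show ?thesis using that eventually_happens' trivial_limit_at_right_real by blast
qed

lemma one_le_ln: "3 \<le> T \<Longrightarrow> 1 \<le> ln (T :: real)"
  using exp_le by (subst ln_ge_iff) auto

text \<open>With \<eta> = c / ln T the logarithm in the exponent is at most (ln A + 3 + ln (1/c)) ln
  T, and ln T cancels. The 3 is 2 from T^2 plus 1 from ln (ln T) \<le> ln T. Reflection over a
  distance of N \<eta> thus costs only a factor e, however large N was fixed before c.\<close>

lemma exp_reflection_exponent_le:
  fixes L \<eta> N A t\<^sub>0 c T :: real
  assumes c: "0 < c" "c * (ln A + 3 + ln (1 / c)) \<le> t\<^sub>0 / (4 * N)" and "N \<ge> 1" "0 < t\<^sub>0" "A \<ge> 1" "c \<le> 1"
    and T: "T \<ge> 3" and B: "0 < B" "B \<le> A"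
  shows "exp (4 * (N * (c / ln T)) * ln (B * T\<^sup>2 / (c / ln T)) / t\<^sub>0) \<le> exp 1"
proof -
  define L where "L = ln T"
  have L: "L \<ge> 1" unfolding L_def by (rule one_le_ln[OF T])
  have "ln (B * T\<^sup>2 / (c / L)) = ln B + 2 * L + ln (1 / c) + ln L"
    using B T L c by (simp add: ln_mult ln_div ln_realpow L_def)
  also have "ln B \<le> ln A * L"
  proof -
    have "ln B \<le> ln A * 1" using B assms by simp
    also have "\<dots> \<le> ln A * L" using L assms by (intro mult_left_mono) auto
    finally show ?thesis .
  qed
  also have "ln (1 / c) \<le> ln (1 / c) * L"
    using L c assms(6) mult_left_mono[of 1 L "ln (1 / c)"] by simp
  also have "ln L \<le> 1 * L" using ln_le_minus_one[of L] L by simp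
  finally have "ln (B * T\<^sup>2 / (c / L)) \<le> (ln A + 3 + ln (1 / c)) * L" by (simp add: algebra_simps)
  then have "(c / L) * ln (B * T\<^sup>2 / (c / L)) \<le> (c / L) * ((ln A + 3 + ln (1 / c)) * L)"
    using c L by (intro mult_left_mono) auto
  also have "\<dots> = c * (ln A + 3 + ln (1 / c))" using L by simp
  also have "\<dots> \<le> t\<^sub>0 / (4 * N)" by (rule c)
  finally have "(4 * N / t\<^sub>0) * ((c / L) * ln (B * T\<^sup>2 / (c / L))) \<le> (4 * N / t\<^sub>0) * (t\<^sub>0 / (4 * N))"
    using assms by (intro mult_left_mono) auto
  then have "4 * (N * (c / L)) * ln (B * T\<^sup>2 / (c / L)) / t\<^sub>0 \<le> 1"
    using assms by (simp add: mult_ac)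
  then show ?thesis by (simp add: L_def)
qed

context bounded_character begin

text \<open>
  Suppose \<open>D(\<rho>)\<close> were small at \<open>\<rho> = \<beta> + it\<close>. Applied to \<open>(D(s) - D(\<rho>)) / (s - \<rho>)\<close>, the reflection
  inequality makes \<open>\<bar>D(1 + \<eta> + it)\<bar>\<close> smaller than \<open>\<bar>D(1 + N\<eta> + it)\<bar>\<close> by a factor of order \<open>1 / N\<close>;
  its fourth power beats the factor \<open>N\<^sup>3\<close> that the pole of \<open>\<zeta>\<close> contributes to the 3-4-1 product.
\<close>

lemma lfun_lower_bound:
  assumes t\<^sub>0: "0 < t\<^sub>0" "t\<^sub>0 \<le> 1"
  obtains c where "0 < c"
    "\<And>T s. T \<ge> 3 \<Longrightarrow> t\<^sub>0 \<le> \<bar>Im s\<bar> \<Longrightarrow> \<bar>Im s\<bar> \<le> T \<Longrightarrow> 1 - c / ln T \<le> Re s \<Longrightarrow> Re s \<le> 2 \<Longrightarrow>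
        c / ln T \<le> norm (lfun s)"
proof -
  \<comment> \<open>The argument ends in (N - 1)^4 \<le> 8 * 6^4 * 3^5 * N^3, where the constant is
    about 2.5 million; this N violates it.\<close>
  define N :: real where "N = 10 ^ 7"
  \<comment> \<open>Covers the constant of \<open>lfun_ratio\<close> for \<open>\<psi>\<close> at
    height T and that for zeta, where C = 0, at height 2 T; the 4 comes from (2 T)^2.\<close>
  define A where "A = 8192 * (5 * C + 6) / t\<^sub>0\<^sup>2 + 4 * (8192 * (5 * 0 + 6) / t\<^sub>0\<^sup>2)"
  have A0: "0 < 8192 * (5 * C + 6) / t\<^sub>0\<^sup>2" "0 < 4 * (8192 * (5 * 0 + 6) / t\<^sub>0\<^sup>2)"
    using C t\<^sub>0 by auto
  have A1: "A \<ge> 1"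
  proof -
    have "t\<^sub>0\<^sup>2 \<le> 1" using t\<^sub>0 by (simp add: power_le_one)
    then have "1 \<le> 4 * (8192 * (5 * 0 + 6) / t\<^sub>0\<^sup>2)" using t\<^sub>0 by simp
    then show ?thesis unfolding A_def using A0 by linarith
  qed
  obtain c where c: "0 < c" "c \<le> t\<^sub>0 / (16 * N)" "c \<le> 1" "c * (ln A + 3 + ln (1 / c)) \<le> t\<^sub>0 / (16 * N)"
    using small_times_ln[of "t\<^sub>0 / (16 * N)" "ln A + 3"] t\<^sub>0 by (auto simp: N_def)
  have c': "c * (ln A + 3 + ln (1 / c)) \<le> t\<^sub>0 / (4 * N)"
    using c(4) t\<^sub>0 by (auto simp: N_def)
  have "c / 4 / ln T \<le> norm (lfun s)"
    if T: "T \<ge> 3" and s: "t\<^sub>0 \<le> \<bar>Im s\<bar>" "\<bar>Im s\<bar> \<le> T" "1 - c / 4 / ln T \<le> Re s" "Re s \<le> 2" for T s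
  proof -
    define L where "L = ln T"
    have L: "L \<ge> 1" unfolding L_def by (rule one_le_ln[OF T])
    define \<eta> where "\<eta> = c / L"
    define \<eta>' where "\<eta>' = N * \<eta>"
    define t where "t = Im s"
    define \<beta> where "\<beta> = Re s"
    have s_eq: "s = Complex \<beta> t" by (simp add: t_def \<beta>_def)
    have \<eta>0: "0 < \<eta>" using c L by (simp add: \<eta>_def)
    have "\<eta> \<le> c" using c L by (simp add: \<eta>_def divide_le_eq mult_left_le)
    then have \<eta>'le: "\<eta>' \<le> t\<^sub>0 / 16" using c(2) by (simp add: \<eta>'_def N_def)
    have \<eta>: "0 < \<eta>" "\<eta> < \<eta>'" "\<eta>' \<le> t\<^sub>0 / 16" using \<eta>0 \<eta>'le by (auto simp: \<eta>'_def N_def)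
    have "\<eta> / 4 \<le> norm (lfun s)"
    proof (cases "\<beta> \<ge> 1 + \<eta>")
      case True
      then have "\<eta> / 2 \<le> norm (lfun s)"
        using s \<eta> t\<^sub>0 by (intro norm_lfun_ge) (auto simp: \<beta>_def)
      then show ?thesis using \<eta>0 by linarith
    next
      case False
      show ?thesis
      proof (rule ccontr)
        assume "\<not> \<eta> / 4 \<le> norm (lfun s)"
        then have small: "norm (lfun (Complex \<beta> t)) \<le> \<eta> / 4" by (simp add: s_eq)
        have \<beta>: "1 - \<eta> \<le> \<beta>" "\<beta> < 1 + \<eta>" using False s c L
            by (auto simp: \<beta>_def \<eta>_def L_def[symmetric] divide_simps)
        have t: "t\<^sub>0 \<le> \<bar>t\<bar>" "\<bar>t\<bar> \<le> T" "t\<^sub>0 \<le> \<bar>2 * t\<bar>" "\<bar>2 * t\<bar> \<le> 2 * T" "2 * T \<ge> 3" using s T t\<^sub>0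
            by (auto simp: t_def)
        define D0 where "D0 = norm (lfun (Complex (1 + \<eta>) t))"
        define D1 where "D1 = norm (lfun (Complex (1 + \<eta>') t))"
        define Z0 where "Z0 = norm (zeta.lfun (Complex (1 + \<eta>) (2 * t)))"
        define Z1 where "Z1 = norm (zeta.lfun (Complex (1 + \<eta>') (2 * t)))"
        have N1: "N \<ge> 1" by (simp add: N_def)
        have e1: "exp (4 * \<eta>' * ln (8192 * (5 * C + 6) / t\<^sub>0\<^sup>2 * T\<^sup>2 / \<eta>) / t\<^sub>0) \<le> exp 1"
          unfolding \<eta>'_def \<eta>_def L_def
          by (rule exp_reflection_exponent_le[OF c(1) c' N1 t\<^sub>0(1) A1 c(3) T A0(1)])
              (use A0 in \<open>auto simp: A_def\<close>)
        have e2: "exp (4 * \<eta>' * ln (8192 * (5 * 0 + 6) / t\<^sub>0\<^sup>2 * (2 * T)\<^sup>2 / \<eta>) / t\<^sub>0) \<le> exp 1"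
        proof -
          have "8192 * (5 * 0 + 6) / t\<^sub>0\<^sup>2 * (2 * T)\<^sup>2 = 4 * (8192 * (5 * 0 + 6) / t\<^sub>0\<^sup>2) * T\<^sup>2"
            by (simp add: power_mult_distrib)
          moreover have "exp (4 * \<eta>' * ln (4 * (8192 * (5 * 0 + 6) / t\<^sub>0\<^sup>2) * T\<^sup>2 / \<eta>) / t\<^sub>0) \<le> exp 1"
            unfolding \<eta>'_def \<eta>_def L_def
            by (rule exp_reflection_exponent_le[OF c(1) c' N1 t\<^sub>0(1) A1 c(3) T A0(2)])
                (use A0 in \<open>auto simp: A_def\<close>)
          ultimately show ?thesis by (simp only:)
        qed
        have D1_ge: "D1 \<ge> \<eta>' / 2" unfolding D1_def using \<eta> t\<^sub>0 by (intro norm_lfun_ge) auto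
        have D0_ge: "D0 \<ge> \<eta> / 2" unfolding D0_def using \<eta> t\<^sub>0 by (intro norm_lfun_ge) auto
        have Z1_ge: "Z1 \<ge> \<eta>' / 2" unfolding Z1_def using \<eta> t\<^sub>0 by (intro zeta.norm_lfun_ge) auto
        have Z: "Z0 \<le> exp 1 * Z1"
        proof -
          have "Z0 \<le> exp (4 * \<eta>' * ln (8192 * (5 * 0 + 6) / t\<^sub>0\<^sup>2 * (2 * T)\<^sup>2 / \<eta>) / t\<^sub>0) * Z1"
            unfolding Z0_def Z1_def by (rule zeta.lfun_ratio(1)[OF t\<^sub>0 t(3,4,5) \<eta>])
          also have "\<dots> \<le> exp 1 * Z1" by (intro mult_right_mono e2) (simp add: Z1_def)
          finally show ?thesis .
        qed
        \<comment> \<open>The two difference quotients have denominators at most 2 \<eta> and at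
          least (N - 1) \<eta>; passing to \<open>D0\<close> and \<open>D1\<close> in the numerators
          costs factors 1/2 and 3/2. Together with the factor e of the reflection this makes 6
          e.\<close>
        have D: "D0 * (N - 1) \<le> 6 * exp 1 * D1"
        proof -
          let ?w = "lfun (Complex \<beta> t)"
          have "D0 / 2 \<le> norm (lfun (Complex (1 + \<eta>) t) - ?w)"
            using D0_ge small norm_triangle_ineq2[of "lfun (Complex (1 + \<eta>) t)" ?w] unfolding D0_def
                by linarith
          then have "(D0 / 2) / (2 * \<eta>) \<le> norm (lfun (Complex (1 + \<eta>) t) - ?w) / (1 + \<eta> - \<beta>)"
            using \<beta> \<eta> by (intro frac_le) auto
          also have "\<dots> \<le> exp (4 * \<eta>' * ln (8192 * (5 * C + 6) / t\<^sub>0\<^sup>2 * T\<^sup>2 / \<eta>) / t\<^sub>0) *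
              (norm (lfun (Complex (1 + \<eta>') t) - ?w) / (1 + \<eta>' - \<beta>))"
            by (rule lfun_ratio(2)[OF t\<^sub>0 t(1,2) T \<eta> \<beta> small])
          also have "\<dots> \<le> exp 1 * (norm (lfun (Complex (1 + \<eta>') t) - ?w) / (1 + \<eta>' - \<beta>))"
            using \<beta> \<eta> by (intro mult_right_mono e1) auto
          also have "norm (lfun (Complex (1 + \<eta>') t) - ?w) / (1 + \<eta>' - \<beta>) \<le> (3 / 2 * D1) / ((N - 1) * \<eta>)"
          proof (rule frac_le)
            show "norm (lfun (Complex (1 + \<eta>') t) - ?w) \<le> 3 / 2 * D1"
              using norm_triangle_ineq4[of "lfun (Complex (1 + \<eta>') t)" ?w] small D1_ge \<eta>
                  unfolding D1_def by linarith
            show "(N - 1) * \<eta> \<le> 1 + \<eta>' - \<beta>" using \<beta> by (simp add: \<eta>'_def algebra_simps)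
          qed (use \<eta> in \<open>auto simp: D1_def N_def\<close>)
          finally have "(D0 / 2) / (2 * \<eta>) \<le> exp 1 * ((3 / 2 * D1) / ((N - 1) * \<eta>))" by simp
          then show ?thesis using \<eta> by (simp add: N_def field_simps)
        qed
        have Z_dirichlet_series: "Z0 = norm (dirichlet_series (\<lambda>_. 1) (Complex (1 + \<eta>) (2 * t)))"
            "Z1 = norm (dirichlet_series (\<lambda>_. 1) (Complex (1 + \<eta>') (2 * t)))"
          unfolding Z0_def Z1_def using \<eta> by (subst zeta.lfun_eq_dirichlet_series; simp)+
        \<comment> \<open>The pole factors of the two sides differ by a constant times N^3, and the
          zeta factors at 2 t cancel up to a factor e by \<open>Z\<close>.\<close>
        have P: "norm (dirichlet_series (\<lambda>_. 1) (of_real (1 + \<eta>')))^3 * D1^4 * Z1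
            \<le> norm (dirichlet_series (\<lambda>_. 1) (of_real (1 + \<eta>)))^3 * D0^4 * Z0"
          using three_four_one_mono[of "1 + \<eta>" "1 + \<eta>'" t] \<eta>
          by (simp add: D0_def D1_def Z_dirichlet_series lfun_eq_dirichlet_series)
        have "norm (dirichlet_series (\<lambda>_. 1) (of_real (1 + \<eta>))) \<le> 2 / \<eta>"
        proof -
          have "norm (dirichlet_series (\<lambda>_. 1) (of_real (1 + \<eta>))) \<le> (1 + \<eta>) / \<eta>"
            using norm_dirichlet_series_le[of "of_real (1 + \<eta>)" "\<lambda>_. 1"] \<eta> by simp
          also have "\<dots> \<le> 2 / \<eta>" using \<eta> t\<^sub>0 by (intro divide_right_mono) auto
          finally show ?thesis .
        qed
        then have "norm (dirichlet_series (\<lambda>_. 1) (of_real (1 + \<eta>)))^3 * D0^4 * Z0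
            \<le> (2 / \<eta>)^3 * D0^4 * (exp 1 * Z1)"
          using Z by (intro mult_mono power_mono) (auto simp: D0_def Z0_def \<eta>0 less_imp_le)
        moreover have "(1 / \<eta>')^3 * D1^4 * Z1
            \<le> norm (dirichlet_series (\<lambda>_. 1) (of_real (1 + \<eta>')))^3 * D1^4 * Z1"
          using norm_dirichlet_series_1_ge[of "1 + \<eta>'"] \<eta>
              by (intro mult_right_mono power_mono) (auto simp: Z1_def)
        ultimately have "(1 / \<eta>')^3 * D1^4 * Z1 \<le> (2 / \<eta>)^3 * D0^4 * (exp 1 * Z1)" using P by linarith
        then have "(1 / \<eta>')^3 * D1^4 \<le> (2 / \<eta>)^3 * D0^4 * exp 1"
          using Z1_ge \<eta> by (simp add: mult.assoc[symmetric])
        then have "(1 / \<eta>')^3 * D1^4 * (\<eta>' ^ 3 * (N - 1)^4) \<le> (2 / \<eta>)^3 * D0^4 * exp 1 * (\<eta>' ^ 3 * (N - 1)^4)"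
          using \<eta> by (intro mult_right_mono) auto
        also have "\<dots> = 8 * N^3 * exp 1 * (D0 * (N - 1))^4"
          using \<eta>0 by (simp add: \<eta>'_def power_mult_distrib power_divide)
        also have "\<dots> \<le> 8 * N^3 * exp 1 * (6 * exp 1 * D1)^4"
          using D by (intro mult_left_mono power_mono) (auto simp: N_def D0_def)
        also have "(1 / \<eta>')^3 * D1^4 * (\<eta>' ^ 3 * (N - 1)^4) = D1^4 * (N - 1)^4"
          using \<eta> by (simp add: power_divide)
        also have "8 * N^3 * exp 1 * (6 * exp 1 * D1)^4 = D1^4 * (8 * N^3 * 6^4 * exp 1 ^ 5)"
          by (simp add: power_mult_distrib eval_nat_numeral)
        finally have "(N - 1)^4 \<le> 8 * N^3 * 6^4 * exp 1 ^ 5"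
          using D1_ge \<eta> by simp
        also have "\<dots> \<le> 8 * N^3 * 6^4 * 3 ^ 5"
          using exp_le by (intro mult_left_mono power_mono) (auto simp: N_def)
        finally show False by (simp add: N_def)
      qed
    qed
    then show ?thesis by (simp add: \<eta>_def L_def)
  qed
  then show ?thesis using that[of "c / 4"] c by auto
qed

text \<open>Three regions. Away from the real axis \<open>lfun_lower_bound\<close> applies; near 1
  it gives nothing, and continuity together with the nonzero value at 1 takes over; what remains
  lies at a fixed distance to the right of 1.\<close>

lemma inverse_cont_bound:
  assumes nz: "dirichlet_cont \<psi> \<kappa> 1 \<noteq> 0"
  obtains c K where "0 < c" "c \<le> 1 / 2" "0 < K"
    "\<And>T s. T \<ge> 3 \<Longrightarrow> \<bar>Im s\<bar> \<le> T \<Longrightarrow> 1 - c / ln T \<le> Re s \<Longrightarrow> Re s \<le> 2 \<Longrightarrow>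
        dirichlet_cont \<psi> \<kappa> s \<noteq> 0 \<and> norm ((s - 1) ^ \<kappa> / dirichlet_cont \<psi> \<kappa> s) \<le> K * ln T"
proof -
  define m where "m = norm (dirichlet_cont \<psi> \<kappa> 1) / 2"
  have m: "m > 0" using nz by (simp add: m_def)
  have "continuous_on {s. Re s > 1 / 2} (dirichlet_cont \<psi> \<kappa>)"
    by (rule holomorphic_on_imp_continuous_on[OF holomorphic_cont])
  then have "isCont (dirichlet_cont \<psi> \<kappa>) 1"
    by (subst (asm) continuous_on_eq_continuous_at[OF open_halfspace_Re_gt]) auto
  then obtain \<epsilon> where \<epsilon>: "\<epsilon> > 0" "\<And>s. dist s 1 < \<epsilon> \<Longrightarrow> dist (dirichlet_cont \<psi> \<kappa> s) (dirichlet_cont \<psi> \<kappa> 1) < m"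
    using m unfolding continuous_at_eps_delta by blast
  \<comment> \<open>The points treated by continuity lie within \<open>2 * t\<^sub>0\<close> of
    1.\<close>
  define t\<^sub>0 where "t\<^sub>0 = min 1 (\<epsilon> / 2)"
  have t\<^sub>0: "0 < t\<^sub>0" "t\<^sub>0 \<le> 1" "t\<^sub>0 \<le> \<epsilon> / 2" using \<epsilon> by (auto simp: t\<^sub>0_def)
  obtain c where c: "0 < c" and lower:
      "\<And>T s. T \<ge> 3 \<Longrightarrow> t\<^sub>0 \<le> \<bar>Im s\<bar> \<Longrightarrow> \<bar>Im s\<bar> \<le> T \<Longrightarrow> 1 - c / ln T \<le> Re s \<Longrightarrow> Re s \<le> 2 \<Longrightarrow>
        c / ln T \<le> norm (lfun s)"
    using lfun_lower_bound[OF t\<^sub>0(1,2)] by blast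
  define c' where "c' = min c (t\<^sub>0 / 2)"
  define K where "K = 1 / c + 4 / m + 4 / t\<^sub>0"
  have K: "1 / c \<le> K" "4 / m \<le> K" "4 / t\<^sub>0 \<le> K" "0 < K" using c m t\<^sub>0
      by (auto simp: K_def add_nonneg_nonneg add_pos_pos)
  have "dirichlet_cont \<psi> \<kappa> s \<noteq> 0 \<and> norm ((s - 1) ^ \<kappa> / dirichlet_cont \<psi> \<kappa> s) \<le> K * ln T"
    if T: "T \<ge> 3" and s: "\<bar>Im s\<bar> \<le> T" "1 - c' / ln T \<le> Re s" "Re s \<le> 2" for T s
  proof -
    have L: "ln T \<ge> 1" by (rule one_le_ln[OF T])
    have KL: "K \<le> K * ln T" using L K by simp
    have inv: "(s - 1) ^ \<kappa> / dirichlet_cont \<psi> \<kappa> s = inverse (lfun s)" by (simp add: lfun_def)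
    have from_lfun: ?thesis if "0 < d" "d \<le> norm (lfun s)" "1 / d \<le> K * ln T" for d
    proof -
      have "dirichlet_cont \<psi> \<kappa> s \<noteq> 0" using that by (auto simp: lfun_def)
      moreover have "norm (inverse (lfun s)) \<le> 1 / d"
        unfolding norm_inverse using le_imp_inverse_le[OF that(2,1)] by (simp add: inverse_eq_divide)
      ultimately show ?thesis using that inv by simp
    qed
    show ?thesis
    proof (cases "t\<^sub>0 \<le> \<bar>Im s\<bar>")
      case True
      have "c' / ln T \<le> c / ln T" using L by (intro divide_right_mono) (auto simp: c'_def)
      then have low: "c / ln T \<le> norm (lfun s)" using lower[OF T True s(1)] s by simp
      have *: "1 / (c / ln T) \<le> K * ln T" using K(1) L mult_right_mono[of "1 / c" K "ln T"] by simp
      show ?thesis by (rule from_lfun[OF _ low *]) (use c L in auto)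
    next
      case False
      show ?thesis
      proof (cases "Re s \<le> 1 + t\<^sub>0 / 2")
        case True
        have "c' / ln T \<le> t\<^sub>0 / 2 / 1" using L t\<^sub>0 c by (intro frac_le) (auto simp: c'_def)
        then have "c' / ln T \<le> t\<^sub>0 / 2" by simp
        then have "\<bar>Re s - 1\<bar> \<le> t\<^sub>0 / 2" using True s(2) by linarith
        then have n: "norm (s - 1) < 2 * t\<^sub>0" using False cmod_le[of "s - 1"] t\<^sub>0 by simp
        then have "dist (dirichlet_cont \<psi> \<kappa> s) (dirichlet_cont \<psi> \<kappa> 1) < m" using \<epsilon> t\<^sub>0
            by (simp add: dist_norm)
        then have cm: "norm (dirichlet_cont \<psi> \<kappa> s) \<ge> m"
          using norm_triangle_ineq3[of "dirichlet_cont \<psi> \<kappa> s" "dirichlet_cont \<psi> \<kappa> 1"]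
              by (simp add: dist_norm m_def)
        have "norm s \<le> norm (s - 1) + norm (1::complex)" using norm_triangle_ineq[of "s - 1" 1] by simp
        then have "norm ((s - 1) ^ \<kappa>) \<le> 4" using norm_pow_\<kappa>_le[of s] n t\<^sub>0 by simp
        then have "norm ((s - 1) ^ \<kappa> / dirichlet_cont \<psi> \<kappa> s) \<le> 4 / m"
          unfolding norm_divide using cm m by (intro frac_le) auto
        then have "norm ((s - 1) ^ \<kappa> / dirichlet_cont \<psi> \<kappa> s) \<le> K * ln T" using K(2) KL by linarith
        moreover have "dirichlet_cont \<psi> \<kappa> s \<noteq> 0" using cm m by auto
        ultimately show ?thesis by simp
      next
        case False
        then have "t\<^sub>0 / 2 / 2 \<le> norm (lfun s)" using s t\<^sub>0 by (intro norm_lfun_ge) auto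
        moreover have "1 / (t\<^sub>0 / 4) \<le> K * ln T" using K(3) KL by simp
        ultimately show ?thesis using from_lfun[of "t\<^sub>0 / 4"] t\<^sub>0 by simp
      qed
    qed
  qed
  moreover have "c' > 0" "c' \<le> 1 / 2" using c t\<^sub>0 by (auto simp: c'_def)
  ultimately show ?thesis using that[of c' K] K by blast
qed

end

section \<open>Gaussian smoothing\<close>

lemma has_bochner_integral_exp_tail:
  fixes a c :: real
  assumes "a > 0"
  shows "has_bochner_integral lborel (\<lambda>v. indicator {c..} v * exp (- (a * v))) (exp (- (a * c)) / a)"
proof -
  have "has_bochner_integral lborel (\<lambda>x. exp (- x) * indicator {0..} x) (1::real)"
    using has_bochner_integral_I0i_power_exp_m'[of 0] by simp
  then have "has_bochner_integral lborel
      (\<lambda>v. exp (- (- a * c + a * v)) * indicator {0..} (- a * c + a * v)) (1 /\<^sub>R \<bar>a\<bar>)"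
    using assms by (subst (asm) lborel_has_bochner_integral_real_affine_iff[of a _ _ "- a * c"]) auto
  then have "has_bochner_integral lborel
      (\<lambda>v. exp (- (a * c)) * (exp (- (- a * c + a * v)) * indicator {0..} (- a * c + a * v)))
      (exp (- (a * c)) * (1 /\<^sub>R \<bar>a\<bar>))"
    by (rule has_bochner_integral_mult_right)
  moreover have "exp (- (a * c)) * (exp (- (- a * c + a * v)) * indicator {0..} (- a * c + a * v))
      = indicator {c..} v * exp (- (a * v))" for v
  proof -
    have "(- a * c + a * v \<ge> 0) \<longleftrightarrow> v \<ge> c" using assms by simp
    then have "indicator {0..} (- a * c + a * v) = (indicator {c..} v :: real)" by (simp add: indicator_def)
    then show ?thesis by (simp add: exp_add[symmetric] mult.assoc[symmetric])
  qed
  ultimately show ?thesis using assms by (simp add: field_simps)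
qed

text \<open>Laplace transform of a unit step at c; for c = ln n it produces n^(-s) / s.\<close>

lemma has_bochner_integral_cexp_tail:
  fixes s :: complex and c :: real
  assumes "Re s > 0"
  shows "has_bochner_integral lborel (\<lambda>v. indicator {c..} v *\<^sub>R exp (- s * of_real v))
      (exp (- s * of_real c) / s)"
proof -
  let ?f = "\<lambda>v::real. exp (- s * of_real v)"
  have s0: "s \<noteq> 0" using assms by auto
  have int: "integrable lborel (\<lambda>v. indicator {c..} v *\<^sub>R ?f v)"
  proof (rule Bochner_Integration.integrable_bound)
    show "integrable lborel (\<lambda>v. indicator {c..} v * exp (- (Re s * v)))"
      using has_bochner_integral_exp_tail[OF assms, of c] by (simp add: has_bochner_integral_iff)
    show "(\<lambda>v. indicator {c..} v *\<^sub>R ?f v) \<in> borel_measurable lborel" by measurable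
  qed (auto simp: indicator_def)
  have ei: "einterval (ereal c) \<infinity> = {c<..}" by (auto simp: einterval_def)
  have int': "set_integrable lborel {c<..} ?f"
    by (rule set_integrable_subset[of lborel "{c..}"]) (use int in \<open>auto simp: set_integrable_def\<close>)
  have "(LBINT v=ereal c..\<infinity>. ?f v) = 0 - (- exp (- s * of_real c) / s)"
  proof (rule interval_integral_FTC_integrable[where F = "\<lambda>v. - exp (- s * of_real v) / s"])
    show "((\<lambda>v. - exp (- s * of_real v) / s) has_vector_derivative ?f x) (at x)" for x
    proof -
      have "((\<lambda>v. - exp (- s * v) / s) has_field_derivative exp (- s * of_real x)) (at (of_real x))"
        using s0 by (auto intro!: derivative_eq_intros)
      then show ?thesis using has_vector_derivative_real_field by blast
    qed
    show "set_integrable lborel (einterval (ereal c) \<infinity>) ?f" using int' by (simp add: ei)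
    show "(((\<lambda>v. - exp (- s * of_real v) / s) \<circ> real_of_ereal) \<longlongrightarrow> - exp (- s * of_real c) / s)
        (at_right (ereal c))"
      unfolding ereal_tendsto_simps using s0 by (auto intro!: tendsto_eq_intros)
    show "(((\<lambda>v. - exp (- s * of_real v) / s) \<circ> real_of_ereal) \<longlongrightarrow> 0) (at_left \<infinity>)"
      unfolding ereal_tendsto_simps
    proof (rule Lim_null_comparison)
      show "\<forall>\<^sub>F x in at_top. norm (- exp (- s * of_real x) / s) \<le> exp (- (Re s * x)) / norm s"
        by (simp add: norm_divide)
      have "((\<lambda>x. exp (- (Re s * x)) / norm s) \<longlongrightarrow> 0 / norm s) at_top"
        using assms s0
        by (intro tendsto_intros filterlim_compose[OF exp_at_bot] filterlim_uminus_at_top[THEN iffD1]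
            filterlim_tendsto_pos_mult_at_top[OF tendsto_const] filterlim_ident) auto
      then show "((\<lambda>x. exp (- (Re s * x)) / norm s) \<longlongrightarrow> 0) at_top" by simp
    qed
  qed (auto intro!: continuous_intros)
  then have "(\<integral>v. indicator {c<..} v *\<^sub>R ?f v \<partial>lborel) = exp (- s * of_real c) / s"
    by (simp add: interval_lebesgue_integral_def ei set_lebesgue_integral_def)
  also have "(\<integral>v. indicator {c<..} v *\<^sub>R ?f v \<partial>lborel) = (\<integral>v. indicator {c..} v *\<^sub>R ?f v \<partial>lborel)"
  proof (rule integral_cong_AE)
    have "AE v in lborel. v \<noteq> c" by (rule AE_lborel_singleton)
    then show "AE v in lborel. indicator {c<..} v *\<^sub>R ?f v = indicator {c..} v *\<^sub>R ?f v"
      by eventually_elim (auto simp: indicator_def)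
  qed measurable
  finally show ?thesis using int by (simp add: has_bochner_integral_iff)
qed

text \<open>The characteristic function of the standard normal distribution after the substitution x
  = \<sigma> t.\<close>

lemma gaussian_fourier:
  fixes \<sigma> w :: real
  assumes "\<sigma> > 0"
  shows "has_bochner_integral lborel (\<lambda>t. exp (\<i> * of_real (t * w)) * of_real (exp (- (\<sigma>\<^sup>2 * t\<^sup>2 / 2))))
           (complex_of_real (2 * pi * normal_density 0 \<sigma> w))"
proof -
  have eq: "(\<integral>x. std_normal_density x *\<^sub>R cis ((w / \<sigma>) * x) \<partial>lborel) = of_real (exp (- (w / \<sigma>)\<^sup>2 / 2))"
    using fun_cong[OF char_std_normal_distribution, of "w / \<sigma>"] unfolding char_def
    by (subst (asm) integral_density) (auto simp: cis_conv_exp mult.commute)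
  have "integrable lborel (\<lambda>x. std_normal_density x *\<^sub>R cis ((w / \<sigma>) * x))"
    by (rule Bochner_Integration.integrable_bound[OF integrable_normal_density[of 1 0]])
        (auto simp: cis_conv_exp)
  with eq have "has_bochner_integral lborel (\<lambda>x. std_normal_density x *\<^sub>R cis ((w / \<sigma>) * x))
      (of_real (exp (- (w / \<sigma>)\<^sup>2 / 2)))"
    by (simp add: has_bochner_integral_iff)
  then have "has_bochner_integral lborel (\<lambda>t. std_normal_density (0 + \<sigma> * t) *\<^sub>R cis ((w / \<sigma>) * (0 + \<sigma> * t)))
      (of_real (exp (- (w / \<sigma>)\<^sup>2 / 2)) /\<^sub>R \<bar>\<sigma>\<bar>)"
    using assms by (subst (asm) lborel_has_bochner_integral_real_affine_iff[of \<sigma> _ _ 0]) auto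
  then have "has_bochner_integral lborel
      (\<lambda>t. of_real (sqrt (2 * pi)) * (std_normal_density (0 + \<sigma> * t) *\<^sub>R cis ((w / \<sigma>) * (0 + \<sigma> * t))))
      (of_real (sqrt (2 * pi)) * (of_real (exp (- (w / \<sigma>)\<^sup>2 / 2)) /\<^sub>R \<bar>\<sigma>\<bar>) :: complex)"
    by (rule has_bochner_integral_mult_right)
  moreover have "of_real (sqrt (2 * pi)) * (std_normal_density (0 + \<sigma> * t) *\<^sub>R cis ((w / \<sigma>) * (0 + \<sigma> * t)))
      = exp (\<i> * of_real (t * w)) * of_real (exp (- (\<sigma>\<^sup>2 * t\<^sup>2 / 2)))" for t
  proof -
    have "sqrt (2 * pi) * std_normal_density (\<sigma> * t) = exp (- (\<sigma>\<^sup>2 * t\<^sup>2 / 2))"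
      by (simp add: std_normal_density_def power_mult_distrib)
    moreover have "cis ((w / \<sigma>) * (\<sigma> * t)) = exp (\<i> * of_real (t * w))"
      using assms by (simp add: cis_conv_exp mult.commute)
    ultimately show ?thesis
      by (simp only: add_0 scaleR_conv_of_real mult.assoc[symmetric] of_real_mult[symmetric] mult.commute)
  qed
  moreover have "of_real (sqrt (2 * pi)) * (of_real (exp (- (w / \<sigma>)\<^sup>2 / 2)) /\<^sub>R \<bar>\<sigma>\<bar>)
      = complex_of_real (2 * pi * normal_density 0 \<sigma> w)"
  proof -
    have "sqrt (2 * pi) * (exp (- (w / \<sigma>)\<^sup>2 / 2) / \<sigma>) = 2 * pi * normal_density 0 \<sigma> w"
      using assms by (simp add: normal_density_def real_sqrt_mult power_divide field_simps
          real_sqrt_mult_self)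
    then have "complex_of_real (sqrt (2 * pi) * (exp (- (w / \<sigma>)\<^sup>2 / 2) / \<sigma>))
        = of_real (2 * pi * normal_density 0 \<sigma> w)"
      by (rule arg_cong)
    moreover have "of_real u /\<^sub>R \<bar>\<sigma>\<bar> = complex_of_real (u / \<sigma>)" for u
      using assms by (simp add: scaleR_conv_of_real divide_inverse mult.commute)
    ultimately show ?thesis by (simp only: of_real_mult)
  qed
  ultimately show ?thesis by simp
qed

lemma exp_mult_normal_density:
  "exp a * normal_density m \<sigma> v = 1 / sqrt (2 * pi * \<sigma>\<^sup>2) * exp (a - (v - m)\<^sup>2 / (2 * \<sigma>\<^sup>2))"
proof -
  have "exp (a - (v - m)\<^sup>2 / (2 * \<sigma>\<^sup>2)) = exp a * exp (- (v - m)\<^sup>2 / (2 * \<sigma>\<^sup>2))"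
    by (simp flip: exp_add)
  then show ?thesis by (simp only: normal_density_def mult.left_commute)
qed

text \<open>The Gaussian density as an inverse Laplace transform along any vertical line. That the
  value does not depend on \<open>b\<close> follows by completing the square, so no contour is moved
  here.\<close>

lemma gaussian_vertical_line:
  fixes \<sigma> w b :: real
  assumes "\<sigma> > 0"
  defines "k \<equiv> \<lambda>t. exp (Complex b t * of_real w + of_real (\<sigma>\<^sup>2 / 2) * (Complex b t)\<^sup>2)"
  shows "has_bochner_integral lborel k (complex_of_real (2 * pi * normal_density 0 \<sigma> w))"
proof -
  let ?c = "exp (b * w + \<sigma>\<^sup>2 * b\<^sup>2 / 2)"
  have "has_bochner_integral lborel (\<lambda>t. of_real ?c
      * (exp (\<i> * of_real (t * (w + \<sigma>\<^sup>2 * b))) * of_real (exp (- (\<sigma>\<^sup>2 * t\<^sup>2 / 2)))))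
           (of_real ?c * complex_of_real (2 * pi * normal_density 0 \<sigma> (w + \<sigma>\<^sup>2 * b)))"
    by (rule has_bochner_integral_mult_right[OF gaussian_fourier[OF assms(1)]])
  moreover have "of_real ?c * (exp (\<i> * of_real (t * (w + \<sigma>\<^sup>2 * b)))
      * of_real (exp (- (\<sigma>\<^sup>2 * t\<^sup>2 / 2)))) = k t" for t
    unfolding k_def exp_of_real[symmetric] exp_add[symmetric]
    by (rule arg_cong[where f = exp]) (simp add: complex_eq_iff power2_eq_square field_simps)
  moreover have "?c * normal_density 0 \<sigma> (w + \<sigma>\<^sup>2 * b) = normal_density 0 \<sigma> w"
  proof -
    have "b * w + \<sigma>\<^sup>2 * b\<^sup>2 / 2 - ((w + \<sigma>\<^sup>2 * b) - 0)\<^sup>2 / (2 * \<sigma>\<^sup>2) = - w\<^sup>2 / (2 * \<sigma>\<^sup>2)"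
      using assms(1) by (simp add: divide_simps) (simp add: power2_eq_square algebra_simps)
    then show ?thesis unfolding exp_mult_normal_density by (simp add: normal_density_def)
  qed
  then have "complex_of_real ?c * of_real (2 * pi * normal_density 0 \<sigma> (w + \<sigma>\<^sup>2 * b))
      = of_real (2 * pi * normal_density 0 \<sigma> w)"
    by (simp only: of_real_mult[symmetric] mult.left_commute[of ?c])
  ultimately show ?thesis by (simp only:)
qed

text \<open>Completing the square: an exponential weight only shifts the mean. The smoothing error
  needs r = 1 and r = 2.\<close>

lemma normal_density_exp_moment:
  assumes "\<sigma> > 0"
  shows "exp (r * v) * normal_density y \<sigma> v = exp (r * y + r\<^sup>2 * \<sigma>\<^sup>2 / 2) * normal_density (y + r * \<sigma>\<^sup>2) \<sigma> v"
proof -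
  have "r * v - (v - y)\<^sup>2 / (2 * \<sigma>\<^sup>2) = r * y + r\<^sup>2 * \<sigma>\<^sup>2 / 2 - (v - (y + r * \<sigma>\<^sup>2))\<^sup>2 / (2 * \<sigma>\<^sup>2)"
    using assms by (simp add: divide_simps) (simp add: power2_eq_square algebra_simps)
  then show ?thesis unfolding exp_mult_normal_density by simp
qed

text \<open>For e = exp (v - y) - 1 the inequality |e| \<le> e^2 / (2 \<sigma>) + \<sigma> / 2
  replaces the absolute value by exponentials in v, whose Gaussian means are explicit. The mean of
  e^2 is of order \<sigma>^2, so both summands contribute order \<sigma>.\<close>

lemma gaussian_smoothing_error:
  fixes h :: "real \<Rightarrow> real" and y \<sigma> :: real
  assumes [measurable]: "h \<in> borel_measurable borel"
    and lip: "\<And>v. \<bar>h v - h y\<bar> \<le> \<bar>exp v - exp y\<bar> + 1"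
    and \<sigma>: "0 < \<sigma>" "\<sigma> \<le> 1 / 2"
  shows "integrable lborel (\<lambda>v. h v * normal_density y \<sigma> v)"
    and "\<bar>h y - (\<integral>v. h v * normal_density y \<sigma> v \<partial>lborel)\<bar> \<le> 3 * \<sigma> * exp y + 1"
proof -
  let ?n = "normal_density y \<sigma>"
  \<comment> \<open>The majorant obtained in this way, with e^2 expanded so that every summand is an
    exponential moment.\<close>
  define g where "g v = exp y / (2 * \<sigma>)
      * (exp (-2*y) * (exp (2 * v) * ?n v) - 2 * exp (-y) * (exp (1 * v) * ?n v) + ?n v)
      + (exp y * \<sigma> / 2 + 1) * ?n v" for v
  have gi: "has_bochner_integral lborel g (exp y / (2 * \<sigma>) * (exp (-2*y) * (exp (2 * y + 2\<^sup>2 * \<sigma>\<^sup>2 / 2) * 1)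
       - 2 * exp (-y) * (exp (1 * y + 1\<^sup>2 * \<sigma>\<^sup>2 / 2) * 1) + 1) + (exp y * \<sigma> / 2 + 1) * 1)"
    unfolding g_def normal_density_exp_moment[OF \<sigma>(1)] using \<sigma>
    by (intro has_bochner_integral_add has_bochner_integral_diff has_bochner_integral_mult_right)
       (simp_all add: has_bochner_integral_iff)
  have bound: "\<bar>h v - h y\<bar> * ?n v \<le> g v" for v
  proof -
    define e where "e = exp (v - y) - 1"
    have "2 * \<sigma> * \<bar>e\<bar> \<le> e^2 + \<sigma>^2"
      using zero_le_power2[of "\<bar>e\<bar> - \<sigma>"] by (simp add: power2_eq_square algebra_simps abs_mult_self_eq)
    then have e: "\<bar>e\<bar> \<le> e^2 / (2 * \<sigma>) + \<sigma> / 2" using \<sigma> by (simp add: field_simps power2_eq_square)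
    have "exp v - exp y = exp y * e" by (simp add: e_def exp_diff field_simps)
    then have "\<bar>h v - h y\<bar> \<le> exp y * \<bar>e\<bar> + 1" using lip[of v] by (simp add: abs_mult)
    also have "\<dots> \<le> exp y * (e^2 / (2 * \<sigma>) + \<sigma> / 2) + 1" using e by (simp add: mult_left_mono)
    finally have "\<bar>h v - h y\<bar> * ?n v \<le> (exp y * (e^2 / (2 * \<sigma>) + \<sigma> / 2) + 1) * ?n v"
      by (rule mult_right_mono) simp
    also have "e\<^sup>2 = exp (-2*y) * exp (2 * v) - 2 * exp (-y) * exp v + 1"
    proof -
      have "exp (-2*y) * exp (2 * v) = exp (v-y) ^ 2"
          by (simp add: exp_add[symmetric] exp_of_nat_mult[symmetric] power2_eq_square)
      moreover have "exp (-y) * exp v = exp (v-y)" by (simp add: exp_add[symmetric])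
      ultimately show ?thesis by (simp add: e_def power2_eq_square algebra_simps)
    qed
    finally show ?thesis by (simp add: g_def algebra_simps add_divide_distrib diff_divide_distrib)
  qed
  have gn: "0 \<le> g v" for v using bound[of v]
      by (meson abs_ge_zero mult_nonneg_nonneg normal_density_nonneg order_trans)
  have int0: "integrable lborel (\<lambda>v. (h v - h y) * ?n v)"
    by (rule Bochner_Integration.integrable_bound[of _ g])
       (use gi bound gn in \<open>auto simp: has_bochner_integral_iff abs_mult\<close>)
  have "integrable lborel (\<lambda>v. (h v - h y) * ?n v + h y * ?n v)"
    using int0 \<sigma> by (intro Bochner_Integration.integrable_add) auto
  then show int: "integrable lborel (\<lambda>v. h v * ?n v)" by (simp add: algebra_simps)
  have "h y - (\<integral>v. h v * ?n v \<partial>lborel) = - (\<integral>v. (h v - h y) * ?n v \<partial>lborel)"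
    using int \<sigma> by (simp add: left_diff_distrib)
  also have "\<bar>\<dots>\<bar> \<le> (\<integral>v. \<bar>h v - h y\<bar> * ?n v \<partial>lborel)"
    using integral_norm_bound[of lborel "\<lambda>v. (h v - h y) * ?n v"] by (simp add: abs_mult)
  also have "\<dots> \<le> (\<integral>v. g v \<partial>lborel)"
    using gi bound integrable_abs[OF int0]
        by (intro integral_mono) (auto simp: has_bochner_integral_iff abs_mult)
  also have "\<dots> = exp y / (2 * \<sigma>) * (exp (2 * \<sigma>\<^sup>2) - 2 * exp (\<sigma>\<^sup>2 / 2) + 1) + (exp y * \<sigma> / 2 + 1)"
  proof -
    have 1: "exp (-2*y) * (exp (2 * y + 2\<^sup>2 * \<sigma>\<^sup>2 / 2) * 1) = exp (2 * \<sigma>\<^sup>2)"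
      by (simp flip: exp_add)
    have 2: "2 * exp (-y) * (exp (1 * y + 1\<^sup>2 * \<sigma>\<^sup>2 / 2) * 1) = 2 * exp (\<sigma>\<^sup>2 / 2)"
      by (simp flip: exp_add mult.assoc)
    show ?thesis using gi unfolding 1 2 by (simp add: has_bochner_integral_iff)
  qed
  also have "exp (2 * \<sigma>\<^sup>2) - 2 * exp (\<sigma>\<^sup>2 / 2) + 1 \<le> 4 * \<sigma>\<^sup>2"
  proof -
    have s: "\<sigma>\<^sup>2 \<le> 1 / 4" using power_mono[OF \<sigma>(2), of 2] \<sigma>(1) by (simp add: power_divide)
    have "exp (2 * \<sigma>\<^sup>2) \<le> 1 + 2 * \<sigma>\<^sup>2 + (2 * \<sigma>\<^sup>2)\<^sup>2" using s by (intro exp_bound) auto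
    also have "(2 * \<sigma>\<^sup>2)\<^sup>2 \<le> 2 * \<sigma>\<^sup>2" using mult_left_mono[of "2 * \<sigma>\<^sup>2" 1 "2 * \<sigma>\<^sup>2"] s
        by (auto simp: power2_eq_square[of "2 * \<sigma>\<^sup>2"])
    finally have "exp (2 * \<sigma>\<^sup>2) \<le> 1 + 2 * \<sigma>\<^sup>2 + 2 * \<sigma>\<^sup>2" by simp
    moreover have "exp (\<sigma>\<^sup>2 / 2) \<ge> 1" by simp
    ultimately show ?thesis by linarith
  qed
  then have "exp y / (2 * \<sigma>) * (exp (2 * \<sigma>\<^sup>2) - 2 * exp (\<sigma>\<^sup>2 / 2) + 1) \<le> exp y / (2 * \<sigma>) * (4 * \<sigma>\<^sup>2)"
    using \<sigma> by (intro mult_left_mono) auto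
  also have "\<dots> = 2 * \<sigma> * exp y" using \<sigma> by (simp add: power2_eq_square)
  finally have "\<bar>h y - (\<integral>v. h v * ?n v \<partial>lborel)\<bar> \<le> 2 * \<sigma> * exp y + (exp y * \<sigma> / 2 + 1)"
    by simp
  moreover have "exp y * \<sigma> \<ge> 0" using \<sigma> by simp
  ultimately show "\<bar>h y - (\<integral>v. h v * ?n v \<partial>lborel)\<bar> \<le> 3 * \<sigma> * exp y + 1"
    by argo
qed

lemma has_bochner_integral_gaussian:
  assumes "c > 0"
  shows "has_bochner_integral lborel (\<lambda>t. exp (- (c * t\<^sup>2))) (sqrt (pi / c))"
proof -
  define \<tau> where "\<tau> = 1 / sqrt (2 * c)"
  have \<tau>: "\<tau> > 0" "\<tau>\<^sup>2 = 1 / (2 * c)" using assms by (auto simp: \<tau>_def power_divide)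
  have "has_bochner_integral lborel (normal_density 0 \<tau>) 1"
    using \<tau> by (simp add: has_bochner_integral_iff)
  then have "has_bochner_integral lborel (\<lambda>t. sqrt (pi / c) * normal_density 0 \<tau> t) (sqrt (pi / c) * 1)"
    by (rule has_bochner_integral_mult_right)
  moreover have "sqrt (pi / c) * normal_density 0 \<tau> t = exp (- (c * t\<^sup>2))" for t
    using assms by (simp add: normal_density_def \<tau>(2) field_simps)
  ultimately show ?thesis by simp
qed

lemma norm_exp_vertical:
  "norm (exp (Complex b t * of_real w + of_real (\<sigma>\<^sup>2 / 2) * (Complex b t)\<^sup>2)) =
     exp (b * w + \<sigma>\<^sup>2 / 2 * b\<^sup>2) * exp (- (\<sigma>\<^sup>2 / 2 * t\<^sup>2))"
proof -
  have "Re (Complex b t * of_real w + of_real (\<sigma>\<^sup>2 / 2) * (Complex b t)\<^sup>2)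
      = b * w + \<sigma>\<^sup>2 / 2 * b\<^sup>2 + - (\<sigma>\<^sup>2 / 2 * t\<^sup>2)"
    by (simp add: power2_eq_square algebra_simps diff_divide_distrib)
  then have "norm (exp (Complex b t * of_real w + of_real (\<sigma>\<^sup>2 / 2) * (Complex b t)\<^sup>2))
      = exp (b * w + \<sigma>\<^sup>2 / 2 * b\<^sup>2 + - (\<sigma>\<^sup>2 / 2 * t\<^sup>2))"
    by (simp only: norm_exp_eq_Re)
  then show ?thesis by (simp only: exp_add)
qed

lemma borel_measurable_Complex [measurable (raw)]:
  assumes [measurable]: "f \<in> borel_measurable M" "g \<in> borel_measurable M"
  shows "(\<lambda>x. Complex (f x) (g x)) \<in> borel_measurable M"
  unfolding Complex_eq by measurable

text \<open>Fubini: for fixed v the integral over t is \<open>gaussian_vertical_line\<close> with w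
  = y - v, and the density is symmetric in y and v. The bound by \<open>exp v\<close> and b > 1 make
  the double integral absolutely convergent.\<close>

lemma gaussian_smoothing_identity:
  fixes h :: "real \<Rightarrow> real" and y \<sigma> b :: real
  assumes [measurable]: "h \<in> borel_measurable borel"
    and h0: "\<And>v. v < 0 \<Longrightarrow> h v = 0" and h: "\<And>v. \<bar>h v\<bar> \<le> exp v"
    and b: "b > 1" and \<sigma>: "\<sigma> > 0"
  defines "F \<equiv> \<lambda>t. (\<integral>v. h v *\<^sub>R exp (- Complex b t * of_real v) \<partial>lborel) *
                 exp (Complex b t * of_real y + of_real (\<sigma>\<^sup>2 / 2) * (Complex b t)\<^sup>2)"
  shows "integrable lborel F"
    and "(\<integral>t. F t \<partial>lborel) = of_real (2 * pi * (\<integral>v. h v * normal_density y \<sigma> v \<partial>lborel))"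
proof -
  define G where "G v t = h v *\<^sub>R exp
      (Complex b t * of_real (y - v) + of_real (\<sigma>\<^sup>2 / 2) * (Complex b t)\<^sup>2)" for v t
  define p where "p v = \<bar>h v\<bar> * exp (- b * v)" for v
  define q where "q t = exp (b * y + \<sigma>\<^sup>2 / 2 * b\<^sup>2) * exp (- (\<sigma>\<^sup>2 / 2 * t\<^sup>2))" for t
  have normG: "norm (G v t) = p v * q t" for v t
  proof -
    have "exp (b * (y - v) + \<sigma>\<^sup>2 / 2 * b\<^sup>2) = exp (- b * v) * exp (b * y + \<sigma>\<^sup>2 / 2 * b\<^sup>2)"
      by (simp flip: exp_add add: algebra_simps)
    then show ?thesis unfolding G_def norm_scaleR norm_exp_vertical p_def q_def by simp
  qed
  have p: "integrable lborel p"
  proof (rule Bochner_Integration.integrable_bound)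
    show "integrable lborel (\<lambda>v. indicator {0..} v * exp (- ((b - 1) * v)))"
      using has_bochner_integral_exp_tail[of "b - 1" 0] b by (simp add: has_bochner_integral_iff)
    have "\<bar>h v\<bar> * exp (- b * v) \<le> indicator {0..} v * exp (- ((b - 1) * v))" for v
    proof (cases "v < 0")
      case False
      have "\<bar>h v\<bar> * exp (- b * v) \<le> exp v * exp (- b * v)" by (intro mult_right_mono h) auto
      also have "\<dots> = exp (- ((b - 1) * v))" by (simp flip: exp_add add: algebra_simps)
      finally show ?thesis using False by simp
    qed (auto simp: h0)
    then show "AE v in lborel. norm (p v) \<le> norm (indicator {0..} v * exp (- ((b - 1) * v)))"
      by (simp add: p_def abs_mult)
    show "p \<in> borel_measurable lborel" unfolding p_def by measurable
  qed
  have Gi: "integrable (lborel \<Otimes>\<^sub>M lborel) (case_prod G)"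
  proof (rule lborel_pair.Fubini_integrable)
    show "case_prod G \<in> borel_measurable (lborel \<Otimes>\<^sub>M lborel)"
      unfolding G_def by measurable
    show "integrable lborel (\<lambda>v. \<integral>t. norm (case_prod G (v, t)) \<partial>lborel)"
      using p by (simp add: normG)
    have "integrable lborel (\<lambda>t. h v *\<^sub>R exp
        (Complex b t * of_real (y - v) + of_real (\<sigma>\<^sup>2 / 2) * (Complex b t)\<^sup>2))" for v
      using gaussian_vertical_line[OF \<sigma>, of b "y - v"]
          by (intro integrable_scaleR_right) (simp add: has_bochner_integral_iff)
    then show "AE v in lborel. integrable lborel (\<lambda>t. case_prod G (v, t))" by (simp add: G_def)
  qed
  have Feq: "(\<integral>v. G v t \<partial>lborel) = F t" for t
  proof -
    have "G v t = (h v *\<^sub>R exp (- Complex b t * of_real v))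
        * exp (Complex b t * of_real y + of_real (\<sigma>\<^sup>2 / 2) * (Complex b t)\<^sup>2)" for v
    proof -
      have "exp (Complex b t * of_real (y - v) + of_real (\<sigma>\<^sup>2 / 2) * (Complex b t)\<^sup>2)
          = exp (- Complex b t * of_real v) * exp
              (Complex b t * of_real y + of_real (\<sigma>\<^sup>2 / 2) * (Complex b t)\<^sup>2)"
        unfolding exp_add[symmetric] by (rule arg_cong[where f = exp]) (simp add: algebra_simps)
      then show ?thesis by (simp only: G_def mult_scaleR_left)
    qed
    then show ?thesis by (simp only: F_def integral_mult_left_zero)
  qed
  show "integrable lborel F"
    using lborel_pair.integrable_snd[OF Gi] by (simp add: Feq)
  have "(\<integral>t. F t \<partial>lborel) = (\<integral>v. (\<integral>t. G v t \<partial>lborel) \<partial>lborel)"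
    using lborel_pair.Fubini_integral[OF Gi] by (simp add: Feq)
  also have "\<dots> = (\<integral>v. of_real (2 * pi * (h v * normal_density y \<sigma> v)) \<partial>lborel)"
  proof (rule Bochner_Integration.integral_cong[OF refl])
    fix v :: real
    have "(\<integral>t. G v t \<partial>lborel) = h v *\<^sub>R of_real (2 * pi * normal_density 0 \<sigma> (y - v))"
      unfolding G_def using gaussian_vertical_line[OF \<sigma>, of b "y - v"] by (simp add: has_bochner_integral_iff)
    also have "normal_density 0 \<sigma> (y - v) = normal_density y \<sigma> v"
      by (simp add: normal_density_def power2_commute)
    finally show "(\<integral>t. G v t \<partial>lborel) = of_real (2 * pi * (h v * normal_density y \<sigma> v))"
      by (simp add: scaleR_conv_of_real)
  qed
  also have "\<dots> = of_real (2 * pi * (\<integral>v. h v * normal_density y \<sigma> v \<partial>lborel))"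
    by (simp only: integral_complex_of_real integral_mult_right_zero)
  finally show "(\<integral>t. F t \<partial>lborel) = of_real (2 * pi * (\<integral>v. h v * normal_density y \<sigma> v \<partial>lborel))" .
qed

section \<open>Partial sums, their Laplace transform and the shift of the line of
  integration\<close>

definition partial_sum :: "(nat \<Rightarrow> real) \<Rightarrow> real \<Rightarrow> real" where
  "partial_sum a u = (\<Sum>n | n > 0 \<and> real n \<le> u. a n)"

lemma pos_nat_le_eq:
  assumes "0 \<le> u"
  shows "{n::nat. n > 0 \<and> real n \<le> u} = {0<..nat \<lfloor>u\<rfloor>}"
  using assms by (auto simp: le_nat_floor) linarith

lemma finite_pos_nat_le: "finite {n::nat. n > 0 \<and> real n \<le> u}"
  by (rule finite_subset[of _ "{..nat \<lceil>u\<rceil>}"]) (auto, linarith)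

lemma card_nat_between_le:
  assumes "u \<le> w" "0 \<le> u"
  shows "real (card {n::nat. u < real n \<and> real n \<le> w}) \<le> w - u + 1"
proof -
  have "{n::nat. u < real n \<and> real n \<le> w} = {nat \<lfloor>u\<rfloor><..nat \<lfloor>w\<rfloor>}"
    using assms by (auto simp: le_nat_floor) linarith+
  then have "real (card {n::nat. u < real n \<and> real n \<le> w}) = real_of_int (\<lfloor>w\<rfloor> - \<lfloor>u\<rfloor>)"
    using assms floor_mono[OF assms(1)] by (simp add: of_nat_diff nat_mono)
  then show ?thesis by linarith
qed

lemma partial_sum_lipschitz:
  assumes a: "\<And>n. n > 0 \<Longrightarrow> \<bar>a n\<bar> \<le> 1" and "0 \<le> u" "0 \<le> w"
  shows "\<bar>partial_sum a w - partial_sum a u\<bar> \<le> \<bar>w - u\<bar> + 1"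
proof -
  have *: "\<bar>partial_sum a w - partial_sum a u\<bar> \<le> w - u + 1" if "0 \<le> u" "u \<le> w" for u w
  proof -
    let ?S = "{n::nat. u < real n \<and> real n \<le> w}"
    have "{n::nat. n > 0 \<and> real n \<le> w} = {n. n > 0 \<and> real n \<le> u} \<union> ?S"
      using that by auto
    moreover have "finite ?S" by (rule finite_subset[OF _ finite_pos_nat_le[of w]]) (use that in auto)
    ultimately have "partial_sum a w = partial_sum a u + sum a ?S"
      unfolding partial_sum_def using finite_pos_nat_le[of u] by (simp add: sum.union_disjoint disjoint_iff)
    moreover have "\<bar>sum a ?S\<bar> \<le> (\<Sum>n\<in>?S. 1)"
      by (rule order_trans[OF sum_abs sum_mono]) (use a that in auto)
    ultimately show ?thesis using card_nat_between_le[of u w] that by simp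
  qed
  show ?thesis using *[of u w] *[of w u] assms(2,3) by (cases "u \<le> w") auto
qed

lemma partial_sum_measurable [measurable]: "partial_sum a \<in> borel_measurable borel"
proof -
  \<comment> \<open>A countable sum of step functions in u, each of them measurable.\<close>
  have "partial_sum a = (\<lambda>u. \<Sum>n. if n > 0 \<and> real n \<le> u then a n else 0)"
  proof
    fix u
    show "partial_sum a u = (\<Sum>n. if n > 0 \<and> real n \<le> u then a n else 0)"
      unfolding partial_sum_def by (subst suminf_finite[OF finite_pos_nat_le[of u]]) auto
  qed
  then show ?thesis by simp
qed

text \<open>As a function of v the partial sum is a sum of unit steps at ln n weighted by
  \<open>a n\<close>. The transform may be taken term by term because the integrals of the norms are
  summable for Re s > 1.\<close>

lemma laplace_partial_sum:
  assumes s: "Re s > 1" and a: "\<And>n. n > 0 \<Longrightarrow> \<bar>a n\<bar> \<le> 1"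
  shows "(\<integral>v. partial_sum a (exp v) *\<^sub>R exp (- s * of_real v) \<partial>lborel) = dirichlet_series a s / s"
proof -
  define f where "f n v = a (Suc n) *\<^sub>R (indicator {ln (real (Suc n))..} v *\<^sub>R exp (- s * of_real v))"
      for n and v :: real
  have ln_le: "ln (real (Suc n)) \<le> v \<longleftrightarrow> real (Suc n) \<le> exp v" for n v
    by (metis exp_le_cancel_iff exp_ln of_nat_0_less_iff zero_less_Suc)
  have fin: "finite {n. real (Suc n) \<le> exp v}" for v
  proof -
    have "{n. real (Suc n) \<le> exp v} = Suc -` {n. n > 0 \<and> real n \<le> exp v}" by auto
    then show ?thesis by (simp only: finite_vimageI[OF finite_pos_nat_le inj_Suc])
  qed
  have f0: "f n v = 0" if "n \<notin> {n. real (Suc n) \<le> exp v}" for n v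
    using that ln_le[of n v] by (simp add: f_def)
  have int: "has_bochner_integral lborel (f n) (a (Suc n) *\<^sub>R (npow (Suc n) s / s))" for n
    unfolding f_def npow_def using has_bochner_integral_cexp_tail[of s "ln (real (Suc n))"] s
    by (intro has_bochner_integral_scaleR_right) auto
  have nint: "(\<integral>v. norm (f n v) \<partial>lborel) = \<bar>a (Suc n)\<bar> * (real (Suc n) powr (- Re s) / Re s)" for n
  proof -
    have "norm (f n v) = \<bar>a (Suc n)\<bar> * (indicator {ln (real (Suc n))..} v * exp (- (Re s * v)))" for v
      by (simp add: f_def indicator_def)
    moreover have "(\<integral>v. indicator {ln (real (Suc n))..} v * exp (- (Re s * v)) \<partial>lborel)
        = real (Suc n) powr (- Re s) / Re s"
      using has_bochner_integral_exp_tail[of "Re s" "ln (real (Suc n))"] s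
          by (simp add: has_bochner_integral_iff powr_def)
    ultimately show ?thesis by simp
  qed
  have "(\<integral>v. (\<Sum>n. f n v) \<partial>lborel) = (\<Sum>n. integral\<^sup>L lborel (f n))"
  proof (rule integral_suminf)
    show "integrable lborel (f n)" for n using int by (simp add: has_bochner_integral_iff)
    show "AE v in lborel. summable (\<lambda>n. norm (f n v))"
      using f0 by (intro AE_I2 summable_finite[OF fin]) auto
    show "summable (\<lambda>n. \<integral>v. norm (f n v) \<partial>lborel)"
    proof (rule summable_comparison_test')
      show "summable (\<lambda>n. real (Suc n) powr (- Re s) / Re s)"
        by (rule summable_divide[OF summable_Suc_powr(1)[OF s]])
      show "norm (\<integral>v. norm (f n v) \<partial>lborel) \<le> real (Suc n) powr (- Re s) / Re s" for n
        unfolding nint using mult_right_mono[of "\<bar>a (Suc n)\<bar>" 1 "real (Suc n) powr (- Re s) / Re s"]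
            a[of "Suc n"] s
        by (simp add: abs_mult del: of_nat_Suc)
    qed
  qed
  also have "(\<lambda>n. integral\<^sup>L lborel (f n)) = (\<lambda>n. (of_real (a (Suc n)) * npow (Suc n) s) / s)"
    using int by (simp add: has_bochner_integral_iff scaleR_conv_of_real)
  also have "(\<Sum>n. (of_real (a (Suc n)) * npow (Suc n) s) / s) = dirichlet_series a s / s"
    using sums_unique[OF sums_divide[OF dirichlet_series_sums[where a = a, OF s a], of s]] by simp
  finally have "(\<integral>v. (\<Sum>n. f n v) \<partial>lborel) = dirichlet_series a s / s" .
  moreover have "(\<Sum>n. f n v) = partial_sum a (exp v) *\<^sub>R exp (- s * of_real v)" for v
  proof -
    have "(\<Sum>n. f n v) = (\<Sum>n | real (Suc n) \<le> exp v. f n v)"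
      using f0 by (intro suminf_finite[OF fin]) auto
    also have "\<dots> = (\<Sum>n | real (Suc n) \<le> exp v. a (Suc n) *\<^sub>R exp (- s * of_real v))"
      using ln_le by (intro sum.cong) (auto simp: f_def)
    also have "\<dots> = (\<Sum>n | real (Suc n) \<le> exp v. a (Suc n)) *\<^sub>R exp (- s * of_real v)"
      by (simp add: scaleR_left.sum)
    also have "(\<Sum>n | real (Suc n) \<le> exp v. a (Suc n)) = partial_sum a (exp v)"
      unfolding partial_sum_def by (rule sum.reindex_bij_witness[of _ "\<lambda>n. n - 1" Suc]) auto
    finally show ?thesis .
  qed
  ultimately show ?thesis by simp
qed

lemma abs_partial_sum_le:
  assumes a: "\<And>n. n > 0 \<Longrightarrow> \<bar>a n\<bar> \<le> 1" and "0 \<le> u"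
  shows "\<bar>partial_sum a u\<bar> \<le> u"
proof -
  have "real (card {n::nat. n > 0 \<and> real n \<le> u}) \<le> u"
    using assms(2) by (simp add: pos_nat_le_eq)
  moreover have "\<bar>partial_sum a u\<bar> \<le> (\<Sum>n | n > 0 \<and> real n \<le> u. 1)"
    unfolding partial_sum_def by (rule order_trans[OF sum_abs sum_mono]) (use a in auto)
  ultimately show ?thesis by simp
qed

text \<open>Cauchy's theorem expresses the integral over the right side of the rectangle by those
  over the other three; \<open>M1\<close> belongs to the left side and \<open>M2\<close> to the
  horizontal ones.\<close>

lemma norm_integral_rectangle_le:
  fixes g :: "complex \<Rightarrow> complex"
  assumes "l < b" "0 < T"
    and hol: "g holomorphic_on {s. l \<le> Re s \<and> Re s \<le> b \<and> \<bar>Im s\<bar> \<le> T}"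
    and left: "\<And>t. \<bar>t\<bar> \<le> T \<Longrightarrow> norm (g (Complex l t)) \<le> M1"
    and hor: "\<And>x. l \<le> x \<Longrightarrow> x \<le> b \<Longrightarrow> norm (g (Complex x T)) \<le> M2 \<and> norm (g (Complex x (-T))) \<le> M2"
    and M: "0 \<le> M1" "0 \<le> M2"
  shows "norm (integral {-T..T} (\<lambda>t. g (Complex b t))) \<le> 2 * T * M1 + 2 * (b - l) * M2"
proof -
  define S where "S = {s. l \<le> Re s \<and> Re s \<le> b \<and> \<bar>Im s\<bar> \<le> T}"
  define P1 where "P1 = Complex b (-T)"
  define P2 where "P2 = Complex b T"
  define P3 where "P3 = Complex l T"
  define P4 where "P4 = Complex l (-T)"
  note P = P1_def P2_def P3_def P4_def
  have S_eq: "S = {s. Re s \<ge> l} \<inter> {s. Re s \<le> b} \<inter> {s. Im s \<le> T} \<inter> {s. Im s \<ge> -T}"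
    by (auto simp: S_def)
  have conv: "convex S" unfolding S_eq
    by (intro convex_Int convex_halfspace_Re_ge convex_halfspace_Re_le convex_halfspace_Im_ge
        convex_halfspace_Im_le)
  have hol': "g holomorphic_on S" using hol by (simp add: S_def)
  have PS: "P1 \<in> S" "P2 \<in> S" "P3 \<in> S" "P4 \<in> S" using assms by (auto simp: P S_def)
  have seg: "closed_segment u v \<subseteq> S" if "u \<in> S" "v \<in> S" for u v
    using that conv by (simp add: closed_segment_subset)
  have int: "g contour_integrable_on linepath u v" if "u \<in> S" "v \<in> S" for u v
    using holomorphic_on_imp_continuous_on[OF holomorphic_on_subset[OF hol' seg[OF that]]]
    by (rule contour_integrable_continuous_linepath)
  let ?p = "linepath P1 P2 +++ linepath P2 P3 +++ linepath P3 P4 +++ linepath P4 P1"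
  have "(g has_contour_integral 0) ?p"
    by (rule Cauchy_theorem_convex_simple[OF hol' conv]) (use seg PS in \<open>auto simp: path_image_join\<close>)
  then have "contour_integral ?p g = 0" by (rule contour_integral_unique)
  then have "contour_integral (linepath P1 P2) g + (contour_integral (linepath P2 P3) g
      + (contour_integral (linepath P3 P4) g + contour_integral (linepath P4 P1) g)) = 0"
    using PS by (simp add: int contour_integral_join contour_integrable_join)
  then have "contour_integral (linepath P1 P2) g = - (contour_integral (linepath P2 P3) g
      + (contour_integral (linepath P3 P4) g + contour_integral (linepath P4 P1) g))"
    by (simp only: eq_neg_iff_add_eq_0)
  then have "norm (contour_integral (linepath P1 P2) g) = norm (contour_integral (linepath P2 P3) g
      + (contour_integral (linepath P3 P4) g + contour_integral (linepath P4 P1) g))"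
    by (simp only: norm_minus_cancel)
  also have "\<dots> \<le> norm (contour_integral (linepath P2 P3) g)
      + (norm (contour_integral (linepath P3 P4) g) + norm (contour_integral (linepath P4 P1) g))"
    by (meson add_left_mono norm_triangle_ineq order_trans)
  also have "norm (contour_integral (linepath P2 P3) g) \<le> M2 * norm (P3 - P2)"
  proof (rule contour_integral_bound_linepath[OF int[OF PS(2,3)] M(2)])
    fix z assume z: "z \<in> closed_segment P2 P3"
    then have "Re z \<in> closed_segment b l" "Im z = T"
      by (auto simp: P closed_segment_same_Im)
    then have "z = Complex (Re z) T" "l \<le> Re z" "Re z \<le> b"
      using assms(1) by (auto simp: complex_eq_iff closed_segment_eq_real_ivl)
    then show "norm (g z) \<le> M2" using hor by metis
  qed
  also have "norm (contour_integral (linepath P3 P4) g) \<le> M1 * norm (P4 - P3)"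
  proof (rule contour_integral_bound_linepath[OF int[OF PS(3,4)] M(1)])
    fix z assume z: "z \<in> closed_segment P3 P4"
    then have "z \<in> S" using seg PS by blast
    moreover have "Re z = l" using z by (auto simp: P closed_segment_same_Re)
    ultimately show "norm (g z) \<le> M1" using left[of "Im z"] by (auto simp: S_def)
  qed
  also have "norm (contour_integral (linepath P4 P1) g) \<le> M2 * norm (P1 - P4)"
  proof (rule contour_integral_bound_linepath[OF int[OF PS(4,1)] M(2)])
    fix z assume z: "z \<in> closed_segment P4 P1"
    then have "Re z \<in> closed_segment l b" "Im z = -T"
      by (auto simp: P closed_segment_same_Im)
    then have "z = Complex (Re z) (-T)" "l \<le> Re z" "Re z \<le> b"
      using assms(1) by (auto simp: complex_eq_iff closed_segment_eq_real_ivl)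
    then show "norm (g z) \<le> M2" using hor by metis
  qed
  also have "norm (P3 - P2) = b - l" using assms(1) by (simp add: P cmod_def)
  also have "norm (P4 - P3) = 2 * T" using assms(2) by (simp add: P cmod_def real_sqrt_mult)
  also have "norm (P1 - P4) = b - l" using assms(1) by (simp add: P cmod_def)
  also have "contour_integral (linepath P1 P2) g = \<i> * integral {-T..T} (\<lambda>t. g (Complex b t))"
    by (rule contour_integral_linepath_same_Re) (use assms(2) in \<open>auto simp: P\<close>)
  finally show ?thesis by (simp add: norm_mult algebra_simps)
qed

text \<open>\<open>B\<close> is a continuation of the Dirichlet series of \<open>a\<close>,
  controlled only up to height T. That part of the line is moved to abscissa l; the rest stays at b,
  where the trivial bound and the Gaussian factor suffice. In the bound, the first two terms are the
  smoothing error, the third is the left side, and the last collects the horizontal sides and the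
  tails.\<close>

lemma partial_sum_gaussian_bound:
  fixes a :: "nat \<Rightarrow> real" and B :: "complex \<Rightarrow> complex"
  assumes a: "\<And>n. n > 0 \<Longrightarrow> \<bar>a n\<bar> \<le> 1"
    and y: "y \<ge> 1" and \<sigma>: "0 < \<sigma>" "\<sigma> \<le> 1 / 2" and T: "T > 0" and l: "1 / 2 \<le> l" "l < 1" and K: "K \<ge> 0"
    and hol: "B holomorphic_on {s. l \<le> Re s \<and> Re s \<le> 2 \<and> \<bar>Im s\<bar> \<le> T}"
    and BK: "\<And>s. l \<le> Re s \<Longrightarrow> Re s \<le> 2 \<Longrightarrow> \<bar>Im s\<bar> \<le> T \<Longrightarrow> norm (B s) \<le> K"
    and B: "\<And>s. 1 < Re s \<Longrightarrow> Re s \<le> 2 \<Longrightarrow> \<bar>Im s\<bar> \<le> T \<Longrightarrow> B s = dirichlet_series a s"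
  shows "\<bar>partial_sum a (exp y)\<bar> \<le> 3 * \<sigma> * exp y + 1 + 4 * T * K * exp (l * y + 1)
     + (8 * K + 4 * (1 + y) / \<sigma>) * exp (y + 2) * exp (- (\<sigma>\<^sup>2 * T\<^sup>2 / 4))"
proof -
  \<comment> \<open>Then \<open>exp (b * y)\<close> is only e times \<open>exp y\<close>, and the
    series is at most b / (b - 1) = 1 + y on the line.\<close>
  define b where "b = 1 + 1 / y"
  have b: "1 < b" "b \<le> 2" "b * y = y + 1" using y by (auto simp: b_def field_simps)
  define h where "h v = partial_sum a (exp v)" for v
  define g where "g s = B s / s * exp (s * of_real y + of_real (\<sigma>\<^sup>2 / 2) * s\<^sup>2)" for s
  define F where "F t = (\<integral>v. h v *\<^sub>R exp (- Complex b t * of_real v) \<partial>lborel) *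
                 exp (Complex b t * of_real y + of_real (\<sigma>\<^sup>2 / 2) * (Complex b t)\<^sup>2)" for t
  \<comment> \<open>Half of the Gaussian decay at height T; on the tails the other half remains to
    make the integral over t converge.\<close>
  define e where "e = exp (- (\<sigma>\<^sup>2 * T\<^sup>2 / 4))"
  have hm [measurable]: "h \<in> borel_measurable borel" unfolding h_def by measurable
  have h0: "h v = 0" if "v < 0" for v
  proof -
    have "exp v < 1" using that by simp
    then have "\<not> real n \<le> exp v" if "n > 0" for n :: nat using that by linarith
    then have "{n::nat. n > 0 \<and> real n \<le> exp v} = {}" by blast
    then show ?thesis by (simp only: h_def partial_sum_def sum.empty)
  qed
  have hle: "\<bar>h v\<bar> \<le> exp v" for v using abs_partial_sum_le[of a "exp v"] a by (simp add: h_def)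
  have s2: "\<sigma>\<^sup>2 \<le> 1 / 4" using power_mono[OF \<sigma>(2), of 2] \<sigma>(1) by (simp add: power_divide)
  have \<sigma>x: "\<sigma>\<^sup>2 / 2 * x\<^sup>2 \<le> 1" if "0 \<le> x" "x \<le> 2" for x
  proof -
    have "x\<^sup>2 \<le> 2\<^sup>2" using that by (intro power_mono) auto
    then have "\<sigma>\<^sup>2 * x\<^sup>2 \<le> (1/4) * 4" using s2 by (intro mult_mono) auto
    then show ?thesis by simp
  qed
  have smooth: "\<bar>h y - (\<integral>v. h v * normal_density y \<sigma> v \<partial>lborel)\<bar> \<le> 3 * \<sigma> * exp y + 1"
    using gaussian_smoothing_error(2)[OF hm _ \<sigma>] partial_sum_lipschitz[of a] a by (simp add: h_def)
  have Fint: "integrable lborel F" and Feq: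
      "(\<integral>t. F t \<partial>lborel) = of_real (2 * pi * (\<integral>v. h v * normal_density y \<sigma> v \<partial>lborel))"
    using gaussian_smoothing_identity[OF hm h0 hle b(1) \<sigma>(1), of y] unfolding F_def by blast+
  have F_dirichlet_series:
      "F t = dirichlet_series a (Complex b t) / Complex b t
      * exp (Complex b t * of_real y + of_real (\<sigma>\<^sup>2 / 2) * (Complex b t)\<^sup>2)" for t
    unfolding F_def h_def using laplace_partial_sum[of "Complex b t" a] a b by simp
  have normexp: "norm (exp (Complex x t * of_real y + of_real (\<sigma>\<^sup>2 / 2) * (Complex x t)\<^sup>2))
      \<le> exp (x * y + 1) * exp (- (\<sigma>\<^sup>2 / 2 * t\<^sup>2))"
    if "0 \<le> x" "x \<le> 2" for x t
    unfolding norm_exp_vertical using \<sigma>x[OF that] by (intro mult_right_mono) auto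
  have inv: "norm (Complex x t) \<ge> x" for x t
    using complex_Re_le_cmod[of "Complex x t"] by simp
  have eT: "exp (- (\<sigma>\<^sup>2 / 2 * T\<^sup>2)) \<le> e" by (simp add: e_def)

  have inside: "norm (integral {-T..T} F)
      \<le> 2 * T * (2 * K * exp (l * y + 1)) + 2 * (b - l) * (2 * K * exp (y + 2) * e)"
  proof -
    have "integral {-T..T} F = integral {-T..T} (\<lambda>t. g (Complex b t))"
      by (rule integral_cong) (use B b in \<open>auto simp: F_dirichlet_series g_def\<close>)
    also have "norm \<dots> \<le> 2 * T * (2 * K * exp (l * y + 1)) + 2 * (b - l) * (2 * K * exp (y + 2) * e)"
    proof (rule norm_integral_rectangle_le)
      show "g holomorphic_on {s. l \<le> Re s \<and> Re s \<le> b \<and> \<bar>Im s\<bar> \<le> T}"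
        unfolding g_def using l b by (intro holomorphic_intros holomorphic_on_subset[OF hol]) auto
      have bound: "norm (g (Complex x t)) \<le> 2 * K * (exp (x * y + 1) * exp (- (\<sigma>\<^sup>2 / 2 * t\<^sup>2)))"
        if "l \<le> x" "x \<le> b" "\<bar>t\<bar> \<le> T" for x t
      proof -
        have "norm (B (Complex x t) / Complex x t) \<le> 2 * K"
        proof -
          have "norm (B (Complex x t)) / norm (Complex x t) \<le> K / (1/2)"
            using BK[of "Complex x t"] that b l inv[of x t] K by (intro frac_le) auto
          then show ?thesis by (simp add: norm_divide)
        qed
        then show ?thesis unfolding g_def norm_mult
          using normexp[of x t] that b l K by (intro mult_mono) auto
      qed
      show "norm (g (Complex l t)) \<le> 2 * K * exp (l * y + 1)" if "\<bar>t\<bar> \<le> T" for t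
      proof -
        have "exp (l * y + 1) * exp (- (\<sigma>\<^sup>2 / 2 * t\<^sup>2)) \<le> exp (l * y + 1) * 1"
          by (intro mult_left_mono) auto
        then show ?thesis using bound[of l t] that l b K mult_left_mono[of _ _ "2 * K"] by (smt (verit))
      qed
      show "norm (g (Complex x T)) \<le> 2 * K * exp (y + 2) * e \<and> norm (g (Complex x (- T)))
          \<le> 2 * K * exp (y + 2) * e"
        if "l \<le> x" "x \<le> b" for x
      proof -
        have "x * y \<le> b * y" using that y by simp
        then have "exp (x * y + 1) \<le> exp (y + 2)" using b by simp
        then have "exp (x * y + 1) * exp (- (\<sigma>\<^sup>2 / 2 * T\<^sup>2)) \<le> exp (y + 2) * e"
          using eT by (intro mult_mono) auto
        then have "2 * K * (exp (x * y + 1) * exp (- (\<sigma>\<^sup>2 / 2 * T\<^sup>2))) \<le> 2 * K * (exp (y + 2) * e)"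
          using K by (intro mult_left_mono) auto
        then show ?thesis using bound[of x T] bound[of x "-T"] that T by (auto simp: mult.assoc)
      qed
    qed (use l b T K in \<open>auto simp: e_def\<close>)
    finally show ?thesis .
  qed
  have outside: "norm (\<integral>t. indicator (- {-T..T}) t *\<^sub>R F t \<partial>lborel) \<le> (1 + y) * exp (y + 2) * e * (4 / \<sigma>)"
  proof -
    define G where "G t = (1 + y) * exp (y + 2) * e * exp (- (\<sigma>\<^sup>2 / 4 * t\<^sup>2))" for t
    have gauss: "has_bochner_integral lborel (\<lambda>t. exp (- (\<sigma>\<^sup>2 / 4 * t\<^sup>2))) (sqrt (pi / (\<sigma>\<^sup>2 / 4)))"
      by (rule has_bochner_integral_gaussian) (use \<sigma> in auto)
    have G: "has_bochner_integral lborel G ((1 + y) * exp (y + 2) * e * sqrt (pi / (\<sigma>\<^sup>2 / 4)))"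
      unfolding G_def by (rule has_bochner_integral_mult_right[OF gauss])
    have le: "norm (indicator (- {-T..T}) t *\<^sub>R F t) \<le> G t" for t
    proof (cases "\<bar>t\<bar> \<le> T")
      case True
      then have "indicator (- {-T..T}) t = (0::real)" by (auto simp: indicator_def)
      then show ?thesis using y by (simp add: G_def e_def)
    next
      case False
      have "norm (dirichlet_series a (Complex b t) / Complex b t) \<le> (1 + y) / 1"
        unfolding norm_divide
      proof (intro frac_le)
        have "norm (dirichlet_series a (Complex b t)) \<le> b / (b - 1)"
          using norm_dirichlet_series_le[of "Complex b t" a] a b by simp
        also have "b / (b - 1) = 1 + y" using y by (simp add: b_def field_simps)
        finally show "norm (dirichlet_series a (Complex b t)) \<le> 1 + y" .
      qed (use inv[of b t] b y in auto)
      moreover have "norm (exp (Complex b t * of_real y + of_real (\<sigma>\<^sup>2 / 2) * (Complex b t)\<^sup>2))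
          \<le> exp (y + 2) * (e * exp (- (\<sigma>\<^sup>2 / 4 * t\<^sup>2)))"
      proof -
        have "T\<^sup>2 \<le> t\<^sup>2" using False T by (metis abs_of_pos abs_le_square_iff le_cases)
        then have "\<sigma>\<^sup>2 * T\<^sup>2 \<le> \<sigma>\<^sup>2 * t\<^sup>2" by (intro mult_left_mono) auto
        then have "exp (- (\<sigma>\<^sup>2 / 2 * t\<^sup>2)) \<le> e * exp (- (\<sigma>\<^sup>2 / 4 * t\<^sup>2))"
          by (simp add: e_def flip: exp_add)
        then have "exp (b * y + 1) * exp (- (\<sigma>\<^sup>2 / 2 * t\<^sup>2)) \<le> exp (y + 2) * (e * exp (- (\<sigma>\<^sup>2 / 4 * t\<^sup>2)))"
          using b by (intro mult_mono) auto
        then show ?thesis using normexp[of b t] b by linarith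
      qed
      ultimately have "norm (F t) \<le> (1 + y) * (exp (y + 2) * (e * exp (- (\<sigma>\<^sup>2 / 4 * t\<^sup>2))))"
        unfolding F_dirichlet_series norm_mult using y by (intro mult_mono) auto
      moreover have "norm (indicator (- {-T..T}) t *\<^sub>R F t) \<le> norm (F t)" by (simp add: indicator_def)
      ultimately show ?thesis unfolding G_def by (simp only: mult.assoc)
    qed
    have "norm (\<integral>t. indicator (- {-T..T}) t *\<^sub>R F t \<partial>lborel)
        \<le> (\<integral>t. norm (indicator (- {-T..T}) t *\<^sub>R F t) \<partial>lborel)"
      by (rule integral_norm_bound)
    also have "\<dots> \<le> (\<integral>t. G t \<partial>lborel)"
      using le G by (intro integral_mono integrable_norm integrable_mult_indicator Fint)
          (auto simp: has_bochner_integral_iff)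
    also have "\<dots> = (1 + y) * exp (y + 2) * e * sqrt (pi / (\<sigma>\<^sup>2 / 4))"
      using G by (simp add: has_bochner_integral_iff)
    also have "\<dots> \<le> (1 + y) * exp (y + 2) * e * (4 / \<sigma>)"
    proof (rule mult_left_mono)
      have "pi / (\<sigma>\<^sup>2 / 4) \<le> (4 / \<sigma>)\<^sup>2"
        using pi_less_4 \<sigma> by (simp add: power_divide divide_right_mono)
      then show "sqrt (pi / (\<sigma>\<^sup>2 / 4)) \<le> 4 / \<sigma>" using \<sigma> by (intro real_le_lsqrt) auto
    qed (use y in \<open>auto simp: e_def\<close>)
    finally show ?thesis .
  qed
  have "(\<integral>t. F t \<partial>lborel) = (\<integral>t. indicator {-T..T} t *\<^sub>R F t + indicator (- {-T..T}) t *\<^sub>R F t \<partial>lborel)"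
    by (rule Bochner_Integration.integral_cong) (auto simp: indicator_def)
  also have "\<dots> = (\<integral>t. indicator {-T..T} t *\<^sub>R F t \<partial>lborel) + (\<integral>t. indicator (- {-T..T}) t *\<^sub>R F t \<partial>lborel)"
    by (rule Bochner_Integration.integral_add) (auto intro!: integrable_mult_indicator Fint)
  also have "(\<integral>t. indicator {-T..T} t *\<^sub>R F t \<partial>lborel) = integral {-T..T} F"
    using set_borel_integral_eq_integral(2)[of "{-T..T}" F] integrable_mult_indicator[OF _ Fint, of "{-T..T}"]
    by (simp add: set_integrable_def set_lebesgue_integral_def)
  finally have "norm (\<integral>t. F t \<partial>lborel)
      \<le> (2 * T * (2 * K * exp (l * y + 1)) + 2 * (b - l) * (2 * K * exp (y + 2) * e))
      + (1 + y) * exp (y + 2) * e * (4 / \<sigma>)"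
    using inside outside norm_triangle_ineq by (smt (verit))
  moreover have "norm (\<integral>t. F t \<partial>lborel) = 2 * pi * \<bar>\<integral>v. h v * normal_density y \<sigma> v \<partial>lborel\<bar>"
    unfolding Feq norm_of_real by (simp add: abs_mult)
  moreover have "2 * pi * \<bar>\<integral>v. h v * normal_density y \<sigma> v \<partial>lborel\<bar> \<ge> 1 * \<bar>\<integral>v. h v
      * normal_density y \<sigma> v \<partial>lborel\<bar>"
    using pi_ge_two by (intro mult_right_mono) auto
  moreover have "2 * (b - l) * (2 * K * exp (y + 2) * e) \<le> 4 * (2 * K * exp (y + 2) * e)"
    using b l K by (intro mult_right_mono) (auto simp: e_def)
  ultimately have
      "\<bar>\<integral>v. h v * normal_density y \<sigma> v \<partial>lborel\<bar>
      \<le> 4 * T * K * exp (l * y + 1) + (8 * K + 4 * (1 + y) / \<sigma>) * exp (y + 2) * e"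
    by (simp add: algebra_simps add_divide_distrib)
  then have "\<bar>h y\<bar> \<le> 3 * \<sigma> * exp y + 1 + 4 * T * K * exp (l * y + 1) + (8 * K + 4 * (1 + y) / \<sigma>)
      * exp (y + 2) * e"
    using smooth by linarith
  then show ?thesis by (simp add: h_def e_def)
qed

section \<open>Partial sums of the twisted Moebius function\<close>

context bounded_character begin

text \<open>With L = y^(2/5), T = exp L and \<sigma> = T^(-1/2), the product \<sigma> T = T^(1/2)
  makes the Gaussian factor doubly exponentially small, and the shifted line gains exp(-c y / L) =
  exp(-c y^(3/5)), which beats the factor T. The smoothing error, relatively exp(-L / 2), dominates
  and is absorbed since 1/3 < 2/5.\<close>

lemma partial_sum_mu_bigo:
  assumes nz: "dirichlet_cont \<psi> \<kappa> 1 \<noteq> 0"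
  shows "(\<lambda>y. partial_sum (\<lambda>n. moebius_mu n * \<psi> n) (exp y)) \<in> O(\<lambda>y. exp (y - y powr (1/3)))"
proof -
  obtain c K where c: "0 < c" "c \<le> 1 / 2" and K: "0 < K" and
    inv: "\<And>T s. T \<ge> 3 \<Longrightarrow> \<bar>Im s\<bar> \<le> T \<Longrightarrow> 1 - c / ln T \<le> Re s \<Longrightarrow> Re s \<le> 2 \<Longrightarrow>
        dirichlet_cont \<psi> \<kappa> s \<noteq> 0 \<and> norm ((s - 1) ^ \<kappa> / dirichlet_cont \<psi> \<kappa> s) \<le> K * ln T"
    using inverse_cont_bound[OF nz] by blast
  let ?a = "\<lambda>n. moebius_mu n * \<psi> n"
  define bound where "bound y = 3 * exp (- (y powr (2/5)) / 2) * exp y + 1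
     + 4 * exp (y powr (2/5)) * (K * y powr (2/5)) * exp ((1 - c / y powr (2/5)) * y + 1)
     + (8 * (K * y powr (2/5)) + 4 * (1 + y) / exp (- (y powr (2/5)) / 2)) * exp (y + 2) * exp
         (- (exp (y powr (2/5)) / 4))" for y :: real
  \<comment> \<open>32 = 4^(5/2) gives L \<ge> 4, enough for T \<ge> 3, \<sigma> \<le> 1/2 and c / L
    < 1/2.\<close>
  have ev: "\<bar>partial_sum ?a (exp y)\<bar> \<le> bound y" if y: "y \<ge> 32" for y
  proof -
    define L where "L = y powr (2/5)"
    define T where "T = exp L"
    define \<sigma> where "\<sigma> = exp (- L / 2)"
    have "(32::real) powr (2/5) \<le> L" unfolding L_def using y by (intro powr_mono2) auto
    moreover have "(32::real) powr (2/5) = 4"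
    proof -
      have "(32::real) = 2 powr 5" by (simp flip: powr_realpow)
      then have "(32::real) powr (2/5) = 2 powr 2" by (simp add: powr_powr)
      then show ?thesis by (simp flip: powr_realpow)
    qed
    ultimately have L: "L \<ge> 4" by simp
    have T: "T \<ge> 3" "ln T = L"
    proof -
      show "T \<ge> 3" unfolding T_def using exp_ge_add_one_self[of L] L by linarith
    qed (simp add: T_def)
    have \<sigma>: "0 < \<sigma>" "\<sigma> \<le> 1 / 2"
    proof -
      have "1 + L / 2 \<le> exp (L / 2)" by (rule exp_ge_add_one_self)
      then have "2 \<le> exp (L / 2)" using L by linarith
      then show "\<sigma> \<le> 1 / 2" using le_imp_inverse_le[of 2 "exp (L / 2)"] by (simp add: \<sigma>_def exp_minus)
    qed (simp add: \<sigma>_def)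
    have "\<sigma>\<^sup>2 = exp (- L)" by (simp add: \<sigma>_def power2_eq_square flip: exp_add)
    then have \<sigma>T: "\<sigma>\<^sup>2 * T\<^sup>2 / 4 = exp L / 4" by (simp add: T_def power2_eq_square flip: exp_add)
    have l: "1 / 2 \<le> 1 - c / L" "1 - c / L < 1"
    proof -
      have "c / L \<le> (1 / 2) / 1" using c L by (intro frac_le) auto
      then show "1 / 2 \<le> 1 - c / L" by simp
    qed (use c L in simp)
    have "\<bar>partial_sum ?a (exp y)\<bar> \<le> 3 * \<sigma> * exp y + 1 + 4 * T * (K * L) * exp ((1 - c / L) * y + 1)
     + (8 * (K * L) + 4 * (1 + y) / \<sigma>) * exp (y + 2) * exp (- (\<sigma>\<^sup>2 * T\<^sup>2 / 4))"
    proof (rule partial_sum_gaussian_bound[where B = "\<lambda>s. (s - 1) ^ \<kappa> / dirichlet_cont \<psi> \<kappa> s"])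
      show "\<bar>?a n\<bar> \<le> 1" if "n > 0" for n using abs_mu_\<psi>_le that .
      show "(\<lambda>s. (s - 1) ^ \<kappa> / dirichlet_cont \<psi> \<kappa> s)
          holomorphic_on {s. 1 - c / L \<le> Re s \<and> Re s \<le> 2 \<and> \<bar>Im s\<bar> \<le> T}"
      proof (intro holomorphic_intros)
        have "c / L < 1 / 2"
        proof -
          have "c / L \<le> (1 / 2) / 4" using c L by (intro frac_le) auto
          also have "\<dots> < (1 / 2 :: real)" by simp
          finally show ?thesis .
        qed
        then show "dirichlet_cont \<psi> \<kappa> holomorphic_on {s. 1 - c / L \<le> Re s \<and> Re s \<le> 2 \<and> \<bar>Im s\<bar> \<le> T}"
          by (intro holomorphic_on_subset[OF holomorphic_cont]) auto
      qed (use inv[of T] T in auto)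
      show "norm ((s - 1) ^ \<kappa> / dirichlet_cont \<psi> \<kappa> s) \<le> K * L"
        if "1 - c / L \<le> Re s" "Re s \<le> 2" "\<bar>Im s\<bar> \<le> T" for s
        using inv[of T s] that T by simp
      show "(s - 1) ^ \<kappa> / dirichlet_cont \<psi> \<kappa> s = dirichlet_series ?a s" if "1 < Re s" for s
      proof -
        have "s \<noteq> 1" using that by auto
        then have "(s - 1) ^ \<kappa> / dirichlet_cont \<psi> \<kappa> s = 1 / dirichlet_series \<psi> s" using that
            by (simp add: cont_eq_dirichlet_series)
        also have "\<dots> = dirichlet_series ?a s"
            using dirichlet_series_mu_inverse[OF that] norm_dirichlet_series_ge(2)[OF that]
            by (simp add: field_simps)
        finally show ?thesis .
      qed
    qed (use y \<sigma> T l K L in auto)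
    then show ?thesis unfolding \<sigma>T by (simp add: bound_def T_def \<sigma>_def L_def)
  qed
  have "(\<lambda>y. partial_sum ?a (exp y)) \<in> O(bound)"
    by (rule landau_o.big_mono)
        (use ev in \<open>auto intro!: eventually_at_top_linorderI[of 32] order_trans[OF _ abs_ge_self]\<close>)
  also have "bound \<in> O(\<lambda>y. exp (y - y powr (1/3)))"
    unfolding bound_def using c K by real_asymp
  finally show ?thesis .
qed

end

section \<open>A character with small partial sums\<close>

text \<open>Stripping factors of 3 encodes the value 1 at 3; the clause at 0 lets this recursion
  terminate.\<close>

fun g3 :: "nat \<Rightarrow> real" where
  "g3 n = (if n = 0 then 0 else if 3 dvd n then g3 (n div 3) else if n mod 3 = 1 then 1 else - 1)"

declare g3.simps [simp del]

lemma g3_triple: "n > 0 \<Longrightarrow> g3 (3 * n) = g3 n"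
  by (subst g3.simps) auto

lemma g3_not_dvd: "\<not> 3 dvd n \<Longrightarrow> g3 n = (if n mod 3 = 1 then 1 else - 1)"
  by (cases "n = 0") (simp_all add: g3.simps[of n])

lemma g3_cases: "n > 0 \<Longrightarrow> g3 n = 1 \<or> g3 n = - 1"
proof (induction n rule: less_induct)
  case (less n)
  show ?case
  proof (cases "3 dvd n")
    case True
    then obtain m where "n = 3 * m" by auto
    then show ?thesis using less by (auto simp: g3_triple)
  qed (auto simp: g3_not_dvd)
qed

text \<open>Factors of 3 are removed by induction on m + n; without them only residues modulo 3
  matter.\<close>

lemma g3_mult: "m > 0 \<Longrightarrow> n > 0 \<Longrightarrow> g3 (m * n) = g3 m * g3 n"
proof (induction "m + n" arbitrary: m n rule: less_induct)
  case less
  consider (m) m' where "m = 3 * m'" | (n) n' where "n = 3 * n'" | (none) "\<not> 3 dvd m" "\<not> 3 dvd n" by auto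
  then show ?case
  proof cases
    case m
    then have "g3 (m' * n) = g3 m' * g3 n" using less by auto
    moreover have "m * n = 3 * (m' * n)" using m by simp
    ultimately show ?thesis using m less.prems by (simp only: g3_triple) (simp add: g3_triple)
  next
    case n
    then have "g3 (m * n') = g3 m * g3 n'" using less by auto
    moreover have "m * n = 3 * (m * n')" using n by simp
    ultimately show ?thesis using n less.prems by (simp only: g3_triple) (simp add: g3_triple)
  next
    case none
    have "m mod 3 = 1 \<or> m mod 3 = 2" "n mod 3 = 1 \<or> n mod 3 = 2"
      using none by (auto simp: dvd_eq_mod_eq_0)
    moreover have "(m * n) mod 3 = ((m mod 3) * (n mod 3)) mod 3" by (simp add: mod_mult_eq)
    moreover have "\<not> 3 dvd m * n" using none by (simp add: prime_dvd_mult_iff)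
    ultimately show ?thesis using none by (auto simp: g3_not_dvd)
  qed
qed

text \<open>Terms prime to 3 cancel in consecutive pairs with residues 1 and 2, leaving 1 only if N
  stops inside a pair; the multiples of 3 repeat the sum up to \<open>N div 3\<close>.\<close>

lemma char_sum_g3_rec: "char_sum g3 N = char_sum g3 (N div 3) + (if N mod 3 = 1 then 1 else 0)"
proof (induction N)
  case (Suc N)
  consider "N mod 3 = 0" | "N mod 3 = 1" | "N mod 3 = 2" by linarith
  then show ?case
  proof cases
    case 1
    then have "Suc N mod 3 = 1" "Suc N div 3 = N div 3" by (auto simp: mod_Suc div_Suc)
    moreover from this have "g3 (Suc N) = 1" by (subst g3_not_dvd) (auto simp: dvd_eq_mod_eq_0)
    ultimately show ?thesis using Suc 1 by (simp add: char_sum_Suc)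
  next
    case 2
    then have "Suc N mod 3 = 2" "Suc N div 3 = N div 3" by (auto simp: mod_Suc div_Suc)
    moreover from this have "g3 (Suc N) = - 1" by (subst g3_not_dvd) (auto simp: dvd_eq_mod_eq_0)
    ultimately show ?thesis using Suc 2 by (simp add: char_sum_Suc)
  next
    case 3
    then have *: "Suc N = 3 * Suc (N div 3)" using div_mult_mod_eq[of N 3] by simp
    then have "g3 (Suc N) = g3 (Suc (N div 3))" by (metis g3_triple zero_less_Suc)
    moreover have "Suc N div 3 = Suc (N div 3)" "Suc N mod 3 = 0" using 3 by (auto simp: mod_Suc div_Suc)
    ultimately show ?thesis using Suc 3 by (simp add: char_sum_Suc)
  qed
qed (simp add: char_sum_def)

text \<open>Each ternary digit adds at most 1, and 1 \<le> ln 3 pays for it. The nonnegativity is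
  what later forces the series to be nonzero at 1.\<close>

lemma char_sum_g3_bounds:
  "0 \<le> char_sum g3 N" "N > 0 \<Longrightarrow> char_sum g3 N \<le> 1 + ln (real N)"
proof (induction N rule: less_induct)
  case (less N)
  {
    case 1
    show ?case
    proof (cases "N = 0")
      case False
      then show ?thesis using less(1)[of "N div 3"] by (subst char_sum_g3_rec) auto
    qed (simp add: char_sum_def)
  next
    case 2
    show ?case
    proof (cases "N div 3 = 0")
      case True
      then show ?thesis using 2 by (subst char_sum_g3_rec) (auto simp: char_sum_def)
    next
      case False
      have "(1::real) \<le> ln 3" by (rule one_le_ln) simp
      moreover have "char_sum g3 (N div 3) \<le> 1 + ln (real (N div 3))"
          using less(2)[of "N div 3"] 2 False by auto
      moreover have "ln (real (N div 3)) \<le> ln (real N / 3)"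
      proof (intro ln_mono)
        have "3 * (N div 3) \<le> N" by simp
        then show "real (N div 3) \<le> real N / 3" by linarith
        show "0 < real (N div 3)" using False by simp
      qed
      moreover have "ln (real N / 3) = ln (real N) - ln 3" using 2 by (simp add: ln_div)
      ultimately show ?thesis by (subst char_sum_g3_rec) auto
    qed
  }
qed

lemma abs_char_sum_g3_le:
  assumes "N > 0"
  shows "\<bar>char_sum g3 N\<bar> \<le> 2 * sqrt (real N)"
proof -
  have "ln (real N) = 2 * ln (sqrt (real N))" using assms by (simp add: ln_sqrt)
  also have "\<dots> \<le> 2 * (sqrt (real N) - 1)" using assms by (intro mult_left_mono ln_le_minus_one) auto
  finally show ?thesis using char_sum_g3_bounds[of N] assms by simp
qed

interpretation g3: bounded_character g3 0 2
  by unfold_locales (use g3_mult g3_cases abs_char_sum_g3_le in auto)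

lemma npow_one: "n > 0 \<Longrightarrow> npow n 1 = of_real (1 / real n)"
  using npow_of_real[of n 1] by (simp add: powr_minus_divide)

text \<open>In the series obtained by Abel summation every term at 1 is nonnegative, because the
  partial sums of \<open>g3\<close> are, and the first term is positive.\<close>

lemma cont_g3_nonzero: "dirichlet_cont g3 0 1 \<noteq> 0"
proof -
  define r where "r n = char_sum g3 (Suc n) * (1 / real (Suc n) - 1 / real (Suc (Suc n)))" for n
  have r: "cont_term g3 0 (Suc n) 1 = of_real (r n)" for n
    by (simp add: cont_term_def npow_one r_def)
  have "summable (\<lambda>n. norm (cont_term g3 0 (Suc n) 1))"
  proof (rule summable_comparison_test')
    show "summable (\<lambda>n. 12 * real (Suc n) powr (- (3 / 2)))"
      using summable_Suc_powr(1)[of "3/2"] by (intro summable_mult) auto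
    show "norm (norm (cont_term g3 0 (Suc n) 1)) \<le> 12 * real (Suc n) powr (- (3 / 2))" for n
      using g3.norm_cont_term_le[of "Suc n" 1] by simp
  qed
  then have sm: "summable r" unfolding r norm_of_real by (rule summable_rabs_cancel)
  moreover have "0 \<le> r n" for n
    unfolding r_def using char_sum_g3_bounds(1)[of "Suc n"] by (intro mult_nonneg_nonneg) (auto simp: frac_le)
  moreover have "0 < r 0"
  proof -
    have "g3 (Suc 0) = 1" by (simp add: g3_not_dvd)
    moreover have "{0<..Suc 0} = {Suc 0}" by auto
    ultimately show ?thesis by (simp add: r_def char_sum_def)
  qed
  ultimately have "suminf r > 0" by (rule suminf_pos2)
  moreover have "dirichlet_cont g3 0 1 = of_real (suminf r)"
    using sm by (simp add: dirichlet_cont_def r suminf_of_real)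
  ultimately show ?thesis by simp
qed

text \<open>At s = 1 every \<open>cont_term\<close> vanishes, its first part because of the factor s
  - 1 and its second because n^0 is constant. What remains is 1, the residue of zeta.\<close>

lemma cont_one_nonzero: "dirichlet_cont (\<lambda>_. 1) 1 1 \<noteq> 0"
  by (simp add: dirichlet_cont_def cont_term_def npow_def)

section \<open>The hyperbola method\<close>

lemma partial_sum_mu_g3_bigo:
    "(\<lambda>y. partial_sum (\<lambda>n. moebius_mu n * g3 n ^ k) (exp y)) \<in> O(\<lambda>y. exp (y - y powr (1/3)))"
proof (cases "even k")
  case True
  have "g3 n ^ k = 1" if "n > 0" for n using g3_cases[OF that] True by auto
  then have "partial_sum (\<lambda>n. moebius_mu n * g3 n ^ k) u = partial_sum (\<lambda>n. moebius_mu n * 1) u" for u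
    unfolding partial_sum_def by (intro sum.cong) auto
  then show ?thesis using zeta.partial_sum_mu_bigo[OF cont_one_nonzero] by simp
next
  case False
  have "g3 n ^ k = g3 n" if "n > 0" for n using g3_cases[OF that] False by auto
  then have "partial_sum (\<lambda>n. moebius_mu n * g3 n ^ k) u = partial_sum (\<lambda>n. moebius_mu n * g3 n) u" for u
    unfolding partial_sum_def by (intro sum.cong) auto
  then show ?thesis using g3.partial_sum_mu_bigo[OF cont_g3_nonzero] by simp
qed

lemma partial_sum_g3_le:
  assumes "u > 0" "u \<le> x" "x \<ge> 1"
  shows "\<bar>partial_sum g3 u\<bar> \<le> 1 + ln x"
proof -
  have eq: "partial_sum g3 u = char_sum g3 (nat \<lfloor>u\<rfloor>)"
    using assms by (simp add: partial_sum_def char_sum_def pos_nat_le_eq)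
  show ?thesis
  proof (cases "nat \<lfloor>u\<rfloor> = 0")
    case True
    then show ?thesis using assms by (simp add: eq char_sum_def)
  next
    case False
    then have "ln (real (nat \<lfloor>u\<rfloor>)) \<le> ln x" using assms by (intro ln_mono) linarith+
    then show ?thesis using char_sum_g3_bounds[of "nat \<lfloor>u\<rfloor>"] False by (simp add: eq)
  qed
qed

text \<open>\<open>sum_mu_power_dvd\<close> detects the k-free n, and n = d^k m reindexes the pairs;
  complete multiplicativity splits \<open>g3 n\<close> accordingly.\<close>

lemma partial_sum_k_free:
  assumes "k > 0"
  shows "partial_sum (\<lambda>n. if k_free k n then g3 n else 0) x =
    (\<Sum>(d, m) | d > 0 \<and> m > 0 \<and> real (d ^ k * m) \<le> x. (moebius_mu d * g3 d ^ k) * g3 m)"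
proof -
  have g3_pow: "g3 (d ^ j) = g3 d ^ j" if "d > 0" for d j
  proof (induction j)
    case 0
    show ?case by (simp add: g3_not_dvd)
  qed (use that in \<open>simp add: g3_mult\<close>)
  have fin: "finite {d. d ^ k dvd n}" if "n > 0" for n :: nat
    using finite_power_dvd that assms .
  have pos: "d > 0" "n div d ^ k > 0" if "n > 0" "d ^ k dvd n" for d n :: nat
    using that assms by (auto simp: dvd_div_eq_0_iff power_0_left intro!: Nat.gr0I)
  have "partial_sum (\<lambda>n. if k_free k n then g3 n else 0) x
      = (\<Sum>n | n > 0 \<and> real n \<le> x. \<Sum>d | d ^ k dvd n. (moebius_mu d * g3 d ^ k) * g3 (n div d ^ k))"
    unfolding partial_sum_def
  proof (rule sum.cong[OF refl])
    fix n assume n: "n \<in> {n. n > 0 \<and> real n \<le> x}"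
    have "(\<Sum>d | d ^ k dvd n. (moebius_mu d * g3 d ^ k) * g3 (n div d ^ k))
        = (\<Sum>d | d ^ k dvd n. moebius_mu d * g3 n)"
    proof (rule sum.cong[OF refl])
      fix d assume d: "d \<in> {d. d ^ k dvd n}"
      then have "g3 (d ^ k * (n div d ^ k)) = g3 (d ^ k) * g3 (n div d ^ k)"
        using pos[of n d] n by (intro g3_mult) auto
      then show "(moebius_mu d * g3 d ^ k) * g3 (n div d ^ k) = moebius_mu d * g3 n"
        using d pos[of n d] n by (simp add: g3_pow)
    qed
    also have "\<dots> = g3 n * (\<Sum>d | d ^ k dvd n. moebius_mu d)" by (simp add: sum_distrib_left mult.commute)
    also have "\<dots> = (if k_free k n then g3 n else 0)" using n assms by (simp add: sum_mu_power_dvd)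
    finally show "(if k_free k n then g3 n else 0)
        = (\<Sum>d | d ^ k dvd n. (moebius_mu d * g3 d ^ k) * g3 (n div d ^ k))" by simp
  qed
  also have "\<dots> = (\<Sum>(n, d)\<in>(SIGMA n:{n. n > 0 \<and> real n \<le> x}. {d. d ^ k dvd n}). (moebius_mu d * g3 d ^ k)
      * g3 (n div d ^ k))"
    by (rule sum.Sigma) (use fin finite_pos_nat_le in auto)
  also have "\<dots> = (\<Sum>(d, m) | d > 0 \<and> m > 0 \<and> real (d ^ k * m) \<le> x. (moebius_mu d * g3 d ^ k) * g3 m)"
    by (rule sum.reindex_bij_witness[of _ "\<lambda>(d, m). (d ^ k * m, d)" "\<lambda>(n, d). (d, n div d ^ k)"])
       (use pos in \<open>auto simp del: of_nat_mult of_nat_power\<close>)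
  finally show ?thesis .
qed

text \<open>Cut at d = Y. For d \<le> Y the sum over m is a partial sum of \<open>g3\<close>, hence
  logarithmic. For d > Y the variable m is confined to m \<le> x / Y^k, and the cancellation is that
  of \<open>moebius_mu d * g3 d ^ k\<close> for d between Y and (x / m)^(1/k).
  \<open>\<delta>\<close> is a saving valid for every u \<ge> Y.\<close>

lemma hyperbola_bound:
  fixes x Y B \<delta> :: real
  assumes k: "k > 0" and x: "x \<ge> 1" and Y: "Y \<ge> 1" "Y \<le> x powr (1 / real k)"
    and H: "\<And>u. u \<ge> Y \<Longrightarrow> \<bar>partial_sum (\<lambda>n. moebius_mu n * g3 n ^ k) u\<bar> \<le> B * u * \<delta>" and B: "B \<ge> 0" "\<delta> \<ge> 0"
  shows "\<bar>partial_sum (\<lambda>n. if k_free k n then g3 n else 0) x\<bar>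
      \<le> Y * (1 + ln x) + x / Y ^ k * (2 * B * x powr (1 / real k) * \<delta>)"
proof -
  define h where "h n = moebius_mu n * g3 n ^ k" for n
  define P where "P = {(d, m). d > 0 \<and> m > 0 \<and> real (d ^ k * m) \<le> x}"
  define P1 where "P1 = (SIGMA d:{d. d > 0 \<and> real d \<le> Y}. {m. m > 0 \<and> real m \<le> x / real d ^ k})"
  define M where "M = {m::nat. m > 0 \<and> real m \<le> x / Y ^ k}"
  define D where "D m = {d. Y < real d \<and> real d \<le> (x / real m) powr (1 / real k)}" for m :: nat
  have root: "real d \<le> (x / real m) powr (1 / real k) \<longleftrightarrow> real d ^ k \<le> x / real m" if "d > 0" "m > 0"
      for d m :: nat
  proof -
    have "real d = (real d ^ k) powr (1 / real k)"
      using that k by (simp flip: powr_realpow add: powr_powr)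
    then have "real d \<le> (x / real m) powr (1 / real k) \<longleftrightarrow> (real d ^ k) powr (1 / real k)
        \<le> (x / real m) powr (1 / real k)" by simp
    also have "\<dots> \<longleftrightarrow> real d ^ k \<le> x / real m"
      using powr_mono2[of "1 / real k" "real d ^ k" "x / real m"]
          powr_less_mono2[of "1 / real k" "x / real m" "real d ^ k"] that k x
      by (cases "real d ^ k \<le> x / real m") auto
    finally show ?thesis .
  qed
  have rootY: "Y \<le> (x / real m) powr (1 / real k)" if "m \<in> M" for m
  proof -
    have "Y = (Y ^ k) powr (1 / real k)" using Y k by (simp flip: powr_realpow add: powr_powr)
    also have "\<dots> \<le> (x / real m) powr (1 / real k)"
      using that Y by (intro powr_mono2) (auto simp: M_def field_simps)
    finally show ?thesis .
  qed
  have finD: "finite (D m)" for m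
    by (rule finite_subset[OF _ finite_pos_nat_le[of "(x / real m) powr (1 / real k)"]])
        (use Y in \<open>auto simp: D_def\<close>)
  have finM: "finite M" unfolding M_def by (rule finite_pos_nat_le)
  \<comment> \<open>The second part is fibred over m, so that d becomes the inner variable of
    summation.\<close>
  have P_eq: "P = P1 \<union> (\<lambda>(m, d). (d, m)) ` (SIGMA m:M. D m)"
  proof (intro equalityI subsetI)
    fix p assume "p \<in> P"
    then obtain d m where p: "p = (d, m)" "d > 0" "m > 0" "real d ^ k * real m \<le> x" by (auto simp: P_def)
    show "p \<in> P1 \<union> (\<lambda>(m, d). (d, m)) ` (SIGMA m:M. D m)"
    proof (cases "real d \<le> Y")
      case True
      then show ?thesis using p by (auto simp: P1_def field_simps)
    next
      case False
      have "real d \<le> (x / real m) powr (1 / real k)" using p root by (simp add: field_simps)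
      moreover have "real m \<le> x / Y ^ k"
      proof -
        have "Y ^ k * real m \<le> real d ^ k * real m" using False Y by (intro mult_right_mono power_mono) auto
        then have "Y ^ k * real m \<le> x" using p(4) by linarith
        then show ?thesis using Y by (simp add: pos_le_divide_eq mult.commute)
      qed
      ultimately show ?thesis using False p by (auto simp: M_def D_def image_iff)
    qed
  next
    fix p assume p: "p \<in> P1 \<union> (\<lambda>(m, d). (d, m)) ` (SIGMA m:M. D m)"
    then consider d m where "p = (d, m)" "d > 0" "m > 0" "real m \<le> x / real d ^ k" | d m where
        "p = (d, m)" "m \<in> M" "d \<in> D m"
      by (auto simp: P1_def)
    then show "p \<in> P"
    proof cases
      case 1
      then show ?thesis by (simp add: P_def field_simps)
    next
      case 2
      then have "d > 0" "m > 0" using Y by (auto simp: D_def M_def)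
      then show ?thesis using 2 root[of d m] by (simp add: P_def D_def field_simps)
    qed
  qed
  have "finite P1" unfolding P1_def by (intro finite_SigmaI finite_pos_nat_le)
  moreover have "P1 \<inter> (\<lambda>(m, d). (d, m)) ` (SIGMA m:M. D m) = {}" by (auto simp: P1_def D_def)
  ultimately have
      "(\<Sum>(d, m)\<in>P. h d * g3 m) = (\<Sum>(d, m)\<in>P1. h d * g3 m)
      + (\<Sum>(d, m)\<in>(\<lambda>(m, d). (d, m)) ` (SIGMA m:M. D m). h d * g3 m)"
    unfolding P_eq using finM finD by (intro sum.union_disjoint) auto
  also have "(\<Sum>(d, m)\<in>P1. h d * g3 m) = (\<Sum>d | d > 0 \<and> real d \<le> Y. h d * partial_sum g3 (x / real d ^ k))"
    unfolding P1_def partial_sum_def sum_distrib_left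
    by (rule sum.Sigma[symmetric]) (use finite_pos_nat_le in auto)
  also have "(\<Sum>(d, m)\<in>(\<lambda>(m, d). (d, m)) ` (SIGMA m:M. D m). h d * g3 m)
      = (\<Sum>(m, d)\<in>(SIGMA m:M. D m). h d * g3 m)"
    by (subst sum.reindex) (auto simp: inj_on_def intro!: sum.cong)
  also have "\<dots> = (\<Sum>m\<in>M. \<Sum>d\<in>D m. h d * g3 m)"
    by (rule sum.Sigma[symmetric]) (use finM finD in auto)
  also have "\<dots> = (\<Sum>m\<in>M. g3 m * (partial_sum h ((x / real m) powr (1 / real k)) - partial_sum h Y))"
  proof (rule sum.cong[OF refl])
    fix m assume m: "m \<in> M"
    have "{n. n > 0 \<and> real n \<le> (x / real m) powr (1 / real k)} = {n. n > 0 \<and> real n \<le> Y} \<union> D m"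
      using rootY[OF m] Y by (auto simp: D_def)
    moreover have "{n. n > 0 \<and> real n \<le> Y} \<inter> D m = {}" by (auto simp: D_def)
    ultimately have "partial_sum h ((x / real m) powr (1 / real k)) = partial_sum h Y + sum h (D m)"
      unfolding partial_sum_def using finD finite_pos_nat_le by (simp add: sum.union_disjoint)
    then show "(\<Sum>d\<in>D m. h d * g3 m) = g3 m
        * (partial_sum h ((x / real m) powr (1 / real k)) - partial_sum h Y)"
      by (simp add: sum_distrib_left mult.commute)
  qed
  finally have eq:
      "partial_sum (\<lambda>n. if k_free k n then g3 n else 0) x
      = (\<Sum>d | d > 0 \<and> real d \<le> Y. h d * partial_sum g3 (x / real d ^ k))
      + (\<Sum>m\<in>M. g3 m * (partial_sum h ((x / real m) powr (1 / real k)) - partial_sum h Y))"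
    using partial_sum_k_free[OF k, of x] by (simp add: P_def h_def)
  have h1: "\<bar>h n\<bar> \<le> 1" if "n > 0" for n
    using abs_mu_le[of n] g3_cases[OF that] by (auto simp: h_def abs_mult power_abs)
  have card_le: "real (card {n::nat. n > 0 \<and> real n \<le> u}) \<le> u" if "u \<ge> 0" for u
    using abs_partial_sum_le[of "\<lambda>_. 1" u] that by (simp add: partial_sum_def)
  have "\<bar>\<Sum>d | d > 0 \<and> real d \<le> Y. h d * partial_sum g3 (x / real d ^ k)\<bar>
      \<le> (\<Sum>d | d > 0 \<and> real d \<le> Y. 1 + ln x)"
  proof (rule order_trans[OF sum_abs sum_mono])
    fix d assume "d \<in> {d. d > 0 \<and> real d \<le> Y}"
    then have d: "d > 0" by simp
    have "x / real d ^ k \<le> x / 1" using d x by (intro divide_left_mono) (auto simp: one_le_power)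
    then have "\<bar>partial_sum g3 (x / real d ^ k)\<bar> \<le> 1 + ln x" using d x by (intro partial_sum_g3_le) auto
    then show "\<bar>h d * partial_sum g3 (x / real d ^ k)\<bar> \<le> 1 + ln x"
      unfolding abs_mult
          using h1[OF d] mult_mono[of "\<bar>h d\<bar>" 1 "\<bar>partial_sum g3 (x / real d ^ k)\<bar>" "1 + ln x"] by simp
  qed
  also have "\<dots> = real (card {d::nat. d > 0 \<and> real d \<le> Y}) * (1 + ln x)" by simp
  also have "\<dots> \<le> Y * (1 + ln x)" using card_le[of Y] Y x by (intro mult_right_mono) auto
  finally have 1: "\<bar>\<Sum>d | d > 0 \<and> real d \<le> Y. h d * partial_sum g3 (x / real d ^ k)\<bar> \<le> Y * (1 + ln x)" .
  have "\<bar>\<Sum>m\<in>M. g3 m * (partial_sum h ((x / real m) powr (1 / real k)) - partial_sum h Y)\<bar>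
      \<le> (\<Sum>m\<in>M. 2 * B * x powr (1 / real k) * \<delta>)"
  proof (rule order_trans[OF sum_abs sum_mono])
    fix m assume m: "m \<in> M"
    then have m0: "m > 0" by (simp add: M_def)
    let ?X = "x powr (1 / real k)"
    have X: "(x / real m) powr (1 / real k) \<le> ?X"
      using m0 x by (intro powr_mono2) (auto simp: field_simps)
    have "\<bar>partial_sum h u\<bar> \<le> B * ?X * \<delta>" if "Y \<le> u" "u \<le> ?X" for u
    proof -
      have "\<bar>partial_sum h u\<bar> \<le> B * u * \<delta>" using H[OF that(1)] by (simp add: h_def[abs_def])
      also have "\<dots> \<le> B * ?X * \<delta>" using B that by (intro mult_right_mono mult_left_mono) auto
      finally show ?thesis .
    qed
    from this[OF rootY[OF m] X] this[OF order_refl Y(2)]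
    have "\<bar>partial_sum h ((x / real m) powr (1 / real k)) - partial_sum h Y\<bar> \<le> 2 * B * ?X * \<delta>" by linarith
    then show "\<bar>g3 m * (partial_sum h ((x / real m) powr (1 / real k)) - partial_sum h Y)\<bar> \<le> 2 * B * ?X * \<delta>"
      using g3_cases[OF m0] by (auto simp: abs_mult)
  qed
  also have "\<dots> = real (card M) * (2 * B * x powr (1 / real k) * \<delta>)" by simp
  also have "\<dots> \<le> x / Y ^ k * (2 * B * x powr (1 / real k) * \<delta>)"
    unfolding M_def using card_le[of "x / Y ^ k"] x Y B by (intro mult_right_mono) auto
  finally show ?thesis unfolding eq using 1 by linarith
qed

text \<open>For x = exp v the cut is Y = x^(1/k) exp(-2 v^(1/4)). Small d then give the required
  saving with a spare exp(-v^(1/4)) to absorb 1 + v. Large d cost x / Y^k = exp(2 k v^(1/4)), which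
  a saving of exp(-r v^(1/3)) outweighs.\<close>

lemma partial_sum_k_free_bigo:
  assumes k: "k > 0"
  shows "(\<lambda>x. partial_sum (\<lambda>n. if k_free k n then g3 n else 0) x)
     \<in> O(\<lambda>x. x powr (1 / real k) / exp (1 * ln x powr (1 / 4)))"
proof -
  define a where "a = real k"
  have a: "a > 0" using k by (simp add: a_def)
  obtain B where B: "B > 0"
      "\<forall>\<^sub>F y in at_top. norm (partial_sum (\<lambda>n. moebius_mu n * g3 n ^ k) (exp y))
      \<le> B * norm (exp (y - y powr (1/3)))"
    using partial_sum_mu_g3_bigo[of k] by (auto elim!: landau_o.bigE)
  then obtain y0 where y0:
      "\<And>y. y \<ge> y0 \<Longrightarrow> \<bar>partial_sum (\<lambda>n. moebius_mu n * g3 n ^ k) (exp y)\<bar> \<le> B * exp (y - y powr (1/3))"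
    by (auto simp: eventually_at_top_linorder)
  define w where "w v = v / a - 2 * v powr (1/4)" for v :: real
  \<comment> \<open>Chosen so that w v \<ge> v / (2 a) yields
    \<open>w v powr (1/3) \<ge> r * v powr (1/3)\<close>.\<close>
  define r where "r = (1 / (2 * a)) powr (1/3)"
  have r: "r > 0" using a by (simp add: r_def)
  define q where "q v = exp (- (v powr (1/4))) * (1 + v) + 2 * B
      * exp ((2 * a + 1) * v powr (1/4) - r * v powr (1/3))" for v
  define bnd where "bnd v = exp (v / a - v powr (1/4)) * q v" for v
  have ev: "\<forall>\<^sub>F v in at_top. w v \<ge> v / (2 * a) \<and> w v \<ge> max y0 1 \<and> v \<ge> 1"
  proof -
    have "filterlim (\<lambda>v. w v - v / (2 * a)) at_top at_top" unfolding w_def using a by real_asymp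
    then have "\<forall>\<^sub>F v in at_top. w v - v / (2 * a) \<ge> 0" unfolding filterlim_at_top by blast
    then have 1: "\<forall>\<^sub>F v in at_top. w v \<ge> v / (2 * a)" by eventually_elim simp
    have "filterlim w at_top at_top" unfolding w_def using a by real_asymp
    then show ?thesis using 1 eventually_ge_at_top[of "1::real"]
        by (auto simp: filterlim_at_top eventually_conj_iff)
  qed
  have bound: "\<bar>partial_sum (\<lambda>n. if k_free k n then g3 n else 0) (exp v)\<bar> \<le> bnd v" if v:
      "w v \<ge> v / (2 * a)" "w v \<ge> max y0 1" "v \<ge> 1" for v
  proof -
    define Y where "Y = exp (w v)"
    have xk: "exp v powr (1 / real k) = exp (v / a)" by (simp add: powr_def a_def)
    have "\<bar>partial_sum (\<lambda>n. if k_free k n then g3 n else 0) (exp v)\<bar>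
        \<le> Y * (1 + ln (exp v)) + exp v / Y ^ k * (2 * B * exp v powr (1 / real k) * exp (- (w v powr (1/3))))"
    proof (rule hyperbola_bound[OF k])
      show "\<bar>partial_sum (\<lambda>n. moebius_mu n * g3 n ^ k) u\<bar> \<le> B * u * exp (- (w v powr (1/3)))" if "u \<ge> Y" for u
      proof -
        have u: "u > 0" using that unfolding Y_def by (meson exp_gt_zero less_le_trans)
        have lnu: "ln u \<ge> w v" using that u unfolding Y_def by (simp add: ln_ge_iff)
        have "\<bar>partial_sum (\<lambda>n. moebius_mu n * g3 n ^ k) (exp (ln u))\<bar> \<le> B * exp (ln u - ln u powr (1/3))"
          using v lnu by (intro y0) auto
        also have "\<dots> = B * u * exp (- (ln u powr (1/3)))" using u
        by (simp add: diff_conv_add_uminus exp_add del: add_uminus_conv_diff)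
        also have "\<dots> \<le> B * u * exp (- (w v powr (1/3)))"
          using B u v lnu by (intro mult_left_mono) (auto intro!: powr_mono2)
        finally show ?thesis using u by simp
      qed
    qed (use v B in \<open>auto simp: Y_def xk w_def\<close>)
    moreover have "exp v / Y ^ k = exp (2 * a * v powr (1/4))"
    proof -
      have "Y ^ k = exp (a * w v)" unfolding Y_def a_def by (simp add: exp_of_nat_mult)
      then have "exp v / Y ^ k = exp (v - a * w v)" by (simp add: exp_diff)
      also have "v - a * w v = 2 * a * v powr (1/4)" using a by (simp add: w_def algebra_simps)
      finally show ?thesis .
    qed
    ultimately have "\<bar>partial_sum (\<lambda>n. if k_free k n then g3 n else 0) (exp v)\<bar> \<le> exp (w v) * (1 + v)
        + exp (2 * a * v powr (1/4)) * (2 * B * exp (v / a) * exp (- (w v powr (1/3))))"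
      by (simp only: Y_def xk ln_exp)
    also have "\<dots> \<le> exp (w v) * (1 + v) + exp (2 * a * v powr (1/4))
        * (2 * B * exp (v / a) * exp (- (r * v powr (1/3))))"
    proof (intro add_left_mono mult_left_mono)
      have "r * v powr (1/3) = (v / (2 * a)) powr (1/3)"
        unfolding r_def using a v by (subst powr_mult[symmetric]) auto
      also have "\<dots> \<le> w v powr (1/3)" using a v by (intro powr_mono2) auto
      finally show "exp (- (w v powr (1/3))) \<le> exp (- (r * v powr (1/3)))" by simp
    qed (use B(1) in auto)
    also have "\<dots> = bnd v"
    proof -
      have "exp (w v) = exp (v / a - v powr (1/4)) * exp (- (v powr (1/4)))"
        unfolding exp_add[symmetric] by (simp add: w_def)
      moreover have "exp (2 * a * v powr (1/4)) * exp (v / a) * exp (- (r * v powr (1/3)))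
          = exp (v / a - v powr (1/4)) * exp ((2 * a + 1) * v powr (1/4) - r * v powr (1/3))"
        unfolding exp_add[symmetric] by (simp add: algebra_simps)
      ultimately show ?thesis by (simp add: bnd_def q_def distrib_left mult_ac)
    qed
    finally show ?thesis .
  qed
  have "(\<lambda>v. partial_sum (\<lambda>n. if k_free k n then g3 n else 0) (exp v)) \<in> O(bnd)"
    by (rule landau_o.big_mono, rule eventually_mono[OF ev])
       (use bound in \<open>auto intro: order_trans[OF _ abs_ge_self]\<close>)
  also have "bnd \<in> O(\<lambda>v. exp (v / a - v powr (1/4)))"
  proof -
    have "(\<lambda>v::real. exp (- (v powr (1/4))) * (1 + v)) \<in> O(\<lambda>_. 1 :: real)" by real_asymp
    moreover have "(\<lambda>v. 2 * B * exp ((2 * a + 1) * v powr (1/4) - r * v powr (1/3))) \<in> O(\<lambda>_. 1 :: real)"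
      using a B(1) r by real_asymp
    ultimately have q: "q \<in> O(\<lambda>_. 1)" unfolding q_def by (rule sum_in_bigo)
    have "bnd \<in> O(\<lambda>v. exp (v / a - v powr (1/4)) * 1)"
      unfolding bnd_def by (rule landau_o.big.mult[OF landau_o.big_refl q])
    then show ?thesis by simp
  qed
  finally have "(\<lambda>v. partial_sum (\<lambda>n. if k_free k n then g3 n else 0) (exp v)) \<in>
      O(\<lambda>v. exp (v / a - v powr (1/4)))" .
  then have "(\<lambda>x. partial_sum (\<lambda>n. if k_free k n then g3 n else 0) (exp (ln x))) \<in>
      O(\<lambda>x. exp (ln x / a - ln x powr (1/4)))"
    by (rule landau_o.big.compose) (rule ln_at_top)
  also have "?this \<longleftrightarrow> ?thesis"
  proof (rule landau_o.big.cong_ex)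
    show "\<forall>\<^sub>F x in at_top. partial_sum (\<lambda>n. if k_free k n then g3 n else 0) (exp (ln x))
        = partial_sum (\<lambda>n. if k_free k n then g3 n else 0) x"
      using eventually_gt_at_top[of "0::real"] by eventually_elim simp
    show "\<forall>\<^sub>F x in at_top. exp (ln x / a - ln x powr (1/4))
        = x powr (1 / real k) / exp (1 * ln x powr (1 / 4))"
      using eventually_gt_at_top[of "0::real"] by eventually_elim (simp add: exp_diff powr_def a_def)
  qed
  finally show ?thesis .
qed

section \<open>Multiplicativity on the k-free integers and the choice of \<open>f\<close>\<close>

lemma k_free_mult:
  assumes "coprime m n"
  shows "k_free k (m * n) \<longleftrightarrow> k_free k m \<and> k_free k n"
proof -
  have "p ^ k dvd m * n \<longleftrightarrow> p ^ k dvd m \<or> p ^ k dvd n" if p: "prime p" for p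
  proof
    assume dvd: "p ^ k dvd m * n"
    \<comment> \<open>A prime divides at most one of two coprime factors, so the other one cancels
      from the divisibility.\<close>
    have "coprime p m \<or> coprime p n"
      using assms p by (metis coprime_common_divisor_nat prime_imp_coprime prime_nat_iff less_irrefl)
    then show "p ^ k dvd m \<or> p ^ k dvd n"
      using dvd by (auto simp: coprime_dvd_mult_right_iff coprime_dvd_mult_left_iff)
  qed auto
  then show ?thesis unfolding k_free_def by blast
qed

lemma k_free_prime:
  assumes "prime p" "k \<ge> 2"
  shows "k_free k p"
  unfolding k_free_def
proof (intro allI impI notI)
  fix q assume q: "prime q" "q ^ k dvd p"
  have "q dvd p" using q(2) assms(2) by (metis dvd_power dvd_trans not_numeral_le_zero neq0_conv)
  then have "q = p" using q assms by (simp add: primes_dvd_imp_eq)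
  have "p ^ 2 dvd p" using q(2) assms(2) \<open>q = p\<close> by (metis dvd_trans le_imp_power_dvd)
  then have "p * p \<le> p" using assms(1) by (intro dvd_imp_le) (auto simp: power2_eq_square prime_gt_0_nat)
  then show False using prime_gt_1_nat[OF assms(1)] by simp
qed

theorem theorem1p1:
  fixes k :: nat
  assumes "k \<ge> 2"
  shows "\<exists>(f :: nat \<Rightarrow> complex) (c :: real).
           (\<forall>n>0. f n \<in> {-1, 0, 1}) \<and>
           multiplicative f \<and>
           supported_on_k_free k f \<and>
           (\<forall>p. prime p \<longrightarrow> f p \<in> {-1, 1}) \<and>
           c > 0 \<and>
           (\<lambda>x :: real. \<Sum>n | n > 0 \<and> real n \<le> x. f n)
             \<in> O[at_top](\<lambda>x. complex_of_real
                   (x powr (1 / real k) / exp (c * ln x powr (1 / 4))))"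
proof (intro exI conjI)
  define F where "F n = (if k_free k n then g3 n else 0)" for n
  let ?f = "\<lambda>n. complex_of_real (F n)"
  have "?f n \<in> {-1, 0, 1}" if "n > 0" for n using g3_cases[OF that] by (auto simp: F_def)
  then show "\<forall>n>0. ?f n \<in> {-1, 0, 1}" by blast
  show "multiplicative ?f" unfolding multiplicative_def by (auto simp: F_def k_free_mult g3_mult)
  show "supported_on_k_free k ?f" by (auto simp: supported_on_k_free_def F_def)
  have "?f p \<in> {-1, 1}" if "prime p" for p
    using g3_cases[of p] k_free_prime[OF that assms] prime_gt_0_nat[OF that] by (auto simp: F_def)
  then show "\<forall>p. prime p \<longrightarrow> ?f p \<in> {-1, 1}" by blast
  \<comment> \<open>Fixes the witness c = 1; the factor \<open>1 *\<close> in
    \<open>partial_sum_k_free_bigo\<close> is written to match it.\<close>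
  show "(1::real) > 0" by simp
  have "partial_sum F \<in> O(\<lambda>x. x powr (1 / real k) / exp (1 * ln x powr (1 / 4)))"
    using partial_sum_k_free_bigo[of k] assms by (simp add: F_def[abs_def])
  then show "(\<lambda>x :: real. \<Sum>n | n > 0 \<and> real n \<le> x. ?f n)
             \<in> O[at_top](\<lambda>x. complex_of_real (x powr (1 / real k) / exp (1 * ln x powr (1 / 4))))"
    unfolding partial_sum_def of_real_sum[symmetric] by (simp only: landau_o.big.of_real_iff)
qed

end
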